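(* Consider the downlink transmission method with reverse and forward training and an arbitrary linear precoding function, as described in the context. Let $\mathbf G=\mathbf E^f\mathbf H\mathbf A$ be the effective forward channel, with $(i,j)$-th entry $g_{ij}$, and let $\mathbf x_k^p$ be the vector of forward pilots received by user $k$. Then the following downlink weighted-sum rate (in bits per data-transmission symbol) is achievable during transmission: $$R_\Sigma=\sum_{k=1}^{K}w_k\,\mathbb E\left[C\left(\frac{\big|\mathbb E[g_{kk}\mid\mathbf x_k^p]\big|^2}{1+\sum_{i\ne k}\mathbb E\big[|g_{ki}|^2\,\big|\,\mathbf x_k^p\big]+\mathrm{var}\{g_{kk}\mid\mathbf x_k^p\}}\right)\right],$$ where $C(\theta)=\log_2(1+\theta)$ and the outer expectation is over $\mathbf x_k^p$.
   Context: **System.** A base-station has $M$ antennas and serves $K$ single-antenna users. $\mathbf H$ is the $K\times M$ forward channel matrix with i.i.d. $\mathcal{CN}(0,1)$ entries (zero-mean circularly-symmetric complex Gaussian, unit variance) and $k$-th row $\mathbf h_k^T$. It is constant over a coherence interval of $T$ symbols and independent from one coherence interval to the next. User $k$ has forward SNR $\rho_k^f>0$, reverse SNR $\rho_k^r>0$ and weight $w_k>0$, which are known constants. $\mathbf E^f=\mathrm{diag}(\sqrt{\rho_1^f},\dots,\sqrt{\rho_K^f})$. When the base-station sends $\mathbf s\in\mathbb C^M$ (with $\mathbb E\|\mathbf s\|^2=1$), user $k$ receives $\sqrt{\rho_k^f}\,\mathbf h_k^T\mathbf s+z_k$ with $z_k\sim\mathcal{CN}(0,1)$, independent over time and of everything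 else. Channel reciprocity holds. **Phases of a coherence interval.** 1. *Reverse pilots*, $\tau^r\ge K$ symbols. The base-station receives $\mathbf Y=\sqrt{\tau^r}\,\mathbf H^T\mathbf E^r\boldsymbol\Psi^\dagger+\mathbf V$, where $\mathbf E^r=\mathrm{diag}(\sqrt{\rho_1^r},\dots,\sqrt{\rho_K^r})$, $\boldsymbol\Psi^\dagger\boldsymbol\Psi=\mathbf I$, and $\mathbf V$ has i.i.d. $\mathcal{CN}(0,1)$ entries independent of $\mathbf H$. It forms the MMSE estimate $\hat{\mathbf H}=\mathbb E[\mathbf H\mid\mathbf Y]$. 2. *Computation*, one symbol. The base-station computes an $M\times K$ precoding matrix $\mathbf A=f(\hat{\mathbf H})$, where $f$ is any precoding function with $\mathrm{Tr}(\mathbf A^\dagger\mathbf A)=1$. The function $f$ may depend on the constant system parameters. 3. *Forward pilots*, $\tau^f\ge1$ symbols. In the $t$-th of these the base-station sends $\mathbf A\mathbf q_p^{(t)}$, where $\mathbf q_p^{(t)}\in\mathbb C^K$ is a known pilot vector. For $\tau^f=1$, $\mathbf q_p^{(1)}=[1,1,\dots]^T$. For $\tau^f=2$, $\mathbf q_p^{(1)}=\sqrt2[1,0,1,0,\dots]^T$ and $\mathbf q_p^{(2)}=\sqrt2[0,1,0,1,\dots]^T$. In general $\mathbf q_p^{(t)}$ has entries $\sqrt{\tau^f}$ in the positions congruent to $t$ modulo $\tau^f$ and $0$ elsewhere. The vector of the $\tau^f$ resulting received signals at user $k$ is $\mathbf x_k^p$. 4. *Data*, the remaining $T-\tau^r-\tau^f-1\ge1$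 symbols. The base-station sends $\mathbf s=\mathbf A\mathbf q$, so the vector of the users' received signals is $\mathbf x^f=\mathbf E^f\mathbf H\mathbf A\mathbf q+\mathbf z^f$. Here $\mathbf q=[q_1,\dots,q_K]^T$ collects the users' coded information symbols, which are zero-mean, unit-variance, mutually independent across users and independent of the channel and all noises. **Information at users.** User $k$ knows all constant system parameters, including the precoding function and the joint distribution of $\mathbf x_k^p$ and $\mathbf G$, and in each coherence interval it observes $\mathbf x_k^p$ and its received data signals. **Notation.** $\mathrm{var}\{X\mid Y\}=\mathbb E[|X-\mathbb E[X\mid Y]|^2\mid Y]$, and $\dagger$ denotes conjugate transpose. **Achievability.** Rates $(R_1,\dots,R_K)$, in bits per data-transmission symbol, are achievable if for every $\epsilon>0$ there are coding schemes over $B$ coherence intervals, each consisting of the four phases reverse pilots, computation of $\mathbf A=f(\hat{\mathbf H})$, forward pilots, and data transmission with $\mathbf s=\mathbf A\mathbf q$, and in which each user $k$ decodes using only the constant system parameters, the received forward pilots $\mathbf x_k^p$ and its received data signals, with the following property. The base-station sends each user $k$ an independent message from a set of at least $2^{B(T-\tau^r-\tau^f-1)(R_k-\epsilon)}$ messages, by coding over the symbols $q_k$, with (possibly randomly generated) codebooks that are independent across users, and each user's decoding error probability (averaged over codebooks) tends to $0$ as $B\to\infty$. A weighted-sum rate $R$ is achievable if $R=\sum_kw_kR_k$ for some achievable $(R_1,\dots,R_K)$. *)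

theory Defs
  imports "HOL-Probability.Probability"
begin

section \<open>Conditional expectation and variance given a random element\<close>

text \<open>Conditioning on \<open>X\<close> (with values in the measurable space \<open>N\<close>) is conditioning on the
  sigma-algebra generated by \<open>X\<close>; the results are random variables on \<open>M\<close>.\<close>

definition cond_expectation ::
    "'a measure \<Rightarrow> ('a \<Rightarrow> 'b) \<Rightarrow> 'b measure \<Rightarrow> ('a \<Rightarrow> real) \<Rightarrow> 'a \<Rightarrow> real" where
  "cond_expectation M X N g = real_cond_exp M (vimage_algebra (space M) X N) g"

definition cond_expectation_complex ::
    "'a measure \<Rightarrow> ('a \<Rightarrow> 'b) \<Rightarrow> 'b measure \<Rightarrow> ('a \<Rightarrow> complex) \<Rightarrow> 'a \<Rightarrow> complex" where
  "cond_expectation_complex M X N g \<omega> =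
     Complex (cond_expectation M X N (\<lambda>\<omega>. Re (g \<omega>)) \<omega>)
             (cond_expectation M X N (\<lambda>\<omega>. Im (g \<omega>)) \<omega>)"

definition cond_variance ::
    "'a measure \<Rightarrow> ('a \<Rightarrow> 'b) \<Rightarrow> 'b measure \<Rightarrow> ('a \<Rightarrow> complex) \<Rightarrow> 'a \<Rightarrow> real" where
  "cond_variance M X N g =
     cond_expectation M X N (\<lambda>\<omega>. (cmod (g \<omega> - cond_expectation_complex M X N g \<omega>))\<^sup>2)"


section \<open>The downlink with reverse and forward training\<close>

text \<open>Users are numbered \<open>1..n_users\<close>, antennas \<open>1..n_antennas\<close>, and the symbols of each phase
  from \<open>1\<close>. A matrix is a function on index pairs (row, column). The columns of \<open>rev_pilots\<close>
  (a \<open>rev_len \<times> n_users\<close> matrix) are the users' reverse pilot sequences.\<close>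

record downlink =
  n_users :: nat
  n_antennas :: nat
  coherence_len :: nat
  rev_len :: nat
  fwd_len :: nat
  fwd_snr :: "nat \<Rightarrow> real"
  rev_snr :: "nat \<Rightarrow> real"
  weight :: "nat \<Rightarrow> real"
  rev_pilots :: "nat \<times> nat \<Rightarrow> complex"
  precoder :: "(nat \<times> nat \<Rightarrow> complex) \<Rightarrow> (nat \<times> nat \<Rightarrow> complex)"

text \<open>One symbol of each coherence interval is spent on computing the precoding matrix.\<close>

definition data_len :: "downlink \<Rightarrow> nat" where
  "data_len P = coherence_len P - rev_len P - fwd_len P - 1"

text \<open>The circularly-symmetric complex Gaussian distribution of mean 0 and variance 1
  (real and imaginary part each have variance 1/2).\<close>

definition CN01 :: "complex measure" where
  "CN01 = density lborel (\<lambda>z. ennreal (exp (- (cmod z)\<^sup>2) / pi))"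

text \<open>All randomness within one coherence interval other than the coded symbols is a family of
  i.i.d. unit complex Gaussians: the channel entry from antenna \<open>m\<close> to user \<open>k\<close>, the noise at
  antenna \<open>m\<close> in the \<open>s\<close>-th reverse pilot symbol, and the noise at user \<open>k\<close> in the \<open>t\<close>-th forward
  pilot symbol and in the \<open>t\<close>-th data symbol.\<close>

datatype gaussian_source =
    Channel nat nat
  | Rev_Noise nat nat
  | Pilot_Noise nat nat
  | Data_Noise nat nat

definition gaussian_sources :: "downlink \<Rightarrow> gaussian_source set" where
  "gaussian_sources P =
     {Channel k m | k m. k \<in> {1..n_users P} \<and> m \<in> {1..n_antennas P}} \<union>
     {Rev_Noise m s | m s. m \<in> {1..n_antennas P} \<and> s \<in> {1..rev_len P}} \<union>
     {Pilot_Noise k t | k t. k \<in> {1..n_users P} \<and> t \<in> {1..fwd_len P}} \<union>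
     {Data_Noise k t | k t. k \<in> {1..n_users P} \<and> t \<in> {1..data_len P}}"

definition interval_space :: "downlink \<Rightarrow> (gaussian_source \<Rightarrow> complex) measure" where
  "interval_space P = (\<Pi>\<^sub>M i\<in>gaussian_sources P. CN01)"

definition matrix_space :: "nat \<Rightarrow> nat \<Rightarrow> (nat \<times> nat \<Rightarrow> complex) measure" where
  "matrix_space a b = (\<Pi>\<^sub>M ij\<in>{1..a} \<times> {1..b}. borel)"

definition rev_received :: "downlink \<Rightarrow> (gaussian_source \<Rightarrow> complex) \<Rightarrow> (nat \<times> nat \<Rightarrow> complex)" where
  "rev_received P \<omega> = (\<lambda>(m, s)\<in>{1..n_antennas P} \<times> {1..rev_len P}.
     complex_of_real (sqrt (rev_len P)) *
       (\<Sum>k=1..n_users P. \<omega> (Channel k m) * complex_of_real (sqrt (rev_snr P k)) * cnj (rev_pilots P (s, k)))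
     + \<omega> (Rev_Noise m s))"

definition channel_estimate :: "downlink \<Rightarrow> (gaussian_source \<Rightarrow> complex) \<Rightarrow> (nat \<times> nat \<Rightarrow> complex)" where
  "channel_estimate P \<omega> = (\<lambda>(k, m)\<in>{1..n_users P} \<times> {1..n_antennas P}.
     cond_expectation_complex (interval_space P)
       (rev_received P) (matrix_space (n_antennas P) (rev_len P)) (\<lambda>\<omega>. \<omega> (Channel k m)) \<omega>)"

definition precoding_matrix :: "downlink \<Rightarrow> (gaussian_source \<Rightarrow> complex) \<Rightarrow> (nat \<times> nat \<Rightarrow> complex)" where
  "precoding_matrix P \<omega> = precoder P (channel_estimate P \<omega>)"

text \<open>The entries of the effective forward channel \<open>G = E\<^sup>f H A\<close>.\<close>

definition effective_channel :: "downlink \<Rightarrow> nat \<Rightarrow> nat \<Rightarrow> (gaussian_source \<Rightarrow> complex) \<Rightarrow> complex" where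
  "effective_channel P i j \<omega> = complex_of_real (sqrt (fwd_snr P i)) *
     (\<Sum>m=1..n_antennas P. \<omega> (Channel i m) * precoding_matrix P \<omega> (m, j))"

definition fwd_pilot :: "downlink \<Rightarrow> nat \<Rightarrow> nat \<Rightarrow> complex" where
  "fwd_pilot P t j =
     (if j mod fwd_len P = t mod fwd_len P then complex_of_real (sqrt (fwd_len P)) else 0)"

definition pilot_received :: "downlink \<Rightarrow> nat \<Rightarrow> (gaussian_source \<Rightarrow> complex) \<Rightarrow> (nat \<Rightarrow> complex)" where
  "pilot_received P k \<omega> = (\<lambda>t\<in>{1..fwd_len P}.
     (\<Sum>j=1..n_users P. effective_channel P k j \<omega> * fwd_pilot P t j) + \<omega> (Pilot_Noise k t))"

definition pilot_space :: "downlink \<Rightarrow> (nat \<Rightarrow> complex) measure" where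
  "pilot_space P = (\<Pi>\<^sub>M t\<in>{1..fwd_len P}. borel)"

text \<open>The condition \<open>Tr (A\<^sup>\<dagger> A) = 1\<close> is imposed almost surely, since \<open>A\<close> depends on the conditional
  expectation, which is itself only determined almost surely.\<close>

definition downlink_system :: "downlink \<Rightarrow> bool" where
  "downlink_system P \<longleftrightarrow>
     1 \<le> n_users P \<and> 1 \<le> n_antennas P \<and>
     n_users P \<le> rev_len P \<and> 1 \<le> fwd_len P \<and>
     rev_len P + fwd_len P + 1 + 1 \<le> coherence_len P \<and>
     (\<forall>k\<in>{1..n_users P}. 0 < fwd_snr P k \<and> 0 < rev_snr P k \<and> 0 < weight P k) \<and>
     (\<forall>i\<in>{1..n_users P}. \<forall>j\<in>{1..n_users P}.
        (\<Sum>s=1..rev_len P. cnj (rev_pilots P (s, i)) * rev_pilots P (s, j)) = (if i = j then 1 else 0)) \<and>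
     precoder P \<in> measurable (matrix_space (n_users P) (n_antennas P))
                             (matrix_space (n_antennas P) (n_users P)) \<and>
     (AE \<omega> in interval_space P.
        (\<Sum>j=1..n_users P. \<Sum>m=1..n_antennas P.
           cnj (precoding_matrix P \<omega> (m, j)) * precoding_matrix P \<omega> (m, j)) = 1)"


section \<open>Coding over coherence intervals and achievable rates\<close>

text \<open>User \<open>k\<close>'s message is drawn from \<open>{..<n_messages k}\<close> and its codebook from the distribution
  \<open>codebook_dist k\<close>; the value of a codebook at \<open>(w, b, t)\<close> is the symbol sent for message \<open>w\<close> in the
  \<open>t\<close>-th data symbol of interval \<open>b\<close>. The decoder of user \<open>k\<close> sees, besides its own codebook, the
  forward pilots and the data signals that user \<open>k\<close> receives, indexed by (interval, symbol).\<close>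

type_synonym codebook = "nat \<times> nat \<times> nat \<Rightarrow> complex"

record code =
  n_messages :: "nat \<Rightarrow> nat"
  codebook_dist :: "nat \<Rightarrow> codebook measure"
  decoder :: "nat \<Rightarrow> codebook \<times> (nat \<times> nat \<Rightarrow> complex) \<times> (nat \<times> nat \<Rightarrow> complex) \<Rightarrow> nat"

text \<open>Independent uniform messages, independent codebooks, and \<open>B\<close> independent intervals.\<close>

definition code_space :: "downlink \<Rightarrow> nat \<Rightarrow> code \<Rightarrow>
    ((nat \<Rightarrow> nat) \<times> (nat \<Rightarrow> codebook) \<times> (nat \<Rightarrow> gaussian_source \<Rightarrow> complex)) measure" where
  "code_space P B S =
     (\<Pi>\<^sub>M k\<in>{1..n_users P}. uniform_count_measure {..<n_messages S k}) \<Otimes>\<^sub>M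
     ((\<Pi>\<^sub>M k\<in>{1..n_users P}. codebook_dist S k) \<Otimes>\<^sub>M
      (\<Pi>\<^sub>M b\<in>{1..B}. interval_space P))"

definition code_symbol :: "nat \<Rightarrow> nat \<Rightarrow> nat \<Rightarrow>
    (nat \<Rightarrow> nat) \<times> (nat \<Rightarrow> codebook) \<times> (nat \<Rightarrow> gaussian_source \<Rightarrow> complex) \<Rightarrow> complex" where
  "code_symbol k b t = (\<lambda>(W, C, \<omega>). C k (W k, b, t))"

definition all_pilots_received :: "downlink \<Rightarrow> nat \<Rightarrow> nat \<Rightarrow>
    (nat \<Rightarrow> nat) \<times> (nat \<Rightarrow> codebook) \<times> (nat \<Rightarrow> gaussian_source \<Rightarrow> complex) \<Rightarrow> (nat \<times> nat \<Rightarrow> complex)" where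
  "all_pilots_received P B k = (\<lambda>(W, C, \<omega>).
     \<lambda>(b, t)\<in>{1..B} \<times> {1..fwd_len P}. pilot_received P k (\<omega> b) t)"

definition all_data_received :: "downlink \<Rightarrow> nat \<Rightarrow> nat \<Rightarrow>
    (nat \<Rightarrow> nat) \<times> (nat \<Rightarrow> codebook) \<times> (nat \<Rightarrow> gaussian_source \<Rightarrow> complex) \<Rightarrow> (nat \<times> nat \<Rightarrow> complex)" where
  "all_data_received P B k = (\<lambda>(W, C, \<omega>).
     \<lambda>(b, t)\<in>{1..B} \<times> {1..data_len P}.
       (\<Sum>j=1..n_users P. effective_channel P k j (\<omega> b) * code_symbol j b t (W, C, \<omega>))
       + \<omega> b (Data_Noise k t))"

text \<open>The moment conditions say that the coded symbols have zero mean and unit variance, with respect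
  to both the message and the random codebook. Together with \<open>Tr (A\<^sup>\<dagger> A) = 1\<close> and the independence
  built into \<open>code_space\<close> they give the transmit power constraint.\<close>

definition coding_scheme :: "downlink \<Rightarrow> nat \<Rightarrow> code \<Rightarrow> bool" where
  "coding_scheme P B S \<longleftrightarrow> (\<forall>k\<in>{1..n_users P}.
     1 \<le> n_messages S k \<and>
     prob_space (codebook_dist S k) \<and>
     sets (codebook_dist S k) =
       sets (\<Pi>\<^sub>M i\<in>{..<n_messages S k} \<times> {1..B} \<times> {1..data_len P}. borel) \<and>
     decoder S k \<in> measurable
       (codebook_dist S k \<Otimes>\<^sub>M (matrix_space B (fwd_len P) \<Otimes>\<^sub>M matrix_space B (data_len P)))
       (count_space UNIV) \<and>
     (\<forall>b\<in>{1..B}. \<forall>t\<in>{1..data_len P}.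
        (LINT x|code_space P B S. code_symbol k b t x) = 0 \<and>
        (LINT x|code_space P B S. (cmod (code_symbol k b t x))\<^sup>2) = 1))"

definition error_probability :: "downlink \<Rightarrow> nat \<Rightarrow> code \<Rightarrow> nat \<Rightarrow> real" where
  "error_probability P B S k = measure (code_space P B S)
     {(W, C, \<omega>) \<in> space (code_space P B S).
        decoder S k (C k, all_pilots_received P B k (W, C, \<omega>), all_data_received P B k (W, C, \<omega>)) \<noteq> W k}"

definition achievable_rates :: "downlink \<Rightarrow> (nat \<Rightarrow> real) \<Rightarrow> bool" where
  "achievable_rates P R \<longleftrightarrow> (\<forall>\<epsilon>>0. \<exists>S :: nat \<Rightarrow> code.
     (\<forall>B\<ge>1. coding_scheme P B (S B) \<and>
        (\<forall>k\<in>{1..n_users P}.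
           2 powr (real B * real (data_len P) * (R k - \<epsilon>)) \<le> real (n_messages (S B) k))) \<and>
     (\<forall>k\<in>{1..n_users P}. (\<lambda>B. error_probability P B (S B) k) \<longlonglongrightarrow> 0))"

definition achievable_weighted_sum_rate :: "downlink \<Rightarrow> real \<Rightarrow> bool" where
  "achievable_weighted_sum_rate P r \<longleftrightarrow>
     (\<exists>R. achievable_rates P R \<and> r = (\<Sum>k=1..n_users P. weight P k * R k))"

definition capacity :: "real \<Rightarrow> real" where
  "capacity \<theta> = log 2 (1 + \<theta>)"

end

theory Submission
  imports Defs
begin

text \<open>All users draw Gaussian codebooks. User \<open>k\<close> estimates its gain by
  \<open>h = E[g\<^sub>k\<^sub>k | x]\<close>, treats everything else as noise of power
  \<open>s = 1 + \<Sum> E[|g\<^sub>k\<^sub>i|\<^sup>2 | x] + var(g\<^sub>k\<^sub>k | x)\<close>, where \<open>x\<close> are its pilots, and scores a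
  codeword by the sum over all symbols of
  \<open>ln (1 + |h|\<^sup>2 / s) + |y|\<^sup>2 / (s + |h|\<^sup>2) - |y - h q|\<^sup>2 / s\<close>;
  it decodes to a codeword whose score exceeds a threshold.
  For the codeword sent, the scores of the coherence intervals are i.i.d.; since \<open>s\<close> and \<open>s + |h|\<^sup>2\<close> are
  the conditional means of \<open>|y - h q|\<^sup>2\<close> and \<open>|y|\<^sup>2\<close>, each symbol contributes the mean
  \<open>E[ln (1 + |h|\<^sup>2 / s)]\<close>, and the law of large numbers applies. For any other codeword, the
  exponential of the score of each symbol has mean exactly 1, so Markov's inequality and a union bound
  apply to any rate below that mean.\<close>

section \<open>The unit complex Gaussian distribution\<close>

text \<open>Interference and gain error \<open>(g - h) q\<close> need be neither Gaussian nor
  independent of the signal, so the true channel law is out of reach. The score is instead the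
  log-likelihood ratio \<open>ln (p (y | q) / p (y))\<close> of a fictitious channel
  \<open>y = h q + z\<close> with Gaussian noise \<open>z\<close> of variance \<open>s\<close> and
  unit Gaussian input. Hence wrong codewords are controlled for each fixed \<open>y\<close>,
  whatever its law, and for the sent codeword only second moments count, because the two quadratic
  terms cancel in the mean. Symbols of one interval share the channel and are dependent, so
  averaging runs over intervals only. Two devices make independence usable. Codebooks, channels and
  noises are gathered into one product of unit Gaussians, where independence means disjoint index
  sets. Conditional expectations, determined only almost surely, are used as pointwise functions of
  the observation, so that the precoder does not change when a data noise does. The threshold lies,
  up to rounding, halfway between the mean score and the logarithm of the codebook size, which
  leaves an exponential margin on the side of the wrong codewords.\<close>

lemma borel_measurable_Complex:
  "(\<lambda>(x, y). Complex x y) \<in> borel_measurable (lborel \<Otimes>\<^sub>M lborel)"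
proof -
  have "(\<lambda>(x, y). Complex x y) \<in> borel_measurable (borel \<Otimes>\<^sub>M borel)"
    by (auto simp: Complex_eq split_beta')
  then show ?thesis by (simp cong: measurable_cong_sets)
qed

text \<open>Lebesgue measure is determined by its values on open boxes, and a box in the complex
  plane is a rectangle in real and imaginary part. This reduces Gaussian integrals over the plane to
  products of one-dimensional ones.\<close>

lemma lborel_complex_eq_distr:
  "(lborel :: complex measure) = distr (lborel \<Otimes>\<^sub>M lborel) borel (\<lambda>(x, y). Complex x y)"
proof (rule lborel_eqI)
  fix l u :: complex
  assume le: "\<And>b. b \<in> Basis \<Longrightarrow> l \<bullet> b \<le> u \<bullet> b"
  have le': "Re l \<le> Re u" "Im l \<le> Im u"
    using le[of 1] le[of \<i>] by (auto simp: Basis_complex_def inner_complex_def)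
  have "(\<lambda>(x, y). Complex x y) -` box l u \<inter> space (lborel \<Otimes>\<^sub>M lborel) =
      {Re l<..<Re u} \<times> {Im l<..<Im u}"
    by (auto simp: box_def Basis_complex_def inner_complex_def space_pair_measure)
  then have "emeasure (distr (lborel \<Otimes>\<^sub>M lborel) borel (\<lambda>(x, y). Complex x y)) (box l u)
     = emeasure (lborel \<Otimes>\<^sub>M lborel) ({Re l<..<Re u} \<times> {Im l<..<Im u})"
    by (subst emeasure_distr[OF borel_measurable_Complex]) auto
  also have "\<dots> = ennreal (Re u - Re l) * ennreal (Im u - Im l)"
    using le' by (subst lborel.emeasure_pair_measure_Times) auto
  also have "\<dots> = ennreal (\<Prod>b\<in>Basis. (u - l) \<bullet> b)"
    using le' by (simp add: Basis_complex_def inner_complex_def ennreal_mult[symmetric])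
  finally show "emeasure (distr (lborel \<Otimes>\<^sub>M lborel) borel (\<lambda>(x, y). Complex x y)) (box l u) = \<dots>" .
qed auto

lemma nn_integral_lborel_complex:
  assumes [measurable]: "f \<in> borel_measurable borel"
  shows "(\<integral>\<^sup>+z. f z \<partial>lborel) = (\<integral>\<^sup>+x. \<integral>\<^sup>+y. f (Complex x y) \<partial>lborel \<partial>lborel)"
proof -
  have [measurable]: "(\<lambda>(x, y). f (Complex x y)) \<in> borel_measurable (lborel \<Otimes>\<^sub>M lborel)"
    using measurable_compose[OF borel_measurable_Complex assms] by (simp add: split_beta')
  show ?thesis
    by (subst lborel_complex_eq_distr, subst nn_integral_distr[OF borel_measurable_Complex])
       (simp, subst lborel.nn_integral_fst[symmetric], auto simp: split_beta')
qed

text \<open>The integrand is \<open>pi / c\<close> times the product of two normal densities of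
  variance \<open>1 / (2 * c)\<close>, centred at \<open>Re m\<close> and \<open>Im m\<close>, each
  of total mass 1. The shift \<open>m\<close> is what remains after completing a square.\<close>

lemma nn_integral_complex_gaussian:
  assumes "c > 0"
  shows "(\<integral>\<^sup>+z. ennreal (exp (- c * (cmod (z - m))\<^sup>2)) \<partial>lborel) = ennreal (pi / c)"
proof -
  define s where "s = sqrt (1 / (2 * c))"
  have s: "s > 0" and s2: "s\<^sup>2 = 1 / (2 * c)"
    using assms by (auto simp: s_def)
  have e: "ennreal (exp (- c * (cmod (Complex x y - m))\<^sup>2)) =
      ennreal (pi / c) * ennreal (normal_density (Re m) s x) * ennreal (normal_density (Im m) s y)" for x y
  proof -
    have "sqrt (2 * pi * s\<^sup>2) * sqrt (2 * pi * s\<^sup>2) = pi / c"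
      using assms by (simp add: s2)
    then have "exp (- c * (cmod (Complex x y - m))\<^sup>2) =
      pi / c * normal_density (Re m) s x * normal_density (Im m) s y"
      using assms by (simp add: normal_density_def s2 cmod_power2 exp_add[symmetric] algebra_simps)
    then show ?thesis
      using assms by (simp add: ennreal_mult[symmetric])
  qed
  have one: "(\<integral>\<^sup>+x. ennreal (normal_density m s x) \<partial>lborel) = 1" for m
    using prob_space.emeasure_space_1[OF prob_space_normal_density[OF s, of m]]
    by (simp add: emeasure_density)
  show ?thesis
    by (subst nn_integral_lborel_complex) (simp, simp only: e, simp add: nn_integral_cmult one)
qed

lemma space_CN01 [simp]: "space CN01 = UNIV"
  and sets_CN01 [simp, measurable_cong]: "sets CN01 = sets borel"
  by (auto simp: CN01_def)

lemma nn_integral_CN01: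
  assumes [measurable]: "f \<in> borel_measurable borel"
  shows "(\<integral>\<^sup>+z. f z \<partial>CN01) = (\<integral>\<^sup>+z. ennreal (exp (- (cmod z)\<^sup>2) / pi) * f z \<partial>lborel)"
  unfolding CN01_def by (subst nn_integral_density) auto

interpretation CN01: prob_space CN01
proof
  have "emeasure CN01 (space CN01) = (\<integral>\<^sup>+z. ennreal (1 / pi) * ennreal (exp (- 1 * (cmod (z - 0))\<^sup>2)) \<partial>lborel)"
    by (simp add: CN01_def emeasure_density ennreal_mult[symmetric])
  also have "\<dots> = ennreal (1 / pi) * ennreal (pi / 1)"
    by (subst nn_integral_cmult, simp, subst nn_integral_complex_gaussian) auto
  finally show "emeasure CN01 (space CN01) = 1"
    by (simp add: ennreal_mult[symmetric])
qed

text \<open>Completing the square: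
  \<open>|z|\<^sup>2 + |y - a z|\<^sup>2 / s = ((s + |a|\<^sup>2) / s) |z - cnj a y / (s + |a|\<^sup>2)|\<^sup>2 + |y|\<^sup>2 / (s + |a|\<^sup>2)\<close>.\<close>

lemma nn_integral_CN01_exp_quadratic:
  assumes s: "s > 0"
  shows "(\<integral>\<^sup>+z. ennreal (exp (- (cmod (y - a * z))\<^sup>2 / s)) \<partial>CN01) =
    ennreal (s / (s + (cmod a)\<^sup>2) * exp (- (cmod y)\<^sup>2 / (s + (cmod a)\<^sup>2)))"
proof -
  define d where "d = s + (cmod a)\<^sup>2"
  have d: "d > 0" using s by (simp add: d_def add_pos_nonneg)
  have sq: "(cmod z)\<^sup>2 + (cmod (y - a * z))\<^sup>2 / s =
      d / s * (cmod (z - cnj a * y / of_real d))\<^sup>2 + (cmod y)\<^sup>2 / d" for z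
  proof -
    have 1: "of_real ((cmod w)\<^sup>2) = w * cnj w" for w by (rule complex_norm_square)
    \<comment> \<open>With \<open>w * cnj w\<close> for squared moduli this becomes a rational
      identity over the complex numbers. Multiplying by \<open>s * d\<close> leaves polynomials,
      compared after inserting \<open>d = s + a * cnj a\<close>.\<close>
    have "complex_of_real ((cmod z)\<^sup>2 + (cmod (y - a * z))\<^sup>2 / s) =
       of_real (d / s * (cmod (z - cnj a * y / of_real d))\<^sup>2 + (cmod y)\<^sup>2 / d)"
    proof -
      have dd: "complex_of_real d = of_real s + a * cnj a"
        by (simp only: d_def of_real_add 1)
      have nz: "complex_of_real d \<noteq> 0" "complex_of_real s \<noteq> 0" using s d by auto
      have "of_real s * of_real d * (complex_of_real ((cmod z)\<^sup>2 + (cmod (y - a * z))\<^sup>2 / s)) =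
        of_real s * of_real d * of_real (d / s * (cmod (z - cnj a * y / of_real d))\<^sup>2 + (cmod y)\<^sup>2 / d)"
        using nz unfolding of_real_add of_real_mult of_real_divide 1 complex_cnj_diff complex_cnj_mult
           complex_cnj_divide complex_cnj_cnj complex_cnj_complex_of_real
        by (simp add: field_simps) (simp add: dd algebra_simps)
      then show ?thesis using nz by simp
    qed
    then show ?thesis by (simp only: of_real_eq_iff)
  qed
  have "(\<integral>\<^sup>+z. ennreal (exp (- (cmod (y - a * z))\<^sup>2 / s)) \<partial>CN01) =
    (\<integral>\<^sup>+z. ennreal (exp (- (cmod y)\<^sup>2 / d) / pi) *
       ennreal (exp (- (d / s) * (cmod (z - cnj a * y / of_real d))\<^sup>2)) \<partial>lborel)"
  proof (subst nn_integral_CN01, simp, intro nn_integral_cong)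
    fix z
    have "- (cmod z)\<^sup>2 + - (cmod (y - a * z))\<^sup>2 / s = - (cmod y)\<^sup>2 / d + - (d / s) * (cmod (z - cnj a * y / of_real d))\<^sup>2"
      using sq[of z] by simp
    then have "exp (- (cmod z)\<^sup>2) * exp (- (cmod (y - a * z))\<^sup>2 / s) =
      exp (- (cmod y)\<^sup>2 / d) * exp (- (d / s) * (cmod (z - cnj a * y / of_real d))\<^sup>2)"
      unfolding exp_add[symmetric] by simp
    then show "ennreal (exp (- (cmod z)\<^sup>2) / pi) * ennreal (exp (- (cmod (y - a * z))\<^sup>2 / s)) =
      ennreal (exp (- (cmod y)\<^sup>2 / d) / pi) * ennreal (exp (- (d / s) * (cmod (z - cnj a * y / of_real d))\<^sup>2))"
      by (simp add: ennreal_mult[symmetric])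
  qed
  also have "\<dots> = ennreal (exp (- (cmod y)\<^sup>2 / d) / pi) * ennreal (pi / (d / s))"
    using d s by (subst nn_integral_cmult, simp, subst nn_integral_complex_gaussian) auto
  finally show ?thesis
    using s d by (simp add: ennreal_mult[symmetric] d_def mult_ac)
qed

text \<open>Negation preserves Lebesgue measure, and the density depends on \<open>cmod z\<close>
  only. This symmetry removes cross terms and odd moments without computing them.\<close>

lemma nn_integral_CN01_uminus:
  assumes [measurable]: "f \<in> borel_measurable borel"
  shows "(\<integral>\<^sup>+z. f (- z) \<partial>CN01) = (\<integral>\<^sup>+z. f z \<partial>CN01)"
proof -
  have "(lborel :: complex measure) = distr lborel borel uminus"
    using lborel_affine[of "-1" "0::complex"] by (simp add: density_1)
  then have "(\<integral>\<^sup>+z. ennreal (exp (- (cmod z)\<^sup>2) / pi) * f z \<partial>lborel) =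
      (\<integral>\<^sup>+z. ennreal (exp (- (cmod z)\<^sup>2) / pi) * f z \<partial>distr lborel borel uminus)"
    by simp
  also have "\<dots> = (\<integral>\<^sup>+z. ennreal (exp (- (cmod z)\<^sup>2) / pi) * f (- z) \<partial>lborel)"
    by (subst nn_integral_distr) auto
  finally show ?thesis
    by (simp add: nn_integral_CN01)
qed

text \<open>The density is a product of two normal densities of variance 1/2, and each coordinate
  contributes its variance.\<close>

lemma nn_integral_CN01_norm_square: "(\<integral>\<^sup>+z. ennreal ((cmod z)\<^sup>2) \<partial>CN01) = 1"
proof -
  define s :: real where "s = sqrt (1 / 2)"
  have s: "s > 0" and s2: "s\<^sup>2 = 1 / 2"
    by (auto simp: s_def)
  define n where "n = (\<lambda>x. ennreal (normal_density 0 s x))"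
  have [measurable]: "n \<in> borel_measurable borel" by (simp add: n_def)
  have one: "(\<integral>\<^sup>+x. n x \<partial>lborel) = 1"
    using prob_space.emeasure_space_1[OF prob_space_normal_density[OF s, of 0]]
    by (simp add: emeasure_density n_def)
  have sq: "(\<integral>\<^sup>+x. n x * ennreal (x\<^sup>2) \<partial>lborel) = ennreal (1 / 2)"
  proof -
    have "has_bochner_integral lborel (\<lambda>x. normal_density 0 s x * x\<^sup>2) (1 / 2)"
    proof -
      have "fact (2 * 1) / ((2 / s\<^sup>2) ^ 1 * fact 1) = (1 / 2 :: real)"
        unfolding s2 by (simp add: fact_2)
      moreover have "(\<lambda>x. normal_density 0 s x * (x - 0) ^ (2 * 1)) = (\<lambda>x. normal_density 0 s x * x\<^sup>2)"
        by simp
      ultimately show ?thesis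
        using normal_moment_even[OF s, of 0 1] by (simp only:)
    qed
    then have "integrable lborel (\<lambda>x. normal_density 0 s x * x\<^sup>2)"
      "(LBINT x. normal_density 0 s x * x\<^sup>2) = 1 / 2"
      by (simp_all only: has_bochner_integral_iff)
    then have "(\<integral>\<^sup>+x. ennreal (normal_density 0 s x * x\<^sup>2) \<partial>lborel) = ennreal (1 / 2)"
      using nn_integral_eq_integral[of lborel "\<lambda>x. normal_density 0 s x * x\<^sup>2"] by (simp only: zero_le_mult_iff normal_density_nonneg zero_le_power2 AE_I2 simp_thms)
    then show ?thesis by (simp add: n_def ennreal_mult)
  qed
  have "ennreal (exp (- (cmod (Complex x y))\<^sup>2) / pi) * ennreal ((cmod (Complex x y))\<^sup>2) =
      n x * ennreal (x\<^sup>2) * n y + n x * (n y * ennreal (y\<^sup>2))" for x y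
  proof -
    have "sqrt (2 * pi * s\<^sup>2) * sqrt (2 * pi * s\<^sup>2) = pi"
      by (simp add: s2)
    then have "exp (- (cmod (Complex x y))\<^sup>2) / pi = normal_density 0 s x * normal_density 0 s y"
      by (simp add: normal_density_def s2 cmod_power2 exp_add[symmetric] algebra_simps)
    then show ?thesis
      by (simp add: n_def cmod_power2 ennreal_mult[symmetric] ennreal_plus[symmetric] algebra_simps
        del: ennreal_plus)
  qed
  then have "(\<integral>\<^sup>+z. ennreal ((cmod z)\<^sup>2) \<partial>CN01) =
    (\<integral>\<^sup>+x. \<integral>\<^sup>+y. n x * ennreal (x\<^sup>2) * n y + n x * (n y * ennreal (y\<^sup>2)) \<partial>lborel \<partial>lborel)"
    by (subst nn_integral_CN01, simp, subst nn_integral_lborel_complex) auto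
  also have "\<dots> = ennreal (1 / 2) + ennreal (1 / 2)"
    by (simp add: nn_integral_add nn_integral_cmult nn_integral_multc one sq)
  also have "\<dots> = ennreal (1 / 2 + 1 / 2)"
    by (rule ennreal_plus[symmetric]) simp_all
  also have "\<dots> = 1"
    by (simp only: field_sum_of_halves ennreal_1)
  finally show ?thesis .
qed

lemma parallelogram_complex:
  "(cmod (a + w))\<^sup>2 + (cmod (a - w))\<^sup>2 = 2 * (cmod a)\<^sup>2 + 2 * (cmod w)\<^sup>2"
  unfolding power2_norm_eq_inner by (simp add: inner_add inner_diff inner_commute)

text \<open>Adding the integrands at \<open>z\<close> and at \<open>- z\<close> removes the cross
  term by the parallelogram law, so the computation stays within nonnegative integrals. Everything
  is doubled, and the factor 2 is cancelled at the end.\<close>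

lemma nn_integral_CN01_affine:
  "(\<integral>\<^sup>+z. ennreal ((cmod (a + c * z))\<^sup>2) \<partial>CN01) = ennreal ((cmod a)\<^sup>2 + (cmod c)\<^sup>2)"
proof -
  define I where "I = (\<integral>\<^sup>+z. ennreal ((cmod (a + c * z))\<^sup>2) \<partial>CN01)"
  have "I = (\<integral>\<^sup>+z. ennreal ((cmod (a - c * z))\<^sup>2) \<partial>CN01)"
    unfolding I_def by (subst nn_integral_CN01_uminus[symmetric]) auto
  then have "I + I = (\<integral>\<^sup>+z. ennreal ((cmod (a + c * z))\<^sup>2) + ennreal ((cmod (a - c * z))\<^sup>2) \<partial>CN01)"
    by (subst nn_integral_add) (auto simp: I_def)
  also have "\<dots> = (\<integral>\<^sup>+z. ennreal (2 * (cmod a)\<^sup>2) + ennreal (2 * (cmod c)\<^sup>2) * ennreal ((cmod z)\<^sup>2) \<partial>CN01)"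
  proof (intro nn_integral_cong)
    fix z
    have "(cmod (a + c * z))\<^sup>2 + (cmod (a - c * z))\<^sup>2 = 2 * (cmod a)\<^sup>2 + 2 * (cmod c)\<^sup>2 * (cmod z)\<^sup>2"
      using parallelogram_complex[of a "c * z"] unfolding norm_mult power_mult_distrib mult.assoc .
    then show "ennreal ((cmod (a + c * z))\<^sup>2) + ennreal ((cmod (a - c * z))\<^sup>2) =
      ennreal (2 * (cmod a)\<^sup>2) + ennreal (2 * (cmod c)\<^sup>2) * ennreal ((cmod z)\<^sup>2)"
      by (simp add: ennreal_mult[symmetric] ennreal_plus[symmetric] del: ennreal_plus)
  qed
  also have "\<dots> = ennreal (2 * (cmod a)\<^sup>2) + ennreal (2 * (cmod c)\<^sup>2)"
    by (subst nn_integral_add, simp, simp, subst nn_integral_cmult, simp)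
       (simp only: nn_integral_CN01_norm_square nn_integral_const CN01.emeasure_space_1 mult_1_right)
  also have "\<dots> = 2 * ennreal ((cmod a)\<^sup>2 + (cmod c)\<^sup>2)"
    by (subst (1 2) ennreal_mult) (simp_all add: distrib_left)
  finally have "2 * I = 2 * ennreal ((cmod a)\<^sup>2 + (cmod c)\<^sup>2)"
    by (simp only: mult_2)
  then show ?thesis
    unfolding I_def by (subst (asm) ennreal_mult_cancel_left) auto
qed

lemma integrable_CN01_norm_square: "integrable CN01 (\<lambda>z. (cmod z)\<^sup>2)"
  by (rule integrableI_bounded) (auto simp: nn_integral_CN01_norm_square cong: measurable_cong_sets)

lemma integral_CN01_norm_square: "(LINT z|CN01. (cmod z)\<^sup>2) = 1"
  by (rule integral_eq_nn_integral[THEN trans])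
     (auto simp: nn_integral_CN01_norm_square cong: measurable_cong_sets)

text \<open>By symmetry the mean equals its own negative. With the second moment this yields the
  moment conditions on coded symbols.\<close>

lemma integral_CN01_id: "(LINT z|CN01. z) = 0"
proof -
  have m: "(uminus :: complex \<Rightarrow> complex) \<in> CN01 \<rightarrow>\<^sub>M CN01" by (simp cong: measurable_cong_sets)
  have d: "distr CN01 CN01 uminus = CN01"
  proof (rule measure_eqI)
    fix A assume "A \<in> sets (distr CN01 CN01 uminus)"
    then have A [measurable]: "A \<in> sets borel" by simp
    have "emeasure (distr CN01 CN01 uminus) A = (\<integral>\<^sup>+z. indicator A (- z) \<partial>CN01)"
      using A m by (subst nn_integral_distr[symmetric, OF m]) (auto cong: measurable_cong_sets)
    also have "\<dots> = emeasure CN01 A"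
      using A by (subst nn_integral_CN01_uminus) auto
    finally show "emeasure (distr CN01 CN01 uminus) A = emeasure CN01 A" .
  qed simp
  have "(LINT z|CN01. z) = (LINT z|distr CN01 CN01 uminus. z)"
    by (simp add: d)
  also have "\<dots> = - (LINT z|CN01. z)"
    by (subst integral_distr[OF m]) (auto cong: measurable_cong_sets)
  finally show ?thesis by simp
qed

section \<open>Factorization through an observation, and a weak law of large numbers\<close>

text \<open>For each rational level \<open>r\<close> the set where \<open>f\<close> exceeds
  \<open>r\<close> is the preimage of some \<open>A r\<close> under \<open>X\<close>, and
  \<open>f\<close> is recovered as the supremum of the levels it exceeds. The factorization holds at
  every point of \<open>\<Omega>\<close>, which later gives exact and not merely almost sure
  dependence on an observation.\<close>

lemma Doob_Dynkin_real:
  fixes f :: "'a \<Rightarrow> real"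
  assumes X: "X \<in> \<Omega> \<rightarrow> space N" and f: "f \<in> borel_measurable (vimage_algebra \<Omega> X N)"
  obtains h where "h \<in> borel_measurable N" "\<And>\<omega>. \<omega> \<in> \<Omega> \<Longrightarrow> f \<omega> = h (X \<omega>)"
proof -
  have "\<exists>A. A \<in> sets N \<and> {\<omega> \<in> \<Omega>. real_of_rat r < f \<omega>} = X -` A \<inter> \<Omega>" for r
  proof -
    have "{\<omega> \<in> space (vimage_algebra \<Omega> X N). real_of_rat r < f \<omega>} \<in> sets (vimage_algebra \<Omega> X N)"
      using f by measurable
    then show ?thesis by (auto simp: sets_vimage_algebra2[OF X])
  qed
  then obtain A where A [measurable]: "\<And>r. A r \<in> sets N"
    and A_eq: "\<And>r. {\<omega> \<in> \<Omega>. real_of_rat r < f \<omega>} = X -` A r \<inter> \<Omega>"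
    by metis
  \<comment> \<open>Outside the range of \<open>X\<close> the sets \<open>A r\<close> are
    uncontrolled and the supremum may be infinite, hence the extended reals. The value
    \<open>- \<infinity>\<close> makes a level that is not exceeded neutral for the
    supremum.\<close>
  define h where "h y = real_of_ereal (SUP r. if y \<in> A r then ereal (real_of_rat r) else - \<infinity>)" for y
  have "h \<in> borel_measurable N"
    unfolding h_def by measurable
  moreover have "f \<omega> = h (X \<omega>)" if "\<omega> \<in> \<Omega>" for \<omega>
  proof -
    have iff: "X \<omega> \<in> A r \<longleftrightarrow> real_of_rat r < f \<omega>" for r
      using A_eq[of r] that by blast
    have "(SUP r. if X \<omega> \<in> A r then ereal (real_of_rat r) else - \<infinity>) = ereal (f \<omega>)"
    proof (rule antisym)
      show "(SUP r. if X \<omega> \<in> A r then ereal (real_of_rat r) else - \<infinity>) \<le> ereal (f \<omega>)"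
        by (rule SUP_least) (auto simp: iff)
      show "ereal (f \<omega>) \<le> (SUP r. if X \<omega> \<in> A r then ereal (real_of_rat r) else - \<infinity>)"
      proof (rule dense_le)
        fix x assume x: "x < ereal (f \<omega>)"
        show "x \<le> (SUP r. if X \<omega> \<in> A r then ereal (real_of_rat r) else - \<infinity>)"
        proof (cases x)
          case (real x')
          with x obtain r where "x' < real_of_rat r" "real_of_rat r < f \<omega>"
            using of_rat_dense[of x' "f \<omega>"] by auto
          with real show ?thesis
            by (intro SUP_upper2[of r]) (auto simp: iff)
        qed (use x in auto)
      qed
    qed
    then show ?thesis by (simp add: h_def)
  qed
  ultimately show thesis by (rule that)
qed

text \<open>At a fixed point the clamping has no effect once \<open>c\<close> reaches
  \<open>|f x|\<close>, and \<open>|f|\<close> dominates every difference.\<close>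

lemma integral_truncation_tendsto_0:
  fixes f :: "'a \<Rightarrow> real"
  assumes f: "integrable N f"
  shows "(\<lambda>c. LINT x|N. \<bar>f x - max (- real c) (min (real c) (f x))\<bar>) \<longlonglongrightarrow> 0"
proof -
  have [measurable]: "f \<in> borel_measurable N" using f by auto
  have "(\<lambda>c. LINT x|N. \<bar>f x - max (- real c) (min (real c) (f x))\<bar>) \<longlonglongrightarrow> (LINT x|N. 0)"
  proof (rule integral_dominated_convergence[where w = "\<lambda>x. \<bar>f x\<bar>"])
    show "AE x in N. (\<lambda>c. \<bar>f x - max (- real c) (min (real c) (f x))\<bar>) \<longlonglongrightarrow> 0"
    proof (intro AE_I2 tendsto_eventually)
      fix x
      obtain c0 :: nat where "\<bar>f x\<bar> \<le> real c0" using real_arch_simple by blast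
      then show "\<forall>\<^sub>F c in sequentially. \<bar>f x - max (- real c) (min (real c) (f x))\<bar> = 0"
        by (intro eventually_sequentiallyI[of c0]) auto
    qed
  qed (use f in auto)
  then show ?thesis by simp
qed

text \<open>Only the first moment is assumed to exist: the summands are split into a bounded part, to which
  Hoeffding's inequality applies, and a remainder of small mean absolute value.\<close>

lemma weak_law_lower_tail:
  fixes M :: "nat \<Rightarrow> 'm measure" and N :: "'a measure" and f :: "'a \<Rightarrow> real"
  assumes f: "integrable N f" and \<delta>: "\<delta> > 0"
    and M: "\<And>B. prob_space (M B)"
    and indep: "\<And>B. prob_space.indep_vars (M B) (\<lambda>_. N) (X B) {1..B}"
    and X: "\<And>B b. b \<in> {1..B} \<Longrightarrow> distr (M B) N (X B b) = N"
  shows "(\<lambda>B. measure (M B) {x \<in> space (M B). (\<Sum>b=1..B. f (X B b x)) \<le> real B * ((LINT y|N. f y) - \<delta>)})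
    \<longlonglongrightarrow> 0"
proof (rule LIMSEQ_I)
  fix \<epsilon> :: real assume \<epsilon>: "\<epsilon> > 0"
  note [measurable] = borel_measurable_integrable[OF f]
  define T where "T c x = max (- real c) (min (real c) (f x))" for c x
  have [measurable]: "T c \<in> borel_measurable N" for c unfolding T_def by measurable
  have "\<forall>\<^sub>F c in sequentially. (LINT x|N. \<bar>f x - T c x\<bar>) < min (\<delta> / 3) (\<delta> * \<epsilon> / 6)"
    unfolding T_def by (rule order_tendstoD[OF integral_truncation_tendsto_0[OF f]]) (use \<delta> \<epsilon> in auto)
  then have "\<forall>\<^sub>F c in sequentially. (LINT x|N. \<bar>f x - T c x\<bar>) < min (\<delta> / 3) (\<delta> * \<epsilon> / 6) \<and> c \<ge> 1"
    using eventually_ge_at_top[of 1] by eventually_elim auto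
  then obtain c where c: "(LINT x|N. \<bar>f x - T c x\<bar>) < min (\<delta> / 3) (\<delta> * \<epsilon> / 6)" "c \<ge> 1"
    using eventually_happens'[OF sequentially_bot] by blast
  \<comment> \<open>The mean size of the truncation remainder. Its bound by
    \<open>\<delta> / 3\<close> pays for the shift of the mean; its bound by
    \<open>\<delta> * \<epsilon> / 6\<close> makes Markov's inequality give at most
    \<open>\<epsilon> / 2\<close>.\<close>
  define m where "m = (LINT x|N. \<bar>f x - T c x\<bar>)"
  have Tint: "integrable N (T c)"
    by (rule Bochner_Integration.integrable_bound[OF f]) (auto simp: T_def)
  have hint: "integrable N (\<lambda>x. \<bar>f x - T c x\<bar>)"
    using f Tint by auto
  have split: "(LINT y|N. f y) \<le> (LINT y|N. T c y) + m"
  proof -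
    have "(LINT y|N. f y) - (LINT y|N. T c y) = (LINT y|N. f y - T c y)"
      using f Tint by simp
    also have "\<dots> \<le> m"
      unfolding m_def using f Tint by (intro integral_mono) auto
    finally show ?thesis by simp
  qed
  \<comment> \<open>Hoeffding's exponent for a deviation \<open>B * \<delta> / 3\<close> of
    \<open>B\<close> summands with range \<open>2 * c\<close>, namely
    \<open>2 * (B * \<delta> / 3)^2 / (B * (2 * c)^2)\<close>. Taking \<open>c\<close> at least 1
    keeps the denominator nonzero.\<close>
  have "(\<lambda>B. exp (- (real B * (\<delta>\<^sup>2 / (18 * (real c)\<^sup>2))))) \<longlonglongrightarrow> 0"
  proof -
    have "(\<lambda>B. exp (- (\<delta>\<^sup>2 / (18 * (real c)\<^sup>2))) ^ B) \<longlonglongrightarrow> 0"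
      using \<delta> c by (intro LIMSEQ_power_zero) auto
    then show ?thesis
      by (simp add: exp_of_nat_mult[symmetric] del: exp_minus)
  qed
  from LIMSEQ_D[OF this, of "\<epsilon> / 2"] \<epsilon> obtain B0 where
    B0: "\<And>B. B \<ge> B0 \<Longrightarrow> exp (- (real B * (\<delta>\<^sup>2 / (18 * (real c)\<^sup>2)))) < \<epsilon> / 2" by auto
  have "measure (M B) {x \<in> space (M B). (\<Sum>b=1..B. f (X B b x)) \<le> real B * ((LINT y|N. f y) - \<delta>)} < \<epsilon>"
    if B: "B \<ge> max B0 1" for B
  proof -
    interpret prob_space "M B" by (rule M)
    have Xm [measurable]: "X B b \<in> M B \<rightarrow>\<^sub>M N" if "b \<in> {1..B}" for b
      using indep[of B] that by (auto simp: indep_vars_def)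
    have expX: "expectation (\<lambda>x. g (X B b x)) = (LINT y|N. g y)"
      if "b \<in> {1..B}" "g \<in> borel_measurable N" for b and g :: "'a \<Rightarrow> real"
      using that integral_distr[OF Xm[OF that(1)] that(2)] X by simp
    interpret H: Hoeffding_ineq "M B" "{1..B}" "\<lambda>b x. T c (X B b x)" "\<lambda>_. - real c" "\<lambda>_. real c"
      "\<Sum>b\<in>{1..B}. expectation (\<lambda>x. T c (X B b x))"
    proof unfold_locales
      show "indep_vars (\<lambda>_. borel) (\<lambda>b x. T c (X B b x)) {1..B}"
        by (rule indep_vars_compose2[OF indep]) auto
    qed (auto simp: T_def)
    \<comment> \<open>The loss \<open>\<delta>\<close> is split into thirds: one for the shift of
      the mean by truncation, one for the fluctuation of the truncated sum in \<open>?A\<close>, one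
      for the accumulated remainder in \<open>?C\<close>.\<close>
    let ?A = "{x \<in> space (M B). (\<Sum>b=1..B. T c (X B b x)) \<le> real B * (LINT y|N. T c y) - real B * \<delta> / 3}"
    let ?C = "{x \<in> space (M B). (\<Sum>b=1..B. \<bar>f (X B b x) - T c (X B b x)\<bar>) \<ge> real B * \<delta> / 3}"
    have [measurable]: "?A \<in> sets (M B)" "?C \<in> sets (M B)" by measurable
    have "prob {x \<in> space (M B). (\<Sum>b=1..B. f (X B b x)) \<le> real B * ((LINT y|N. f y) - \<delta>)} \<le> prob (?A \<union> ?C)"
    proof (intro finite_measure_mono subsetI)
      fix x assume "x \<in> {x \<in> space (M B). (\<Sum>b=1..B. f (X B b x)) \<le> real B * ((LINT y|N. f y) - \<delta>)}"
      then have x: "x \<in> space (M B)" and le: "(\<Sum>b=1..B. f (X B b x)) \<le> real B * ((LINT y|N. f y) - \<delta>)"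
        by auto
      have "(\<Sum>b=1..B. T c (X B b x)) - (\<Sum>b=1..B. \<bar>f (X B b x) - T c (X B b x)\<bar>) \<le> (\<Sum>b=1..B. f (X B b x))"
        unfolding sum_subtractf[symmetric] by (intro sum_mono) auto
      also note le
      also have "real B * ((LINT y|N. f y) - \<delta>) \<le> real B * ((LINT y|N. T c y) + \<delta> / 3 - \<delta>)"
        using split c by (intro mult_left_mono) (auto simp: m_def)
      finally show "x \<in> ?A \<union> ?C"
        using x by (auto simp: algebra_simps)
    qed auto
    also have "\<dots> \<le> prob ?A + prob ?C"
      by (intro measure_Un_le) auto
    also have "prob ?A < \<epsilon> / 2"
    proof -
      have "prob ?A \<le> exp (- 2 * (real B * \<delta> / 3)\<^sup>2 / (\<Sum>b\<in>{1..B}. (real c - - real c)\<^sup>2))"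
        using H.Hoeffding_ineq_le[of "real B * \<delta> / 3"] \<delta> B c by (simp add: expX)
      also have "- 2 * (real B * \<delta> / 3)\<^sup>2 / (\<Sum>b\<in>{1..B}. (real c - - real c)\<^sup>2) =
         - (real B * (\<delta>\<^sup>2 / (18 * (real c)\<^sup>2)))"
        using B c by (simp add: field_simps power2_eq_square)
      finally show ?thesis using B0[of B] B by auto
    qed
    also have "prob ?C \<le> \<epsilon> / 2"
    proof -
      have hX: "integrable (M B) (\<lambda>x. \<bar>f (X B b x) - T c (X B b x)\<bar>)" if "b \<in> {1..B}" for b
        using integrable_distr[OF Xm[OF that], of "\<lambda>x. \<bar>f x - T c x\<bar>"] hint X[OF that] by simp
      have "prob ?C \<le> expectation (\<lambda>x. \<Sum>b=1..B. \<bar>f (X B b x) - T c (X B b x)\<bar>) / (real B * \<delta> / 3)"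
        using \<delta> B hX by (intro integral_Markov_inequality_measure[where A="{}"] Bochner_Integration.integrable_sum)
          (auto intro!: sum_nonneg AE_I2)
      also have "expectation (\<lambda>x. \<Sum>b=1..B. \<bar>f (X B b x) - T c (X B b x)\<bar>) =
          (\<Sum>b=1..B. expectation (\<lambda>x. \<bar>f (X B b x) - T c (X B b x)\<bar>))"
        using hX by (intro Bochner_Integration.integral_sum)
      also have "\<dots> = (\<Sum>b=1..B. m)"
        unfolding m_def by (intro sum.cong refl expX[of _ "\<lambda>x. \<bar>f x - T c x\<bar>"]) auto
      also have "\<dots> = real B * m" by simp
      also have "real B * m / (real B * \<delta> / 3) = 3 * m / \<delta>"
        using B by simp
      also have "\<dots> \<le> \<epsilon> / 2"
        using c \<delta> by (simp add: m_def field_simps)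
      finally show ?thesis .
    qed
    finally show ?thesis by simp
  qed
  then show "\<exists>no. \<forall>B\<ge>no. norm (measure (M B) {x \<in> space (M B). (\<Sum>b=1..B. f (X B b x)) \<le>
      real B * ((LINT y|N. f y) - \<delta>)} - 0) < \<epsilon>"
    by (intro exI[of _ "max B0 1"]) auto
qed

section \<open>Conditional moments given an observation\<close>

lemma integrable_bounded_mult:
  fixes f u :: "'a \<Rightarrow> real"
  assumes u: "integrable M u" and [measurable]: "f \<in> borel_measurable M"
    and bound: "\<And>\<omega>. \<omega> \<in> space M \<Longrightarrow> \<bar>f \<omega>\<bar> \<le> 1"
  shows "integrable M (\<lambda>\<omega>. f \<omega> * u \<omega>)"
proof (rule Bochner_Integration.integrable_bound[OF u])
  have [measurable]: "u \<in> borel_measurable M" using u by auto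
  show "(\<lambda>\<omega>. f \<omega> * u \<omega>) \<in> borel_measurable M" by measurable
  show "AE \<omega> in M. norm (f \<omega> * u \<omega>) \<le> norm (u \<omega>)"
    using bound by (intro AE_I2) (auto simp: abs_mult intro!: mult_left_le_one_le)
qed

lemma integrable_Re_Im_of_square:
  assumes "finite_measure M" and g [measurable]: "g \<in> borel_measurable M"
    and g2: "integrable M (\<lambda>\<omega>. (cmod (g \<omega>))\<^sup>2)"
  shows "integrable M (\<lambda>\<omega>. Re (g \<omega>))" "integrable M (\<lambda>\<omega>. Im (g \<omega>))"
    "integrable M (\<lambda>\<omega>. (Re (g \<omega>))\<^sup>2)" "integrable M (\<lambda>\<omega>. (Im (g \<omega>))\<^sup>2)"
proof -
  interpret finite_measure M by fact
  show *: "integrable M (\<lambda>\<omega>. (Re (g \<omega>))\<^sup>2)" "integrable M (\<lambda>\<omega>. (Im (g \<omega>))\<^sup>2)"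
    by (rule Bochner_Integration.integrable_bound[OF g2]; simp add: cmod_power2)+
  show "integrable M (\<lambda>\<omega>. Re (g \<omega>))" "integrable M (\<lambda>\<omega>. Im (g \<omega>))"
    by (rule square_integrable_imp_integrable; simp add: *)+
qed

locale observation = prob_space M for M :: "'a measure" +
  fixes X :: "'a \<Rightarrow> 'b" and N :: "'b measure"
  assumes X [measurable]: "X \<in> M \<rightarrow>\<^sub>M N"
begin

abbreviation (input) "F \<equiv> vimage_algebra (space M) X N"

lemma sigma_subalgebra_vimage: "finite_measure_subalgebra M F"
  by standard (auto simp: subalgebra_def intro!: subsetD[OF sets_image_in_sets[OF refl X]])

lemma observation_in_space: "X \<in> space M \<rightarrow> space N"
  using measurable_space[OF X] by auto

lemma observation_measurable_vimage: "X \<in> F \<rightarrow>\<^sub>M N"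
  using observation_in_space by (rule measurable_vimage_algebra1)

lemma cond_expectation_measurable: "cond_expectation M X N u \<in> borel_measurable F"
  unfolding cond_expectation_def by measurable

text \<open>The version of conditional expectation in use is measurable for the sigma-algebra of
  \<open>X\<close> itself, so the Doob--Dynkin factorization applies at every point of the
  space.\<close>

lemma cond_expectation_factor:
  obtains h where "h \<in> borel_measurable N" "\<And>\<omega>. \<omega> \<in> space M \<Longrightarrow> cond_expectation M X N u \<omega> = h (X \<omega>)"
  using Doob_Dynkin_real[OF observation_in_space cond_expectation_measurable] by blast

lemma measurable_from_vimage: "u \<in> borel_measurable F \<Longrightarrow> u \<in> borel_measurable M"
  using measurable_from_subalg[OF finite_measure_subalgebra.subalg[OF sigma_subalgebra_vimage]] .

lemma cond_expectation_integral:
  fixes u :: "'a \<Rightarrow> real"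
  assumes "integrable M (\<lambda>\<omega>. f \<omega> * u \<omega>)" "f \<in> borel_measurable F" "u \<in> borel_measurable M"
  shows "integrable M (\<lambda>\<omega>. f \<omega> * cond_expectation M X N u \<omega>)"
    "(LINT \<omega>|M. f \<omega> * cond_expectation M X N u \<omega>) = (LINT \<omega>|M. f \<omega> * u \<omega>)"
proof -
  interpret finite_measure_subalgebra M F by (rule sigma_subalgebra_vimage)
  show "integrable M (\<lambda>\<omega>. f \<omega> * cond_expectation M X N u \<omega>)"
    "(LINT \<omega>|M. f \<omega> * cond_expectation M X N u \<omega>) = (LINT \<omega>|M. f \<omega> * u \<omega>)"
    unfolding cond_expectation_def using real_cond_exp_intg assms by auto
qed

text \<open>Conditional Jensen inequality for the convex function \<open>x^2\<close>.\<close>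

lemma integrable_cond_expectation_square:
  assumes "integrable M u" "integrable M (\<lambda>\<omega>. (u \<omega>)\<^sup>2)"
  shows "integrable M (\<lambda>\<omega>. (cond_expectation M X N u \<omega>)\<^sup>2)"
proof -
  interpret finite_measure_subalgebra M F by (rule sigma_subalgebra_vimage)
  show ?thesis
    unfolding cond_expectation_def
    by (rule integrable_convex_cond_exp[where I = UNIV and q = "\<lambda>x. x\<^sup>2"])
       (use assms convex_power2 in auto)
qed

end

locale estimation = observation M X N for M :: "'a measure" and X :: "'a \<Rightarrow> 'b" and N :: "'b measure" +
  fixes g :: "'a \<Rightarrow> complex"
  assumes g [measurable]: "g \<in> borel_measurable M"
    and g2: "integrable M (\<lambda>\<omega>. (cmod (g \<omega>))\<^sup>2)"
begin

abbreviation (input) "e \<equiv> cond_expectation_complex M X N g"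

lemma cond_expectation_complex_measurable [measurable]: "e \<in> borel_measurable M"
proof -
  have [measurable]: "cond_expectation M X N u \<in> borel_measurable M" for u
    by (rule measurable_from_vimage[OF cond_expectation_measurable])
  have eq: "e = (\<lambda>\<omega>. of_real (cond_expectation M X N (\<lambda>\<omega>. Re (g \<omega>)) \<omega>) +
      \<i> * of_real (cond_expectation M X N (\<lambda>\<omega>. Im (g \<omega>)) \<omega>))"
    by (auto simp: cond_expectation_complex_def Complex_eq fun_eq_iff)
  show ?thesis unfolding eq by measurable
qed

lemma integrable_cond_expectation_complex_square: "integrable M (\<lambda>\<omega>. (cmod (e \<omega>))\<^sup>2)"
proof -
  note i = integrable_Re_Im_of_square[OF finite_measure_axioms g g2]
  show ?thesis
    unfolding cond_expectation_complex_def cmod_power2 complex.sel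
    by (intro Bochner_Integration.integrable_add integrable_cond_expectation_square i)
qed

lemma integrable_estimation_error_square: "integrable M (\<lambda>\<omega>. (cmod (g \<omega> - e \<omega>))\<^sup>2)"
proof (rule Bochner_Integration.integrable_bound)
  show "integrable M (\<lambda>\<omega>. 2 * (cmod (g \<omega>))\<^sup>2 + 2 * (cmod (e \<omega>))\<^sup>2)"
    using g2 integrable_cond_expectation_complex_square by auto
  have "(cmod (a - b))\<^sup>2 \<le> 2 * (cmod a)\<^sup>2 + 2 * (cmod b)\<^sup>2" for a b
  proof -
    show ?thesis using parallelogram_complex[of a b] zero_le_power2[of "cmod (a + b)"] by linarith
  qed
  then show "AE \<omega> in M. norm ((cmod (g \<omega> - e \<omega>))\<^sup>2) \<le> norm (2 * (cmod (g \<omega>))\<^sup>2 + 2 * (cmod (e \<omega>))\<^sup>2)"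
    by auto
qed measurable

text \<open>Orthogonality of the estimation error: the cross term of
  \<open>|g|\<^sup>2 = |g - e|\<^sup>2 + |e|\<^sup>2 + 2 Re ((g - e) cnj e)\<close> vanishes when weighted with a function of \<open>X\<close>.\<close>

lemma estimation_error_orthogonal:
  fixes f :: "'a \<Rightarrow> real"
  assumes f: "f \<in> borel_measurable F" and bound: "\<And>\<omega>. \<omega> \<in> space M \<Longrightarrow> \<bar>f \<omega>\<bar> \<le> 1"
    and bound': "\<And>\<omega>. \<omega> \<in> space M \<Longrightarrow> cmod (e \<omega>) * \<bar>f \<omega>\<bar> \<le> 1"
  shows "integrable M (\<lambda>\<omega>. f \<omega> * (cmod (g \<omega>))\<^sup>2)"
    "integrable M (\<lambda>\<omega>. f \<omega> * (cmod (g \<omega> - e \<omega>))\<^sup>2)"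
    "integrable M (\<lambda>\<omega>. f \<omega> * (cmod (e \<omega>))\<^sup>2)"
    "(LINT \<omega>|M. f \<omega> * (cmod (g \<omega>))\<^sup>2) =
     (LINT \<omega>|M. f \<omega> * (cmod (g \<omega> - e \<omega>))\<^sup>2) + (LINT \<omega>|M. f \<omega> * (cmod (e \<omega>))\<^sup>2)"
proof -
  note i = integrable_Re_Im_of_square[OF finite_measure_axioms g g2]
  have fM [measurable]: "f \<in> borel_measurable M" by (rule measurable_from_vimage[OF f])
  note bd = integrable_bounded_mult[OF _ fM bound]
  show 1: "integrable M (\<lambda>\<omega>. f \<omega> * (cmod (g \<omega>))\<^sup>2)"
    by (rule bd[OF g2])
  show 2: "integrable M (\<lambda>\<omega>. f \<omega> * (cmod (g \<omega> - e \<omega>))\<^sup>2)"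
    by (rule bd[OF integrable_estimation_error_square])
  show 3: "integrable M (\<lambda>\<omega>. f \<omega> * (cmod (e \<omega>))\<^sup>2)"
    by (rule bd[OF integrable_cond_expectation_complex_square])
  \<comment> \<open>Applied to the real and the imaginary part of \<open>g\<close>. The weight
    \<open>f * E[u | X]\<close> is bounded by 1 and depends on \<open>X\<close> only, so the
    defining property of conditional expectation applies with it, although \<open>E[u | X]\<close>
    alone may be unbounded.\<close>
  have part: "integrable M (\<lambda>\<omega>. f \<omega> * cond_expectation M X N u \<omega> * u \<omega>) \<and>
      integrable M (\<lambda>\<omega>. f \<omega> * cond_expectation M X N u \<omega> * cond_expectation M X N u \<omega>) \<and>
      (LINT \<omega>|M. f \<omega> * cond_expectation M X N u \<omega> * cond_expectation M X N u \<omega>) =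
      (LINT \<omega>|M. f \<omega> * cond_expectation M X N u \<omega> * u \<omega>)"
    if u: "integrable M u" and le: "\<And>\<omega>. \<bar>cond_expectation M X N u \<omega>\<bar> \<le> cmod (e \<omega>)" for u
  proof -
    have mF: "(\<lambda>\<omega>. f \<omega> * cond_expectation M X N u \<omega>) \<in> borel_measurable F"
      using f cond_expectation_measurable[of u] by measurable
    have [measurable]: "u \<in> borel_measurable M" using u by auto
    have int: "integrable M (\<lambda>\<omega>. f \<omega> * cond_expectation M X N u \<omega> * u \<omega>)"
    proof (rule Bochner_Integration.integrable_bound[OF u])
      show "(\<lambda>\<omega>. f \<omega> * cond_expectation M X N u \<omega> * u \<omega>) \<in> borel_measurable M"
        using measurable_from_vimage[OF mF] by measurable
      show "AE \<omega> in M. norm (f \<omega> * cond_expectation M X N u \<omega> * u \<omega>) \<le> norm (u \<omega>)"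
      proof (intro AE_I2)
        fix \<omega> assume "\<omega> \<in> space M"
        have "\<bar>f \<omega>\<bar> * \<bar>cond_expectation M X N u \<omega>\<bar> \<le> \<bar>f \<omega>\<bar> * cmod (e \<omega>)"
          using le by (intro mult_left_mono) auto
        also have "\<dots> \<le> 1" using bound'[OF \<open>\<omega> \<in> space M\<close>] by (simp add: mult.commute)
        finally have "\<bar>f \<omega> * cond_expectation M X N u \<omega>\<bar> \<le> 1" by (simp add: abs_mult)
        then show "norm (f \<omega> * cond_expectation M X N u \<omega> * u \<omega>) \<le> norm (u \<omega>)"
          by (simp only: real_norm_def abs_mult) (rule mult_left_le_one_le, auto)
      qed
    qed
    show ?thesis
      using cond_expectation_integral[OF int mF] int by auto
  qed
  let ?r = "cond_expectation M X N (\<lambda>\<omega>. Re (g \<omega>))" and ?j = "cond_expectation M X N (\<lambda>\<omega>. Im (g \<omega>))"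
  have r: "Re (e \<omega>) = ?r \<omega>" and j: "Im (e \<omega>) = ?j \<omega>" for \<omega>
    by (auto simp: cond_expectation_complex_def)
  have pr: "integrable M (\<lambda>\<omega>. f \<omega> * ?r \<omega> * Re (g \<omega>))" "integrable M (\<lambda>\<omega>. f \<omega> * ?r \<omega> * ?r \<omega>)"
      "(LINT \<omega>|M. f \<omega> * ?r \<omega> * ?r \<omega>) = (LINT \<omega>|M. f \<omega> * ?r \<omega> * Re (g \<omega>))"
    using part[OF i(1)] abs_Re_le_cmod[of "e _"] unfolding r by blast+
  have pj: "integrable M (\<lambda>\<omega>. f \<omega> * ?j \<omega> * Im (g \<omega>))" "integrable M (\<lambda>\<omega>. f \<omega> * ?j \<omega> * ?j \<omega>)"
      "(LINT \<omega>|M. f \<omega> * ?j \<omega> * ?j \<omega>) = (LINT \<omega>|M. f \<omega> * ?j \<omega> * Im (g \<omega>))"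
    using part[OF i(2)] abs_Im_le_cmod[of "e _"] unfolding j by blast+
  \<comment> \<open>The expansion isolates the cross term: the last group pairs each part with its
    conditional expectation and integrates to 0 by \<open>pr\<close> and \<open>pj\<close>.\<close>
  have "(LINT \<omega>|M. f \<omega> * (cmod (g \<omega>))\<^sup>2) = (LINT \<omega>|M. (f \<omega> * (cmod (g \<omega> - e \<omega>))\<^sup>2 + f \<omega> * (cmod (e \<omega>))\<^sup>2) +
     (2 * (f \<omega> * ?r \<omega> * Re (g \<omega>) - f \<omega> * ?r \<omega> * ?r \<omega>) + 2 * (f \<omega> * ?j \<omega> * Im (g \<omega>) - f \<omega> * ?j \<omega> * ?j \<omega>)))"
    unfolding cmod_power2 minus_complex.sel r j
    by (intro Bochner_Integration.integral_cong refl) (simp add: power2_eq_square algebra_simps)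
  also have "\<dots> = (LINT \<omega>|M. f \<omega> * (cmod (g \<omega> - e \<omega>))\<^sup>2) + (LINT \<omega>|M. f \<omega> * (cmod (e \<omega>))\<^sup>2)"
    using pr pj 2 3 by simp
  finally show "(LINT \<omega>|M. f \<omega> * (cmod (g \<omega>))\<^sup>2) =
     (LINT \<omega>|M. f \<omega> * (cmod (g \<omega> - e \<omega>))\<^sup>2) + (LINT \<omega>|M. f \<omega> * (cmod (e \<omega>))\<^sup>2)" .
qed

text \<open>The conditional noise power is only almost surely at least 1; \<open>sg\<close> differs from it on a null set.\<close>

lemma conditional_moments_factor:
  fixes G :: "'i \<Rightarrow> 'a \<Rightarrow> complex"
  assumes J: "finite J" and G [measurable]: "\<And>i. i \<in> J \<Longrightarrow> G i \<in> borel_measurable M"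
    and G2: "\<And>i. i \<in> J \<Longrightarrow> integrable M (\<lambda>\<omega>. (cmod (G i \<omega>))\<^sup>2)"
  obtains gh :: "'b \<Rightarrow> complex" and sg :: "'b \<Rightarrow> real"
  where "gh \<in> borel_measurable N" "sg \<in> borel_measurable N" "\<And>s. sg s \<ge> 1"
    "\<And>\<omega>. \<omega> \<in> space M \<Longrightarrow> e \<omega> = gh (X \<omega>)"
    "AE \<omega> in M. 1 + (\<Sum>i\<in>J. cond_expectation M X N (\<lambda>\<omega>. (cmod (G i \<omega>))\<^sup>2) \<omega>) + cond_variance M X N g \<omega> = sg (X \<omega>)"
    "integrable M (\<lambda>\<omega>. (cmod (gh (X \<omega>)))\<^sup>2)"
    "(\<integral>\<^sup>+\<omega>. ennreal (((cmod (g \<omega> - gh (X \<omega>)))\<^sup>2 + (\<Sum>i\<in>J. (cmod (G i \<omega>))\<^sup>2) + 1) / sg (X \<omega>)) \<partial>M) = 1"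
    "(\<integral>\<^sup>+\<omega>. ennreal (((cmod (g \<omega>))\<^sup>2 + (\<Sum>i\<in>J. (cmod (G i \<omega>))\<^sup>2) + 1) / (sg (X \<omega>) + (cmod (gh (X \<omega>)))\<^sup>2)) \<partial>M) = 1"
proof -
  interpret FS: finite_measure_subalgebra M F by (rule sigma_subalgebra_vimage)
  define h where "h i = cond_expectation M X N (\<lambda>\<omega>. (cmod (G i \<omega>))\<^sup>2)" for i
  define v where "v = cond_variance M X N g"
  have v_eq: "v = cond_expectation M X N (\<lambda>\<omega>. (cmod (g \<omega> - e \<omega>))\<^sup>2)"
    by (simp add: v_def cond_variance_def)
  obtain hr where hr [measurable]: "hr \<in> borel_measurable N"
    "\<And>\<omega>. \<omega> \<in> space M \<Longrightarrow> cond_expectation M X N (\<lambda>\<omega>. Re (g \<omega>)) \<omega> = hr (X \<omega>)"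
    using cond_expectation_factor by blast
  obtain hi where hi [measurable]: "hi \<in> borel_measurable N"
    "\<And>\<omega>. \<omega> \<in> space M \<Longrightarrow> cond_expectation M X N (\<lambda>\<omega>. Im (g \<omega>)) \<omega> = hi (X \<omega>)"
    using cond_expectation_factor by blast
  define gh where "gh y = complex_of_real (hr y) + \<i> * complex_of_real (hi y)" for y
  have gh [measurable]: "gh \<in> borel_measurable N" unfolding gh_def by measurable
  have e_gh: "e \<omega> = gh (X \<omega>)" if "\<omega> \<in> space M" for \<omega>
    using that hr(2) hi(2) by (simp add: cond_expectation_complex_def gh_def Complex_eq)
  have [measurable]: "(\<lambda>\<omega>. 1 + (\<Sum>i\<in>J. h i \<omega>) + v \<omega>) \<in> borel_measurable F"
    unfolding h_def v_eq using cond_expectation_measurable by measurable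
  then obtain s0 where s0 [measurable]: "s0 \<in> borel_measurable N"
    "\<And>\<omega>. \<omega> \<in> space M \<Longrightarrow> 1 + (\<Sum>i\<in>J. h i \<omega>) + v \<omega> = s0 (X \<omega>)"
    using Doob_Dynkin_real[OF observation_in_space] by (smt (verit))
  define sg where "sg y = max 1 (s0 y)" for y
  have sg [measurable]: "sg \<in> borel_measurable N" unfolding sg_def by measurable
  have sg1: "sg y \<ge> 1" for y by (simp add: sg_def)
  have h_nn: "AE \<omega> in M. \<forall>i\<in>J. h i \<omega> \<ge> 0"
    unfolding AE_ball_countable[OF countable_finite[OF J]] h_def cond_expectation_def
    by (intro ballI FS.real_cond_exp_pos) auto
  have v_nn: "AE \<omega> in M. v \<omega> \<ge> 0"
    unfolding v_eq cond_expectation_def by (intro FS.real_cond_exp_pos) auto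
  have sg_eq: "AE \<omega> in M. 1 + (\<Sum>i\<in>J. h i \<omega>) + v \<omega> = sg (X \<omega>)"
    using h_nn v_nn AE_space
  proof eventually_elim
    case (elim \<omega>)
    have "(\<Sum>i\<in>J. h i \<omega>) \<ge> 0" using elim by (intro sum_nonneg) auto
    then show ?case
      using elim s0(2)[of \<omega>] by (simp add: sg_def)
  qed
  define Q where "Q \<omega> = (\<Sum>i\<in>J. (cmod (G i \<omega>))\<^sup>2)" for \<omega>
  have Q [measurable]: "Q \<in> borel_measurable M" unfolding Q_def by measurable
  \<comment> \<open>Under a bounded weight that depends on \<open>X\<close> only, each conditional
    moment has the same integral as the variable it averages. In this way conditional powers are
    handled without conditional distributions.\<close>
  have key: "integrable M (\<lambda>\<omega>. f \<omega> * (cmod (g \<omega> - e \<omega>))\<^sup>2 + f \<omega> * Q \<omega> + f \<omega>)"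
    "(LINT \<omega>|M. f \<omega> * (cmod (g \<omega> - e \<omega>))\<^sup>2 + f \<omega> * Q \<omega> + f \<omega>) = (LINT \<omega>|M. f \<omega> * sg (X \<omega>))"
    "integrable M (\<lambda>\<omega>. f \<omega> * sg (X \<omega>))"
    if f: "f \<in> borel_measurable F" and bound: "\<And>\<omega>. \<omega> \<in> space M \<Longrightarrow> \<bar>f \<omega>\<bar> \<le> 1" for f
  proof -
    have fM [measurable]: "f \<in> borel_measurable M" by (rule measurable_from_vimage[OF f])
    note bd = integrable_bounded_mult[OF _ fM bound]
    have fi: "integrable M f" using bd[of "\<lambda>_. 1"] by simp
    have i1: "integrable M (\<lambda>\<omega>. f \<omega> * (cmod (g \<omega> - e \<omega>))\<^sup>2)"
      by (intro bd integrable_estimation_error_square)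
    have iG: "integrable M (\<lambda>\<omega>. f \<omega> * (cmod (G i \<omega>))\<^sup>2)" if "i \<in> J" for i
      by (intro bd G2 that)
    have iQ: "integrable M (\<lambda>\<omega>. f \<omega> * Q \<omega>)"
      unfolding Q_def by (intro bd Bochner_Integration.integrable_sum G2)
    show "integrable M (\<lambda>\<omega>. f \<omega> * (cmod (g \<omega> - e \<omega>))\<^sup>2 + f \<omega> * Q \<omega> + f \<omega>)"
      by (intro Bochner_Integration.integrable_add i1 iQ fi)
    have v1: "integrable M (\<lambda>\<omega>. f \<omega> * v \<omega>)"
      "(LINT \<omega>|M. f \<omega> * v \<omega>) = (LINT \<omega>|M. f \<omega> * (cmod (g \<omega> - e \<omega>))\<^sup>2)"
      unfolding v_eq using cond_expectation_integral[OF i1 f] by auto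
    have h1: "integrable M (\<lambda>\<omega>. f \<omega> * h i \<omega>)"
      "(LINT \<omega>|M. f \<omega> * h i \<omega>) = (LINT \<omega>|M. f \<omega> * (cmod (G i \<omega>))\<^sup>2)" if "i \<in> J" for i
      unfolding h_def using cond_expectation_integral[OF iG[OF that] f] that by auto
    have "(LINT \<omega>|M. f \<omega> * (cmod (g \<omega> - e \<omega>))\<^sup>2 + f \<omega> * Q \<omega> + f \<omega>) =
      (LINT \<omega>|M. f \<omega> * v \<omega>) + (\<Sum>i\<in>J. LINT \<omega>|M. f \<omega> * h i \<omega>) + (LINT \<omega>|M. f \<omega>)"
      using i1 iG iQ fi v1 h1 by (simp add: Q_def sum_distrib_left)
    also have "\<dots> = (LINT \<omega>|M. f \<omega> * v \<omega> + (\<Sum>i\<in>J. f \<omega> * h i \<omega>) + f \<omega>)"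
      using v1 h1 fi by simp
    also have "\<dots> = (LINT \<omega>|M. f \<omega> * sg (X \<omega>))"
    proof (rule integral_cong_AE)
      show "AE \<omega> in M. f \<omega> * v \<omega> + (\<Sum>i\<in>J. f \<omega> * h i \<omega>) + f \<omega> = f \<omega> * sg (X \<omega>)"
        using sg_eq
      proof eventually_elim
        case (elim \<omega>)
        show ?case by (simp add: elim[symmetric] sum_distrib_left algebra_simps)
      qed
    qed (use v1 h1 fi in \<open>auto intro!: borel_measurable_add borel_measurable_sum borel_measurable_integrable\<close>)
    finally show "(LINT \<omega>|M. f \<omega> * (cmod (g \<omega> - e \<omega>))\<^sup>2 + f \<omega> * Q \<omega> + f \<omega>) = (LINT \<omega>|M. f \<omega> * sg (X \<omega>))" .
    have "integrable M (\<lambda>\<omega>. f \<omega> * v \<omega> + (\<Sum>i\<in>J. f \<omega> * h i \<omega>) + f \<omega>)"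
      using v1 h1 fi by auto
    then show "integrable M (\<lambda>\<omega>. f \<omega> * sg (X \<omega>))"
    proof (rule integrable_cong_AE_imp)
      show "AE \<omega> in M. f \<omega> * v \<omega> + (\<Sum>i\<in>J. f \<omega> * h i \<omega>) + f \<omega> = f \<omega> * sg (X \<omega>)"
        using sg_eq
      proof eventually_elim
        case (elim \<omega>)
        show ?case by (simp add: elim[symmetric] sum_distrib_left algebra_simps)
      qed
    qed measurable
  qed
  have one: "(\<integral>\<^sup>+\<omega>. ennreal (u \<omega>) \<partial>M) = 1"
    if "integrable M u" "(LINT \<omega>|M. u \<omega>) = 1" "\<And>\<omega>. \<omega> \<in> space M \<Longrightarrow> u \<omega> \<ge> 0" for u :: "'a \<Rightarrow> real"
    using that by (subst nn_integral_eq_integral) auto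
  \<comment> \<open>Weights for the two normalized powers. Since \<open>sg\<close> is at least 1,
    both lie between 0 and 1, so the weighted moments are integrable.\<close>
  define f1 where "f1 \<omega> = 1 / sg (X \<omega>)" for \<omega>
  define f2 where "f2 \<omega> = 1 / (sg (X \<omega>) + (cmod (gh (X \<omega>)))\<^sup>2)" for \<omega>
  note [measurable] = observation_measurable_vimage
  have f1: "f1 \<in> borel_measurable F" unfolding f1_def by measurable
  have f2: "f2 \<in> borel_measurable F" unfolding f2_def by measurable
  have sg0: "sg y > 0" "sg y + (cmod (gh y))\<^sup>2 > 0" for y
    using sg1[of y] by (auto intro: add_pos_nonneg)
  have f1b: "\<bar>f1 \<omega>\<bar> \<le> 1" for \<omega>
    using sg1[of "X \<omega>"] sg0[of "X \<omega>"] by (simp add: f1_def)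
  have f2b: "\<bar>f2 \<omega>\<bar> \<le> 1" for \<omega>
    using sg1[of "X \<omega>"] sg0[of "X \<omega>"] by (simp add: f2_def add_increasing2)
  \<comment> \<open>From \<open>x \<le> 1 + x^2\<close>: dividing by \<open>sg + |gh|^2\<close>
    tames the possibly unbounded estimate, as orthogonality requires.\<close>
  have f2b': "cmod (e \<omega>) * \<bar>f2 \<omega>\<bar> \<le> 1" if "\<omega> \<in> space M" for \<omega>
  proof -
    define x where "x = cmod (gh (X \<omega>))"
    have "0 \<le> (x - 1)\<^sup>2 + x\<^sup>2" by simp
    then have "x \<le> sg (X \<omega>) + x\<^sup>2"
      using sg1[of "X \<omega>"] by (simp add: power2_eq_square algebra_simps)
    then show ?thesis
      using sg0[of "X \<omega>"] by (simp add: f2_def e_gh[OF that] x_def)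
  qed
  have f1sg: "f1 \<omega> * sg (X \<omega>) = 1" for \<omega> using sg0[of "X \<omega>"] by (simp add: f1_def)
  have f2sg: "f2 \<omega> * sg (X \<omega>) + f2 \<omega> * (cmod (gh (X \<omega>)))\<^sup>2 = 1" for \<omega>
    using sg0[of "X \<omega>"] by (simp add: f2_def divide_simps add_divide_distrib[symmetric])
  have nn: "f1 \<omega> \<ge> 0" "f2 \<omega> \<ge> 0" "Q \<omega> \<ge> 0" for \<omega>
    using sg0[of "X \<omega>"] by (auto simp: f1_def f2_def Q_def intro: sum_nonneg less_imp_le)
  have A: "(\<integral>\<^sup>+\<omega>. ennreal (f1 \<omega> * (cmod (g \<omega> - e \<omega>))\<^sup>2 + f1 \<omega> * Q \<omega> + f1 \<omega>) \<partial>M) = 1"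
  proof (rule one)
    show "(LINT \<omega>|M. f1 \<omega> * (cmod (g \<omega> - e \<omega>))\<^sup>2 + f1 \<omega> * Q \<omega> + f1 \<omega>) = 1"
      using key(2)[OF f1 f1b] by (simp add: f1sg prob_space)
  qed (use key(1)[OF f1 f1b] nn in simp_all)
  note o = estimation_error_orthogonal[OF f2 f2b f2b']
  have iQ2: "integrable M (\<lambda>\<omega>. f2 \<omega> * Q \<omega> + f2 \<omega>)"
    using Bochner_Integration.integrable_diff[OF key(1)[OF f2 f2b] o(2)] by (simp add: algebra_simps)
  have Bm: "(\<integral>\<^sup>+\<omega>. ennreal (f2 \<omega> * (cmod (g \<omega>))\<^sup>2 + (f2 \<omega> * Q \<omega> + f2 \<omega>)) \<partial>M) = 1"
  proof (rule one)
    \<comment> \<open>Orthogonality splits \<open>|g|^2\<close> into error and estimate. The error,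
      the powers in \<open>Q\<close> and the unit noise combine to \<open>sg\<close>, and adding
      \<open>|e|^2\<close> gives the denominator of \<open>f2\<close>.\<close>
    have "(LINT \<omega>|M. f2 \<omega> * (cmod (g \<omega>))\<^sup>2 + (f2 \<omega> * Q \<omega> + f2 \<omega>)) =
      (LINT \<omega>|M. f2 \<omega> * (cmod (g \<omega> - e \<omega>))\<^sup>2 + f2 \<omega> * Q \<omega> + f2 \<omega>) + (LINT \<omega>|M. f2 \<omega> * (cmod (e \<omega>))\<^sup>2)"
      unfolding add.assoc
      by (subst (1 2) Bochner_Integration.integral_add[OF _ iQ2]) (simp_all only: o)
    also have "\<dots> = (LINT \<omega>|M. f2 \<omega> * sg (X \<omega>) + f2 \<omega> * (cmod (e \<omega>))\<^sup>2)"
      unfolding key(2)[OF f2 f2b] by (rule Bochner_Integration.integral_add[OF key(3)[OF f2 f2b] o(3), symmetric])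
    also have "\<dots> = (LINT \<omega>|M. 1)"
      by (intro Bochner_Integration.integral_cong refl) (simp add: e_gh f2sg)
    finally show "(LINT \<omega>|M. f2 \<omega> * (cmod (g \<omega>))\<^sup>2 + (f2 \<omega> * Q \<omega> + f2 \<omega>)) = 1"
      by (simp add: prob_space)
  qed (use Bochner_Integration.integrable_add[OF o(1) iQ2] nn in simp_all)
  show thesis
  proof (rule that[OF gh sg sg1 e_gh])
    show "AE \<omega> in M. 1 + (\<Sum>i\<in>J. cond_expectation M X N (\<lambda>\<omega>. (cmod (G i \<omega>))\<^sup>2) \<omega>) + cond_variance M X N g \<omega> = sg (X \<omega>)"
      using sg_eq by (simp add: h_def v_def)
    show "integrable M (\<lambda>\<omega>. (cmod (gh (X \<omega>)))\<^sup>2)"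
      using integrable_cond_expectation_complex_square
      by (subst Bochner_Integration.integrable_cong[OF refl]) (simp_all add: e_gh[symmetric])
    show "(\<integral>\<^sup>+\<omega>. ennreal (((cmod (g \<omega> - gh (X \<omega>)))\<^sup>2 + (\<Sum>i\<in>J. (cmod (G i \<omega>))\<^sup>2) + 1) / sg (X \<omega>)) \<partial>M) = 1"
      unfolding A[symmetric]
      by (intro nn_integral_cong) (simp add: e_gh f1_def Q_def add_divide_distrib)
    show "(\<integral>\<^sup>+\<omega>. ennreal (((cmod (g \<omega>))\<^sup>2 + (\<Sum>i\<in>J. (cmod (G i \<omega>))\<^sup>2) + 1) / (sg (X \<omega>) + (cmod (gh (X \<omega>)))\<^sup>2)) \<partial>M) = 1"
      unfolding Bm[symmetric]
      by (intro nn_integral_cong) (simp add: f2_def Q_def add_divide_distrib add.assoc)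
  qed
qed

end

section \<open>The channel within one coherence interval\<close>

lemma finite_gaussian_sources [simp]: "finite (gaussian_sources P)"
proof -
  have f: "finite {c k m | k m. k \<in> {1..a} \<and> m \<in> {1..b}}"
    for c :: "nat \<Rightarrow> nat \<Rightarrow> gaussian_source" and a b :: nat
    by (rule finite_subset[of _ "(\<lambda>(k, m). c k m) ` ({1..a} \<times> {1..b})"]) auto
  show ?thesis
    unfolding gaussian_sources_def by (intro finite_UnI f)
qed

lemma mem_gaussian_sources [simp]:
  "Channel k m \<in> gaussian_sources P \<longleftrightarrow> k \<in> {1..n_users P} \<and> m \<in> {1..n_antennas P}"
  "Rev_Noise m s \<in> gaussian_sources P \<longleftrightarrow> m \<in> {1..n_antennas P} \<and> s \<in> {1..rev_len P}"
  "Pilot_Noise k t \<in> gaussian_sources P \<longleftrightarrow> k \<in> {1..n_users P} \<and> t \<in> {1..fwd_len P}"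
  "Data_Noise k t \<in> gaussian_sources P \<longleftrightarrow> k \<in> {1..n_users P} \<and> t \<in> {1..data_len P}"
  by (auto simp: gaussian_sources_def)

lemma prob_space_interval_space: "prob_space (interval_space P)"
  unfolding interval_space_def by (intro prob_space_PiM CN01.prob_space_axioms)

lemma space_interval_space:
  "\<omega> \<in> space (interval_space P) \<longleftrightarrow> (\<forall>i. i \<notin> gaussian_sources P \<longrightarrow> \<omega> i = undefined)"
  by (simp add: interval_space_def space_PiM PiE_iff extensional_def)

lemma measurable_source [measurable]:
  "i \<in> gaussian_sources P \<Longrightarrow> (\<lambda>\<omega>. \<omega> i) \<in> borel_measurable (interval_space P)"
  unfolding interval_space_def using measurable_component_singleton[of i "gaussian_sources P" "\<lambda>_. CN01"]
  by (simp cong: measurable_cong_sets)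

lemma integrable_source_square:
  assumes "i \<in> gaussian_sources P"
  shows "integrable (interval_space P) (\<lambda>\<omega>. (cmod (\<omega> i))\<^sup>2)"
proof -
  have d: "distr (interval_space P) CN01 (\<lambda>\<omega>. \<omega> i) = CN01"
    unfolding interval_space_def
    using distr_PiM_component[of "gaussian_sources P" "\<lambda>_. CN01" i, OF CN01.prob_space_axioms assms] .
  have m: "(\<lambda>\<omega>. \<omega> i) \<in> interval_space P \<rightarrow>\<^sub>M CN01"
    using measurable_source[OF assms] by (simp cong: measurable_cong_sets)
  have "integrable (distr (interval_space P) CN01 (\<lambda>\<omega>. \<omega> i)) (\<lambda>z. (cmod z)\<^sup>2)"
    unfolding d by (rule integrable_CN01_norm_square)
  then show ?thesis by (rule integrable_distr[OF m])
qed

locale trained_downlink =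
  fixes P :: downlink
  assumes sys: "downlink_system P"
begin

abbreviation "I \<equiv> interval_space P"
abbreviation "K \<equiv> n_users P"
abbreviation "A \<equiv> n_antennas P"

sublocale I: prob_space I by (rule prob_space_interval_space)

lemma rev_received_measurable [measurable]: "rev_received P \<in> I \<rightarrow>\<^sub>M matrix_space A (rev_len P)"
  unfolding rev_received_def matrix_space_def
  by (rule measurable_restrict) (auto intro!: borel_measurable_add borel_measurable_times borel_measurable_sum)

sublocale rev: observation I "rev_received P" "matrix_space A (rev_len P)"
  by (simp add: observation_def observation_axioms_def I.prob_space_axioms)

lemma channel_estimate_measurable [measurable]: "channel_estimate P \<in> I \<rightarrow>\<^sub>M matrix_space K A"
  unfolding channel_estimate_def matrix_space_def[of K A]
proof (rule measurable_restrict)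
  fix i assume "i \<in> {1..K} \<times> {1..A}"
  then obtain k m where i: "i = (k, m)" and km: "k \<in> {1..K}" "m \<in> {1..A}" by auto
  interpret estimation I "rev_received P" "matrix_space A (rev_len P)" "\<lambda>\<omega>. \<omega> (Channel k m)"
    by standard (use km integrable_source_square in \<open>auto intro!: measurable_source\<close>)
  show "(\<lambda>\<omega>. case i of (k, m) \<Rightarrow> cond_expectation_complex I (rev_received P) (matrix_space A (rev_len P))
      (\<lambda>\<omega>. \<omega> (Channel k m)) \<omega>) \<in> borel_measurable I"
    unfolding i case_prod_conv by (rule cond_expectation_complex_measurable)
qed

text \<open>All conditional expectations in the estimate factor through
  \<open>rev_received P\<close> pointwise. Equality almost surely would say nothing about changing a
  single coordinate of a given outcome.\<close>

lemma channel_estimate_cong: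
  assumes "\<omega> \<in> space I" "\<omega>' \<in> space I" and eq: "rev_received P \<omega> = rev_received P \<omega>'"
  shows "channel_estimate P \<omega> = channel_estimate P \<omega>'"
proof -
  have ce: "cond_expectation I (rev_received P) (matrix_space A (rev_len P)) u \<omega> =
    cond_expectation I (rev_received P) (matrix_space A (rev_len P)) u \<omega>'" for u
    using rev.cond_expectation_factor[of u] assms by metis
  show ?thesis
    unfolding channel_estimate_def cond_expectation_complex_def ce[of "\<lambda>\<omega>. Re (\<omega> _)"] ce[of "\<lambda>\<omega>. Im (\<omega> _)"] ..
qed

lemma precoding_matrix_measurable [measurable]: "precoding_matrix P \<in> I \<rightarrow>\<^sub>M matrix_space A K"
proof -
  have [measurable]: "precoder P \<in> matrix_space K A \<rightarrow>\<^sub>M matrix_space A K"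
    using sys by (simp add: downlink_system_def)
  show ?thesis unfolding precoding_matrix_def[abs_def] by measurable
qed

lemma precoding_entry_measurable [measurable]:
  assumes "m \<in> {1..A}" "j \<in> {1..K}"
  shows "(\<lambda>\<omega>. precoding_matrix P \<omega> (m, j)) \<in> borel_measurable I"
proof -
  have "(\<lambda>a. a (m, j)) \<in> borel_measurable (matrix_space A K)"
    unfolding matrix_space_def using assms by (intro measurable_component_singleton) auto
  from measurable_compose[OF precoding_matrix_measurable this] show ?thesis .
qed

lemma effective_channel_measurable [measurable]:
  assumes "i \<in> {1..K}" "j \<in> {1..K}"
  shows "effective_channel P i j \<in> borel_measurable I"
  unfolding effective_channel_def[abs_def]
  by (intro borel_measurable_times borel_measurable_sum borel_measurable_const
      measurable_source precoding_entry_measurable) (use assms in auto)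

lemma pilot_received_measurable [measurable]:
  assumes "k \<in> {1..K}"
  shows "pilot_received P k \<in> I \<rightarrow>\<^sub>M pilot_space P"
  unfolding pilot_received_def pilot_space_def
  by (intro measurable_restrict borel_measurable_add borel_measurable_sum borel_measurable_times
      measurable_source effective_channel_measurable borel_measurable_const) (use assms in auto)

text \<open>By the Cauchy--Schwarz inequality and \<open>Tr (A\<^sup>\<dagger> A) = 1\<close>, the effective channel gain of user \<open>i\<close> is
  dominated by the norm of that user's channel vector.\<close>

lemma integrable_effective_channel_square:
  assumes i: "i \<in> {1..K}" and j: "j \<in> {1..K}"
  shows "integrable I (\<lambda>\<omega>. (cmod (effective_channel P i j \<omega>))\<^sup>2)"
proof (rule Bochner_Integration.integrable_bound)
  have \<rho>: "fwd_snr P i > 0"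
    using sys i by (auto simp: downlink_system_def)
  show "integrable I (\<lambda>\<omega>. fwd_snr P i * (\<Sum>m=1..A. (cmod (\<omega> (Channel i m)))\<^sup>2))"
    by (intro integrable_mult_right Bochner_Integration.integrable_sum integrable_source_square) (use i in auto)
  have "AE \<omega> in I. (\<Sum>j=1..K. \<Sum>m=1..A. cnj (precoding_matrix P \<omega> (m, j)) * precoding_matrix P \<omega> (m, j)) = 1"
    using sys by (simp add: downlink_system_def)
  then show "AE \<omega> in I. norm ((cmod (effective_channel P i j \<omega>))\<^sup>2)
      \<le> norm (fwd_snr P i * (\<Sum>m=1..A. (cmod (\<omega> (Channel i m)))\<^sup>2))"
  proof eventually_elim
    case (elim \<omega>)
    define a where "a m j = precoding_matrix P \<omega> (m, j)" for m j
    have "complex_of_real (\<Sum>j=1..K. \<Sum>m=1..A. (cmod (a m j))\<^sup>2) = of_real 1"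
      using elim unfolding of_real_sum complex_norm_square a_def by (simp add: mult.commute)
    then have one: "(\<Sum>j=1..K. \<Sum>m=1..A. (cmod (a m j))\<^sup>2) = 1"
      by (simp only: of_real_eq_iff)
    \<comment> \<open>The columns share the total energy 1, so none exceeds it.\<close>
    have col: "(\<Sum>m=1..A. (cmod (a m j))\<^sup>2) \<le> 1"
      unfolding one[symmetric] using j by (intro member_le_sum) (auto intro: sum_nonneg)
    have "(cmod (\<Sum>m=1..A. \<omega> (Channel i m) * a m j))\<^sup>2 \<le> (\<Sum>m=1..A. cmod (\<omega> (Channel i m)) * cmod (a m j))\<^sup>2"
      by (intro power_mono) (auto simp: norm_mult[symmetric] intro: norm_sum)
    also have "\<dots> \<le> (\<Sum>m=1..A. (cmod (\<omega> (Channel i m)))\<^sup>2) * (\<Sum>m=1..A. (cmod (a m j))\<^sup>2)"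
      by (rule Cauchy_Schwarz_ineq_sum)
    also have "\<dots> \<le> (\<Sum>m=1..A. (cmod (\<omega> (Channel i m)))\<^sup>2) * 1"
      by (intro mult_left_mono col sum_nonneg) auto
    finally show ?case
      using \<rho> by (simp add: effective_channel_def norm_mult power_mult_distrib a_def sum_nonneg)
  qed
qed (use assms in measurable)

text \<open>Data noise enters neither kind of pilot, and the precoder sees the channel only through
  the reverse pilots. The updated outcome stays in the space because the index is one of the
  sources, so one coordinate may vary under Fubini's theorem.\<close>

lemma data_noise_irrelevant:
  assumes \<omega>: "\<omega> \<in> space I" and k: "k \<in> {1..K}" and t: "t \<in> {1..data_len P}"
  shows "effective_channel P i j (fun_upd \<omega> (Data_Noise k t) z) = effective_channel P i j \<omega>"
    "pilot_received P i (fun_upd \<omega> (Data_Noise k t) z) = pilot_received P i \<omega>"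
proof -
  let ?\<omega>' = "fun_upd \<omega> (Data_Noise k t) z"
  have "?\<omega>' \<in> space I"
    using \<omega> k t by (auto simp: space_interval_space)
  moreover have "rev_received P ?\<omega>' = rev_received P \<omega>"
    by (simp add: rev_received_def)
  ultimately have "channel_estimate P ?\<omega>' = channel_estimate P \<omega>"
    by (rule channel_estimate_cong[OF _ \<omega>])
  then have p: "precoding_matrix P ?\<omega>' = precoding_matrix P \<omega>"
    unfolding precoding_matrix_def by (rule arg_cong)
  show g: "effective_channel P i j ?\<omega>' = effective_channel P i j \<omega>" for i j
    unfolding effective_channel_def p by simp
  show "pilot_received P i ?\<omega>' = pilot_received P i \<omega>"
    by (simp add: pilot_received_def g)
qed

text \<open>The single coordinate \<open>Data_Noise k t\<close> is integrated out first: the pilots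
  are constant along it and its second moment is 1. Thus the constant 1 in the noise power and the
  energy of an actual noise sample are interchangeable under weights that depend on the
  pilots.\<close>

lemma nn_integral_data_noise:
  fixes f :: "(nat \<Rightarrow> complex) \<Rightarrow> real"
  assumes k: "k \<in> {1..K}" and t: "t \<in> {1..data_len P}"
    and f [measurable]: "f \<in> borel_measurable (pilot_space P)" and nn: "\<And>s. f s \<ge> 0"
  shows "(\<integral>\<^sup>+\<omega>. ennreal ((cmod (\<omega> (Data_Noise k t)))\<^sup>2 * f (pilot_received P k \<omega>)) \<partial>I) =
    (\<integral>\<^sup>+\<omega>. ennreal (f (pilot_received P k \<omega>)) \<partial>I)"
proof -
  interpret product_sigma_finite "\<lambda>_::gaussian_source. CN01"
    by standard
  define d where "d = Data_Noise k t"
  define J where "J = gaussian_sources P - {d}"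
  have d: "d \<in> gaussian_sources P" using k t by (simp add: d_def)
  have J: "finite J" "d \<notin> J" "insert d J = gaussian_sources P"
    using d by (auto simp: J_def)
  have I_eq: "I = PiM (insert d J) (\<lambda>_. CN01)"
    by (simp add: J interval_space_def)
  have pm [measurable]: "(\<lambda>\<omega>. f (pilot_received P k \<omega>)) \<in> borel_measurable (PiM (insert d J) (\<lambda>_. CN01))"
    unfolding I_eq[symmetric] using k by measurable
  have dm [measurable]: "(\<lambda>\<omega>. \<omega> d) \<in> borel_measurable (PiM (insert d J) (\<lambda>_. CN01))"
    unfolding I_eq[symmetric] using d by measurable
  have "(\<integral>\<^sup>+\<omega>. ennreal ((cmod (\<omega> d))\<^sup>2 * f (pilot_received P k \<omega>)) \<partial>I) =
    (\<integral>\<^sup>+x. \<integral>\<^sup>+y. ennreal ((cmod y)\<^sup>2 * f (pilot_received P k (fun_upd x d y))) \<partial>CN01 \<partial>PiM J (\<lambda>_. CN01))"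
    unfolding I_eq by (subst product_nn_integral_insert[OF J(1,2)]) simp_all
  also have "\<dots> = (\<integral>\<^sup>+x. \<integral>\<^sup>+y. ennreal (f (pilot_received P k (fun_upd x d y))) \<partial>CN01 \<partial>PiM J (\<lambda>_. CN01))"
  proof (rule nn_integral_cong)
    fix x assume x: "x \<in> space (PiM J (\<lambda>_. CN01))"
    define c where "c = f (pilot_received P k (fun_upd x d 0))"
    have 0: "(fun_upd x d 0) \<in> space I"
      using x d by (auto simp: space_interval_space J_def space_PiM PiE_iff extensional_def)
    have const: "f (pilot_received P k (fun_upd x d y)) = c" for y
      using data_noise_irrelevant(2)[OF 0 k t, of k y] by (simp only: c_def d_def fun_upd_upd)
    have "(\<integral>\<^sup>+y. ennreal ((cmod y)\<^sup>2 * c) \<partial>CN01) = ennreal c"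
    proof -
      have "c \<ge> 0" using nn by (simp add: c_def)
      then show ?thesis
        by (simp only: ennreal_mult[OF zero_le_power2], subst nn_integral_multc)
           (simp_all add: nn_integral_CN01_norm_square cong: measurable_cong_sets)
    qed
    then show "(\<integral>\<^sup>+y. ennreal ((cmod y)\<^sup>2 * f (pilot_received P k (fun_upd x d y))) \<partial>CN01) =
        (\<integral>\<^sup>+y. ennreal (f (pilot_received P k (fun_upd x d y))) \<partial>CN01)"
      unfolding const using CN01.emeasure_space_1 by simp
  qed
  also have "\<dots> = (\<integral>\<^sup>+\<omega>. ennreal (f (pilot_received P k \<omega>)) \<partial>I)"
    unfolding I_eq by (subst product_nn_integral_insert[OF J(1,2)]) simp_all
  finally show ?thesis by (simp add: d_def)
qed

definition user_rate :: "nat \<Rightarrow> real" where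
  "user_rate k = (LINT \<omega>|I. capacity
        ((cmod (cond_expectation_complex I (pilot_received P k) (pilot_space P)
            (effective_channel P k k) \<omega>))\<^sup>2 /
         (1 + (\<Sum>i\<in>{1..n_users P} - {k}.
                cond_expectation I (pilot_received P k) (pilot_space P)
                  (\<lambda>\<omega>. (cmod (effective_channel P k i \<omega>))\<^sup>2) \<omega>)
            + cond_variance I (pilot_received P k) (pilot_space P)
                (effective_channel P k k) \<omega>)))"

text \<open>Turns the conditional moments into data available to a decoder: functions
  \<open>gh\<close> and \<open>sg\<close> of the pilot vector. The logarithm becomes natural, hence
  the factor \<open>ln 2\<close>, and the unit noise term becomes the energy of a noise sample,
  matching the signal actually received.\<close>

lemma user_rate_as_pilot_function:
  assumes k: "k \<in> {1..K}"
  obtains gh :: "(nat \<Rightarrow> complex) \<Rightarrow> complex" and sg :: "(nat \<Rightarrow> complex) \<Rightarrow> real"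
  where "gh \<in> borel_measurable (pilot_space P)" "sg \<in> borel_measurable (pilot_space P)" "\<And>s. sg s \<ge> 1"
    "integrable I (\<lambda>\<omega>. ln (1 + (cmod (gh (pilot_received P k \<omega>)))\<^sup>2 / sg (pilot_received P k \<omega>)))"
    "(LINT \<omega>|I. ln (1 + (cmod (gh (pilot_received P k \<omega>)))\<^sup>2 / sg (pilot_received P k \<omega>))) = user_rate k * ln 2"
    "\<And>t. t \<in> {1..data_len P} \<Longrightarrow> (\<integral>\<^sup>+\<omega>. ennreal (((cmod (effective_channel P k k \<omega> - gh (pilot_received P k \<omega>)))\<^sup>2 +
        (\<Sum>i\<in>{1..K} - {k}. (cmod (effective_channel P k i \<omega>))\<^sup>2) + (cmod (\<omega> (Data_Noise k t)))\<^sup>2) /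
        sg (pilot_received P k \<omega>)) \<partial>I) = 1"
    "\<And>t. t \<in> {1..data_len P} \<Longrightarrow> (\<integral>\<^sup>+\<omega>. ennreal (((\<Sum>i\<in>{1..K}. (cmod (effective_channel P k i \<omega>))\<^sup>2) +
        (cmod (\<omega> (Data_Noise k t)))\<^sup>2) /
        (sg (pilot_received P k \<omega>) + (cmod (gh (pilot_received P k \<omega>)))\<^sup>2)) \<partial>I) = 1"
proof -
  let ?X = "pilot_received P k" and ?g = "effective_channel P k"
  interpret estimation I ?X "pilot_space P" "?g k"
    by standard (use k integrable_effective_channel_square in \<open>auto intro!: pilot_received_measurable effective_channel_measurable\<close>)
  obtain gh sg where gh [measurable]: "gh \<in> borel_measurable (pilot_space P)"
    and sg [measurable]: "sg \<in> borel_measurable (pilot_space P)" and sg1: "\<And>s. sg s \<ge> 1"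
    and e: "\<And>\<omega>. \<omega> \<in> space I \<Longrightarrow> cond_expectation_complex I ?X (pilot_space P) (?g k) \<omega> = gh (?X \<omega>)"
    and s: "AE \<omega> in I. 1 + (\<Sum>i\<in>{1..K} - {k}. cond_expectation I ?X (pilot_space P) (\<lambda>\<omega>. (cmod (?g i \<omega>))\<^sup>2) \<omega>) +
        cond_variance I ?X (pilot_space P) (?g k) \<omega> = sg (?X \<omega>)"
    and gh2: "integrable I (\<lambda>\<omega>. (cmod (gh (?X \<omega>)))\<^sup>2)"
    and n1: "(\<integral>\<^sup>+\<omega>. ennreal (((cmod (?g k \<omega> - gh (?X \<omega>)))\<^sup>2 + (\<Sum>i\<in>{1..K} - {k}. (cmod (?g i \<omega>))\<^sup>2) + 1) / sg (?X \<omega>)) \<partial>I) = 1"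
    and n2: "(\<integral>\<^sup>+\<omega>. ennreal (((cmod (?g k \<omega>))\<^sup>2 + (\<Sum>i\<in>{1..K} - {k}. (cmod (?g i \<omega>))\<^sup>2) + 1) /
        (sg (?X \<omega>) + (cmod (gh (?X \<omega>)))\<^sup>2)) \<partial>I) = 1"
    using conditional_moments_factor[of "{1..K} - {k}" ?g] k integrable_effective_channel_square by auto
  have [measurable]: "?X \<in> I \<rightarrow>\<^sub>M pilot_space P" using k by measurable
  have gm [measurable]: "\<And>i. i \<in> {1..K} \<Longrightarrow> ?g i \<in> borel_measurable I" using k by measurable
  have sg0: "sg y > 0" "sg y + (cmod (gh y))\<^sup>2 > 0" for y
    using sg1[of y] by (auto intro: add_pos_nonneg)
  have noise: "(\<integral>\<^sup>+\<omega>. ennreal ((u \<omega> + (cmod (\<omega> (Data_Noise k t)))\<^sup>2) / f (?X \<omega>)) \<partial>I) =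
      (\<integral>\<^sup>+\<omega>. ennreal ((u \<omega> + 1) / f (?X \<omega>)) \<partial>I)"
    if t: "t \<in> {1..data_len P}" and [measurable]: "u \<in> borel_measurable I" "f \<in> borel_measurable (pilot_space P)"
      and nn: "\<And>\<omega>. u \<omega> \<ge> 0" "\<And>s. f s > 0" for u t and f :: "(nat \<Rightarrow> complex) \<Rightarrow> real"
  proof -
    have [measurable]: "(\<lambda>\<omega>. \<omega> (Data_Noise k t)) \<in> borel_measurable I"
      using k t by (intro measurable_source) auto
    have sp: "ennreal ((u \<omega> + a) / f (?X \<omega>)) = ennreal (u \<omega> / f (?X \<omega>)) + ennreal (a * (1 / f (?X \<omega>)))"
      if "a \<ge> 0" for a \<omega>
      using that nn by (simp add: add_divide_distrib ennreal_plus less_imp_le)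
    show ?thesis
      unfolding sp[OF zero_le_power2] sp[OF zero_le_one]
      using nn_integral_data_noise[OF k t, of "\<lambda>s. 1 / f s"] nn(2)
      by (subst (1 2) nn_integral_add) (simp_all add: less_imp_le)
  qed
  show thesis
  proof (rule that[OF gh sg sg1])
    show int: "integrable I (\<lambda>\<omega>. ln (1 + (cmod (gh (?X \<omega>)))\<^sup>2 / sg (?X \<omega>)))"
    proof (rule Bochner_Integration.integrable_bound[OF gh2])
      show "AE \<omega> in I. norm (ln (1 + (cmod (gh (?X \<omega>)))\<^sup>2 / sg (?X \<omega>))) \<le> norm ((cmod (gh (?X \<omega>)))\<^sup>2)"
      proof (rule AE_I2)
        fix \<omega>
        let ?q = "(cmod (gh (?X \<omega>)))\<^sup>2 / sg (?X \<omega>)"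
        \<comment> \<open>With \<open>ln (1 + q) \<le> q\<close>, the bound
          \<open>sg \<ge> 1\<close> dominates the rate integrand by the integrable
          \<open>|gh|^2\<close>.\<close>
        have q: "0 \<le> ?q" "?q \<le> (cmod (gh (?X \<omega>)))\<^sup>2"
          using sg1[of "?X \<omega>"] by (auto simp: divide_le_eq mult_le_cancel_left1 not_less intro!: divide_nonneg_nonneg)
        then show "norm (ln (1 + ?q)) \<le> norm ((cmod (gh (?X \<omega>)))\<^sup>2)"
          using ln_add_one_self_le_self[of ?q] by simp
      qed
    qed measurable
    have "user_rate k = (LINT \<omega>|I. capacity ((cmod (gh (?X \<omega>)))\<^sup>2 / sg (?X \<omega>)))"
      unfolding user_rate_def
    proof (rule integral_cong_AE)
      show "AE \<omega> in I. capacity ((cmod (cond_expectation_complex I ?X (pilot_space P) (?g k) \<omega>))\<^sup>2 /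
         (1 + (\<Sum>i\<in>{1..n_users P} - {k}. cond_expectation I ?X (pilot_space P) (\<lambda>\<omega>. (cmod (?g i \<omega>))\<^sup>2) \<omega>) +
          cond_variance I ?X (pilot_space P) (?g k) \<omega>)) = capacity ((cmod (gh (?X \<omega>)))\<^sup>2 / sg (?X \<omega>))"
        using s AE_space by eventually_elim (simp add: e)
      have cm: "cond_expectation I ?X (pilot_space P) u \<in> borel_measurable I" for u
        by (rule measurable_from_vimage[OF cond_expectation_measurable])
      show "(\<lambda>\<omega>. capacity ((cmod (cond_expectation_complex I ?X (pilot_space P) (?g k) \<omega>))\<^sup>2 /
         (1 + (\<Sum>i\<in>{1..n_users P} - {k}. cond_expectation I ?X (pilot_space P) (\<lambda>\<omega>. (cmod (?g i \<omega>))\<^sup>2) \<omega>) +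
          cond_variance I ?X (pilot_space P) (?g k) \<omega>))) \<in> borel_measurable I"
        unfolding capacity_def cond_variance_def using cm by measurable
    qed (simp add: capacity_def)
    also have "\<dots> * ln 2 = (LINT \<omega>|I. ln (1 + (cmod (gh (?X \<omega>)))\<^sup>2 / sg (?X \<omega>)))"
      by (simp add: capacity_def log_def)
    finally show "(LINT \<omega>|I. ln (1 + (cmod (gh (?X \<omega>)))\<^sup>2 / sg (?X \<omega>))) = user_rate k * ln 2" ..
  next
    fix t assume t: "t \<in> {1..data_len P}"
    show "(\<integral>\<^sup>+\<omega>. ennreal (((cmod (?g k \<omega> - gh (?X \<omega>)))\<^sup>2 +
        (\<Sum>i\<in>{1..K} - {k}. (cmod (?g i \<omega>))\<^sup>2) + (cmod (\<omega> (Data_Noise k t)))\<^sup>2) / sg (?X \<omega>)) \<partial>I) = 1"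
      by (subst noise[OF t]) (use n1 sg0 k in \<open>auto intro!: add_nonneg_nonneg sum_nonneg
        borel_measurable_add borel_measurable_sum borel_measurable_power borel_measurable_norm borel_measurable_diff\<close>)
    have sum_k: "(\<Sum>i\<in>{1..K}. (cmod (?g i \<omega>))\<^sup>2) = (cmod (?g k \<omega>))\<^sup>2 + (\<Sum>i\<in>{1..K} - {k}. (cmod (?g i \<omega>))\<^sup>2)" for \<omega>
      using k by (intro sum.remove) auto
    show "(\<integral>\<^sup>+\<omega>. ennreal (((\<Sum>i\<in>{1..K}. (cmod (?g i \<omega>))\<^sup>2) + (cmod (\<omega> (Data_Noise k t)))\<^sup>2) /
        (sg (?X \<omega>) + (cmod (gh (?X \<omega>)))\<^sup>2)) \<partial>I) = 1"
      by (subst noise[OF t]) (use n2[folded sum_k] sg0 k in \<open>auto intro!: sum_nonneg\<close>)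
  qed
qed

end

section \<open>Products of Gaussians over structured index sets\<close>

abbreviation gaussian_vector :: "'i set \<Rightarrow> ('i \<Rightarrow> complex) measure" where
  "gaussian_vector J \<equiv> PiM J (\<lambda>_. CN01)"

lemma prob_space_gaussian_vector: "prob_space (gaussian_vector J)"
  by (intro prob_space_PiM CN01.prob_space_axioms)

lemma measurable_gaussian_component [measurable]:
  "i \<in> J \<Longrightarrow> (\<lambda>x. x i) \<in> borel_measurable (gaussian_vector J)"
  using measurable_component_singleton[of i J "\<lambda>_. CN01"] by (simp cong: measurable_cong_sets)

lemma measurable_gaussian_componentI:
  "f \<in> M \<rightarrow>\<^sub>M gaussian_vector J \<Longrightarrow> i \<in> J \<Longrightarrow> (\<lambda>x. f x i) \<in> borel_measurable M"
  by (rule measurable_compose[OF _ measurable_gaussian_component])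

lemma measurable_into_gaussian_vector:
  assumes "\<And>i. i \<in> J \<Longrightarrow> (\<lambda>x. f x i) \<in> borel_measurable M" "\<And>x. x \<in> space M \<Longrightarrow> f x \<in> extensional J"
  shows "f \<in> M \<rightarrow>\<^sub>M gaussian_vector J"
  using assms by (intro measurable_PiM_single') (auto simp: extensional_def PiE_iff cong: measurable_cong_sets)

text \<open>The inner index set may vary with the outer index because codebooks of different users
  have different sizes. Restriction keeps the result extensional, as elements of a product space
  must be.\<close>

definition uncurry_vector :: "'i set \<Rightarrow> ('i \<Rightarrow> 'j set) \<Rightarrow> ('i \<Rightarrow> 'j \<Rightarrow> complex) \<Rightarrow> 'i \<times> 'j \<Rightarrow> complex" where
  "uncurry_vector I J x = (\<lambda>(i, j)\<in>Sigma I J. x i j)"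

definition join_vector :: "'i set \<Rightarrow> 'j set \<Rightarrow> ('i \<Rightarrow> complex) \<times> ('j \<Rightarrow> complex) \<Rightarrow> 'i + 'j \<Rightarrow> complex" where
  "join_vector I J = (\<lambda>(x, y). \<lambda>i\<in>I <+> J. case_sum x y i)"

lemma uncurry_vector_measurable:
  "uncurry_vector I J \<in> (\<Pi>\<^sub>M i\<in>I. gaussian_vector (J i)) \<rightarrow>\<^sub>M gaussian_vector (Sigma I J)"
proof (rule measurable_into_gaussian_vector)
  fix ij assume "ij \<in> Sigma I J"
  then obtain i j where ij: "ij = (i, j)" "i \<in> I" "j \<in> J i" by auto
  have "(\<lambda>x. x i j) \<in> borel_measurable (\<Pi>\<^sub>M i\<in>I. gaussian_vector (J i))"
    by (rule measurable_compose[OF measurable_component_singleton[OF ij(2), of "\<lambda>i. gaussian_vector (J i)"] measurable_gaussian_component[OF ij(3)]])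
  then show "(\<lambda>x. uncurry_vector I J x ij) \<in> borel_measurable (\<Pi>\<^sub>M i\<in>I. gaussian_vector (J i))"
    using ij by (simp add: uncurry_vector_def)
qed (simp add: uncurry_vector_def)

text \<open>A product measure is determined by its values on boxes. The preimage of a box is a box
  of boxes, and a product over a dependent sum is an iterated product.\<close>

lemma distr_uncurry_vector:
  assumes I: "finite I" and J: "\<And>i. i \<in> I \<Longrightarrow> finite (J i)"
  shows "distr (\<Pi>\<^sub>M i\<in>I. gaussian_vector (J i)) (gaussian_vector (Sigma I J)) (uncurry_vector I J) =
    gaussian_vector (Sigma I J)"
proof -
  interpret product_sigma_finite "\<lambda>_::'a \<times> 'b. CN01" by standard
  interpret J: product_sigma_finite "\<lambda>_::'b. CN01" by standard
  interpret G: prob_space "gaussian_vector (J i)" for i by (rule prob_space_gaussian_vector)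
  interpret N: product_sigma_finite "\<lambda>i. gaussian_vector (J i)" by standard
  show ?thesis
  proof (rule PiM_eqI)
    show "finite (Sigma I J)" using I J by auto
  next
    fix A :: "'a \<times> 'b \<Rightarrow> complex set" assume A: "\<And>i. i \<in> Sigma I J \<Longrightarrow> A i \<in> sets CN01"
    have "uncurry_vector I J -` (Pi\<^sub>E (Sigma I J) A) \<inter> space (\<Pi>\<^sub>M i\<in>I. gaussian_vector (J i)) =
       (\<Pi>\<^sub>E i\<in>I. \<Pi>\<^sub>E j\<in>J i. A (i, j))"
      by (fastforce simp: uncurry_vector_def space_PiM PiE_iff extensional_def)
    moreover have "(\<Pi>\<^sub>E j\<in>J i. A (i, j)) \<in> sets (gaussian_vector (J i))" if "i \<in> I" for i
      using A J that by (intro sets_PiM_I_finite) auto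
    ultimately have "emeasure (distr (\<Pi>\<^sub>M i\<in>I. gaussian_vector (J i)) (gaussian_vector (Sigma I J)) (uncurry_vector I J))
        (Pi\<^sub>E (Sigma I J) A) = (\<Prod>i\<in>I. emeasure (gaussian_vector (J i)) (\<Pi>\<^sub>E j\<in>J i. A (i, j)))"
      using A I J by (subst emeasure_distr[OF uncurry_vector_measurable])
        (auto simp: N.emeasure_PiM intro!: sets_PiM_I_finite)
    also have "\<dots> = (\<Prod>i\<in>I. \<Prod>j\<in>J i. emeasure CN01 (A (i, j)))"
      using A J by (intro prod.cong refl J.emeasure_PiM) auto
    also have "\<dots> = (\<Prod>i\<in>Sigma I J. emeasure CN01 (A i))"
      using I J by (subst prod.Sigma) auto
    finally show "emeasure (distr (\<Pi>\<^sub>M i\<in>I. gaussian_vector (J i)) (gaussian_vector (Sigma I J)) (uncurry_vector I J))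
        (Pi\<^sub>E (Sigma I J) A) = (\<Prod>i\<in>Sigma I J. emeasure CN01 (A i))" .
  qed simp
qed

lemma ball_Plus: "(\<forall>i\<in>I <+> J. Q i) \<longleftrightarrow> (\<forall>i\<in>I. Q (Inl i)) \<and> (\<forall>j\<in>J. Q (Inr j))"
  by auto

lemma join_vector_measurable:
  "join_vector I J \<in> gaussian_vector I \<Otimes>\<^sub>M gaussian_vector J \<rightarrow>\<^sub>M gaussian_vector (I <+> J)"
proof (rule measurable_into_gaussian_vector)
  fix i assume "i \<in> I <+> J"
  then show "(\<lambda>x. join_vector I J x i) \<in> borel_measurable (gaussian_vector I \<Otimes>\<^sub>M gaussian_vector J)"
    by (cases i) (auto simp: join_vector_def split_beta' intro!: measurable_gaussian_componentI)
qed (auto simp: join_vector_def)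

lemma distr_join_vector:
  assumes I: "finite I" and J: "finite J"
  shows "distr (gaussian_vector I \<Otimes>\<^sub>M gaussian_vector J) (gaussian_vector (I <+> J)) (join_vector I J) =
    gaussian_vector (I <+> J)"
proof -
  interpret product_sigma_finite "\<lambda>_::'a + 'b. CN01" by standard
  interpret I: product_sigma_finite "\<lambda>_::'a. CN01" by standard
  interpret J: product_sigma_finite "\<lambda>_::'b. CN01" by standard
  interpret GJ: prob_space "gaussian_vector J" by (rule prob_space_gaussian_vector)
  show ?thesis
  proof (rule PiM_eqI)
    show "finite (I <+> J)" using I J by auto
  next
    fix A :: "'a + 'b \<Rightarrow> complex set" assume A: "\<And>i. i \<in> I <+> J \<Longrightarrow> A i \<in> sets CN01"
    have pre: "join_vector I J -` (Pi\<^sub>E (I <+> J) A) \<inter> space (gaussian_vector I \<Otimes>\<^sub>M gaussian_vector J) =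
       (\<Pi>\<^sub>E i\<in>I. A (Inl i)) \<times> (\<Pi>\<^sub>E j\<in>J. A (Inr j))"
      by (auto simp: join_vector_def space_PiM space_pair_measure PiE_iff extensional_def ball_Plus)
    have A': "A (Inl i) \<in> sets borel" if "i \<in> I" for i using A[OF InlI[OF that]] by simp
    have A'': "A (Inr j) \<in> sets borel" if "j \<in> J" for j using A[OF InrI[OF that]] by simp
    have s: "(\<Pi>\<^sub>E i\<in>I. A (Inl i)) \<in> sets (gaussian_vector I)" "(\<Pi>\<^sub>E j\<in>J. A (Inr j)) \<in> sets (gaussian_vector J)"
      using A' A'' I J by (auto intro!: sets_PiM_I_finite)
    have "emeasure (distr (gaussian_vector I \<Otimes>\<^sub>M gaussian_vector J) (gaussian_vector (I <+> J)) (join_vector I J))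
        (Pi\<^sub>E (I <+> J) A) =
      emeasure (gaussian_vector I) (\<Pi>\<^sub>E i\<in>I. A (Inl i)) * emeasure (gaussian_vector J) (\<Pi>\<^sub>E j\<in>J. A (Inr j))"
      using A I J s by (subst emeasure_distr[OF join_vector_measurable])
        (auto simp: pre GJ.emeasure_pair_measure_Times intro!: sets_PiM_I_finite)
    also have "\<dots> = (\<Prod>i\<in>I. emeasure CN01 (A (Inl i))) * (\<Prod>j\<in>J. emeasure CN01 (A (Inr j)))"
      using A' A'' I J by (simp add: I.emeasure_PiM J.emeasure_PiM)
    also have "\<dots> = (\<Prod>i\<in>I <+> J. emeasure CN01 (A i))"
      using I J by (simp add: prod.Plus)
    finally show "emeasure (distr (gaussian_vector I \<Otimes>\<^sub>M gaussian_vector J) (gaussian_vector (I <+> J)) (join_vector I J))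
        (Pi\<^sub>E (I <+> J) A) = (\<Prod>i\<in>I <+> J. emeasure CN01 (A i))" .
  qed simp
qed

text \<open>The law of \<open>join_vector\<close> followed by Tonelli, with the first group
  innermost: symbols are averaged while channel and noise are held fixed.\<close>

lemma nn_integral_gaussian_vector_Plus:
  assumes I: "finite I" and J: "finite J" and f [measurable]: "f \<in> borel_measurable (gaussian_vector (I <+> J))"
  shows "(\<integral>\<^sup>+u. f u \<partial>gaussian_vector (I <+> J)) =
    (\<integral>\<^sup>+y. \<integral>\<^sup>+x. f (join_vector I J (x, y)) \<partial>gaussian_vector I \<partial>gaussian_vector J)"
proof -
  note [measurable] = join_vector_measurable[of I J]
  interpret GI: prob_space "gaussian_vector I" by (rule prob_space_gaussian_vector)
  interpret GJ: prob_space "gaussian_vector J" by (rule prob_space_gaussian_vector)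
  interpret pair_sigma_finite "gaussian_vector I" "gaussian_vector J" by standard
  have "(\<integral>\<^sup>+u. f u \<partial>gaussian_vector (I <+> J)) = (\<integral>\<^sup>+u. f u \<partial>distr (gaussian_vector I \<Otimes>\<^sub>M gaussian_vector J)
      (gaussian_vector (I <+> J)) (join_vector I J))"
    by (simp only: distr_join_vector[OF I J])
  also have "\<dots> = (\<integral>\<^sup>+p. f (join_vector I J p) \<partial>(gaussian_vector I \<Otimes>\<^sub>M gaussian_vector J))"
    by (subst nn_integral_distr[OF join_vector_measurable]) auto
  also have "\<dots> = (\<integral>\<^sup>+y. \<integral>\<^sup>+x. f (join_vector I J (x, y)) \<partial>gaussian_vector I \<partial>gaussian_vector J)"
    by (subst nn_integral_snd[symmetric]) auto
  finally show ?thesis .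
qed

text \<open>Induction on the coordinates: integrating one of them out by the affine case adds
  \<open>|c i|^2\<close>, the remaining sum playing the part of the constant.\<close>

lemma nn_integral_linear_gaussian:
  assumes "finite Q"
  shows "(\<integral>\<^sup>+q. ennreal ((cmod (a + (\<Sum>i\<in>Q. c i * q i)))\<^sup>2) \<partial>gaussian_vector Q) =
    ennreal ((cmod a)\<^sup>2 + (\<Sum>i\<in>Q. (cmod (c i))\<^sup>2))"
  using assms
proof (induction Q)
  case empty
  show ?case by (simp add: nn_integral_count_space_finite PiM_empty)
next
  case (insert i Q)
  interpret product_sigma_finite "\<lambda>_::'a. CN01" by standard
  interpret G: prob_space "gaussian_vector Q" by (rule prob_space_gaussian_vector)
  have "(\<integral>\<^sup>+q. ennreal ((cmod (a + (\<Sum>i\<in>insert i Q. c i * q i)))\<^sup>2) \<partial>gaussian_vector (insert i Q)) =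
    (\<integral>\<^sup>+x. \<integral>\<^sup>+y. ennreal ((cmod (a + (\<Sum>j\<in>insert i Q. c j * (fun_upd x i y) j)))\<^sup>2) \<partial>CN01 \<partial>gaussian_vector Q)"
    using insert.hyps by (intro product_nn_integral_insert) (auto intro!: borel_measurable_sum)
  also have "\<dots> = (\<integral>\<^sup>+x. \<integral>\<^sup>+y. ennreal ((cmod ((a + (\<Sum>j\<in>Q. c j * x j)) + c i * y))\<^sup>2) \<partial>CN01 \<partial>gaussian_vector Q)"
  proof (intro nn_integral_cong)
    fix x y
    have "(\<Sum>j\<in>Q. c j * (fun_upd x i y) j) = (\<Sum>j\<in>Q. c j * x j)"
      using insert.hyps by (intro sum.cong) auto
    then show "ennreal ((cmod (a + (\<Sum>j\<in>insert i Q. c j * (fun_upd x i y) j)))\<^sup>2) =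
      ennreal ((cmod ((a + (\<Sum>j\<in>Q. c j * x j)) + c i * y))\<^sup>2)"
      using insert.hyps by (simp add: algebra_simps)
  qed
  also have "\<dots> = (\<integral>\<^sup>+x. ennreal ((cmod (a + (\<Sum>j\<in>Q. c j * x j)))\<^sup>2) + ennreal ((cmod (c i))\<^sup>2) \<partial>gaussian_vector Q)"
    by (simp add: nn_integral_CN01_affine)
  also have "\<dots> = ennreal ((cmod a)\<^sup>2 + (\<Sum>i\<in>Q. (cmod (c i))\<^sup>2)) + ennreal ((cmod (c i))\<^sup>2)"
    by (subst nn_integral_add) (auto simp: insert.IH G.emeasure_space_1 intro!: borel_measurable_sum)
  also have "\<dots> = ennreal ((cmod a)\<^sup>2 + (\<Sum>i\<in>insert i Q. (cmod (c i))\<^sup>2))"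
    using insert.hyps by (simp add: ennreal_plus[symmetric] sum_nonneg algebra_simps del: ennreal_plus)
  finally show ?case .
qed

section \<open>Scores of nearest-neighbour decoding\<close>

text \<open>The information density of nearest-neighbour decoding when the channel, given the pilots \<open>s\<close>, is
  taken to have gain \<open>gh s\<close> and noise power \<open>sg s\<close> and the input is Gaussian.\<close>

definition score :: "('s \<Rightarrow> complex) \<Rightarrow> ('s \<Rightarrow> real) \<Rightarrow> 's \<Rightarrow> complex \<Rightarrow> complex \<Rightarrow> real" where
  "score gh sg s y q = ln (1 + (cmod (gh s))\<^sup>2 / sg s) + (cmod y)\<^sup>2 / (sg s + (cmod (gh s))\<^sup>2)
     - (cmod (y - gh s * q))\<^sup>2 / sg s"

text \<open>The exponential of the score is the density of \<open>y\<close> given \<open>q\<close>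
  divided by the density of \<open>y\<close> under a Gaussian input, both for the fictitious
  channel. Completing the square evaluates the average of the former as the latter, for every
  \<open>y\<close> and \<open>s\<close>.\<close>

lemma nn_integral_exp_score:
  assumes "sg s > 0"
  shows "(\<integral>\<^sup>+q. ennreal (exp (score gh sg s y q)) \<partial>CN01) = 1"
proof -
  define d where "d = sg s + (cmod (gh s))\<^sup>2"
  have d: "d > 0" using assms by (simp add: d_def add_pos_nonneg)
  define c where "c = d / sg s * exp ((cmod y)\<^sup>2 / d)"
  have c: "c > 0" using d assms by (simp add: c_def)
  have "exp (score gh sg s y q) = c * exp (- (cmod (y - gh s * q))\<^sup>2 / sg s)" for q
  proof -
    have "1 + (cmod (gh s))\<^sup>2 / sg s = d / sg s"
      using assms by (simp add: d_def field_simps)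
    then have "exp (ln (1 + (cmod (gh s))\<^sup>2 / sg s)) = d / sg s"
      using d assms by simp
    then show ?thesis
      by (simp add: score_def exp_diff exp_add exp_minus c_def d_def divide_inverse)
  qed
  then have "(\<integral>\<^sup>+q. ennreal (exp (score gh sg s y q)) \<partial>CN01) =
    ennreal c * (\<integral>\<^sup>+q. ennreal (exp (- (cmod (y - gh s * q))\<^sup>2 / sg s)) \<partial>CN01)"
    using c by (subst nn_integral_cmult[symmetric]) (auto simp: ennreal_mult cong: measurable_cong_sets)
  also have "\<dots> = ennreal (c * (sg s / d * exp (- (cmod y)\<^sup>2 / d)))"
    unfolding nn_integral_CN01_exp_quadratic[OF assms] d_def[symmetric] using c d assms
    by (simp only: ennreal_mult less_imp_le divide_nonneg_nonneg exp_ge_zero mult_nonneg_nonneg)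
  also have "c * (sg s / d * exp (- (cmod y)\<^sup>2 / d)) = 1"
    using d assms by (simp add: c_def exp_minus field_simps)
  finally show ?thesis by simp
qed

lemma score_measurable:
  assumes gh: "gh \<in> borel_measurable N" and sg: "sg \<in> borel_measurable N"
    and s: "s \<in> M \<rightarrow>\<^sub>M N" and y [measurable]: "y \<in> borel_measurable M" and q [measurable]: "q \<in> borel_measurable M"
  shows "(\<lambda>x. score gh sg (s x) (y x) (q x)) \<in> borel_measurable M"
  unfolding score_def
  by (intro borel_measurable_diff borel_measurable_add borel_measurable_divide borel_measurable_ln
      borel_measurable_power measurable_compose[OF _ borel_measurable_norm] borel_measurable_times borel_measurable_const
      measurable_compose[OF s gh] measurable_compose[OF s sg] y q)

section \<open>Mean score of the transmitted codeword in one coherence interval\<close>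

locale user_decoder = trained_downlink +
  fixes k :: nat and gh :: "(nat \<Rightarrow> complex) \<Rightarrow> complex" and sg :: "(nat \<Rightarrow> complex) \<Rightarrow> real"
  assumes k: "k \<in> {1..K}"
    and gh [measurable]: "gh \<in> borel_measurable (pilot_space P)"
    and sg [measurable]: "sg \<in> borel_measurable (pilot_space P)" and sg_ge_1: "\<And>s. sg s \<ge> 1"
    and integrable_rate:
      "integrable I (\<lambda>\<omega>. ln (1 + (cmod (gh (pilot_received P k \<omega>)))\<^sup>2 / sg (pilot_received P k \<omega>)))"
    and integral_rate:
      "(LINT \<omega>|I. ln (1 + (cmod (gh (pilot_received P k \<omega>)))\<^sup>2 / sg (pilot_received P k \<omega>))) = user_rate k * ln 2"
    and noise_power: "\<And>t. t \<in> {1..data_len P} \<Longrightarrow>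
      (\<integral>\<^sup>+\<omega>. ennreal (((cmod (effective_channel P k k \<omega> - gh (pilot_received P k \<omega>)))\<^sup>2 +
        (\<Sum>i\<in>{1..K} - {k}. (cmod (effective_channel P k i \<omega>))\<^sup>2) + (cmod (\<omega> (Data_Noise k t)))\<^sup>2) /
        sg (pilot_received P k \<omega>)) \<partial>I) = 1"
    and signal_power: "\<And>t. t \<in> {1..data_len P} \<Longrightarrow>
      (\<integral>\<^sup>+\<omega>. ennreal (((\<Sum>i\<in>{1..K}. (cmod (effective_channel P k i \<omega>))\<^sup>2) +
        (cmod (\<omega> (Data_Noise k t)))\<^sup>2) /
        (sg (pilot_received P k \<omega>) + (cmod (gh (pilot_received P k \<omega>)))\<^sup>2)) \<partial>I) = 1"
begin

abbreviation "n \<equiv> data_len P"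

text \<open>One interval is modelled together with the symbols sent in it: \<open>Inl (j, t)\<close>
  indexes the symbol of user \<open>j\<close> at time \<open>t\<close>, \<open>Inr\<close> the
  channel and noise sources. Under \<open>U\<close> all of them are independent unit Gaussians,
  which is the law induced by the random codebooks once the messages are fixed.\<close>

definition symbol_index :: "(nat \<times> nat) set" where
  "symbol_index = {1..K} \<times> {1..n}"

abbreviation "U \<equiv> gaussian_vector (symbol_index <+> gaussian_sources P)"

definition sources :: "(nat \<times> nat + gaussian_source \<Rightarrow> complex) \<Rightarrow> gaussian_source \<Rightarrow> complex" where
  "sources u = (\<lambda>i\<in>gaussian_sources P. u (Inr i))"

definition data_signal :: "nat \<Rightarrow> (nat \<times> nat + gaussian_source \<Rightarrow> complex) \<Rightarrow> complex" where
  "data_signal t u = (\<Sum>j=1..K. effective_channel P k j (sources u) * u (Inl (j, t))) + u (Inr (Data_Noise k t))"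

definition interval_score :: "(nat \<times> nat + gaussian_source \<Rightarrow> complex) \<Rightarrow> real" where
  "interval_score u = (\<Sum>t=1..n. score gh sg (pilot_received P k (sources u)) (data_signal t u) (u (Inl (k, t))))"

lemma finite_symbol_index [simp]: "finite symbol_index"
  by (simp add: symbol_index_def)

lemma distr_sources: "distr U I sources = I"
  unfolding interval_space_def sources_def[abs_def]
  by (rule distr_PiM_reindex[of "symbol_index <+> gaussian_sources P" "\<lambda>_. CN01" Inr "gaussian_sources P"])
     (auto intro: CN01.prob_space_axioms)

lemma sources_measurable [measurable]: "sources \<in> U \<rightarrow>\<^sub>M I"
  unfolding interval_space_def sources_def[abs_def]
  by (intro measurable_into_gaussian_vector) (auto intro!: measurable_gaussian_component)

lemma pilot_k_measurable [measurable]: "pilot_received P k \<in> I \<rightarrow>\<^sub>M pilot_space P"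
  using k by (rule pilot_received_measurable)

lemma effective_channel_k_measurable [measurable]: "j \<in> {1..K} \<Longrightarrow> effective_channel P k j \<in> borel_measurable I"
  using k by (rule effective_channel_measurable)

lemma data_signal_measurable [measurable]:
  assumes "t \<in> {1..n}"
  shows "data_signal t \<in> borel_measurable U"
  unfolding data_signal_def[abs_def]
  by (intro borel_measurable_add borel_measurable_sum borel_measurable_times
      measurable_compose[OF sources_measurable effective_channel_k_measurable] measurable_gaussian_component)
    (use assms k in \<open>auto simp: symbol_index_def\<close>)

lemma symbol_measurable [measurable]: "t \<in> {1..n} \<Longrightarrow> (\<lambda>u. u (Inl (k, t))) \<in> borel_measurable U"
  using k by (intro measurable_gaussian_component) (auto simp: symbol_index_def)

lemma interval_score_measurable [measurable]: "interval_score \<in> borel_measurable U"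
  unfolding interval_score_def[abs_def]
  by (intro borel_measurable_sum score_measurable[OF gh sg] measurable_compose[OF sources_measurable pilot_k_measurable]
      data_signal_measurable symbol_measurable)

lemma sources_join_vector:
  "\<omega> \<in> space I \<Longrightarrow> sources (join_vector symbol_index (gaussian_sources P) (q, \<omega>)) = \<omega>"
  by (auto simp: sources_def join_vector_def fun_eq_iff space_interval_space)

text \<open>With channel and noise fixed, the residual is affine in independent unit Gaussian
  symbols, so its mean square is a sum of squared coefficients, where the own symbol has coefficient
  \<open>g_kk - a\<close>. The choice \<open>a = gh\<close> yields the residual noise power,
  \<open>a = 0\<close> the received power.\<close>

lemma nn_integral_combined_symbols:
  assumes t: "t \<in> {1..n}" and a: "a \<in> borel_measurable (pilot_space P)"
    and f: "f \<in> borel_measurable (pilot_space P)" and f_pos: "\<And>s. f s > 0"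
  shows "(\<integral>\<^sup>+u. ennreal ((cmod (data_signal t u - a (pilot_received P k (sources u)) * u (Inl (k, t))))\<^sup>2 /
      f (pilot_received P k (sources u))) \<partial>U) =
    (\<integral>\<^sup>+\<omega>. ennreal (((cmod (effective_channel P k k \<omega> - a (pilot_received P k \<omega>)))\<^sup>2 +
        (\<Sum>i\<in>{1..K} - {k}. (cmod (effective_channel P k i \<omega>))\<^sup>2) + (cmod (\<omega> (Data_Noise k t)))\<^sup>2) /
        f (pilot_received P k \<omega>)) \<partial>I)"
proof -
  let ?j = "join_vector symbol_index (gaussian_sources P)"
  let ?X = "pilot_received P k" and ?g = "effective_channel P k"
  have X: "(\<lambda>u. ?X (sources u)) \<in> U \<rightarrow>\<^sub>M pilot_space P"
    by (rule measurable_compose[OF sources_measurable pilot_k_measurable])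
  have "(\<integral>\<^sup>+u. ennreal ((cmod (data_signal t u - a (?X (sources u)) * u (Inl (k, t))))\<^sup>2 / f (?X (sources u))) \<partial>U) =
    (\<integral>\<^sup>+\<omega>. \<integral>\<^sup>+q. ennreal ((cmod (data_signal t (?j (q, \<omega>)) - a (?X (sources (?j (q, \<omega>)))) * ?j (q, \<omega>) (Inl (k, t))))\<^sup>2 /
       f (?X (sources (?j (q, \<omega>))))) \<partial>gaussian_vector symbol_index \<partial>I)"
    unfolding interval_space_def
    by (rule nn_integral_gaussian_vector_Plus[OF finite_symbol_index finite_gaussian_sources])
       (intro measurable_compose[OF _ measurable_ennreal] borel_measurable_divide borel_measurable_power
         measurable_compose[OF _ borel_measurable_norm] borel_measurable_diff borel_measurable_times
         measurable_compose[OF X f] measurable_compose[OF X a] symbol_measurable[OF t] data_signal_measurable[OF t])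
  also have "\<dots> = (\<integral>\<^sup>+\<omega>. ennreal (((cmod (?g k \<omega> - a (?X \<omega>)))\<^sup>2 +
        (\<Sum>i\<in>{1..K} - {k}. (cmod (?g i \<omega>))\<^sup>2) + (cmod (\<omega> (Data_Noise k t)))\<^sup>2) / f (?X \<omega>)) \<partial>I)"
  proof (rule nn_integral_cong)
    fix \<omega> assume \<omega>: "\<omega> \<in> space I"
    define z where "z = \<omega> (Data_Noise k t)"
    \<comment> \<open>Coefficients over the symbols of the whole interval: those at times other than
      \<open>t\<close> vanish, and only the own user's gain is reduced by \<open>a\<close>.\<close>
    define c where "c i = (if snd i = t then ?g (fst i) \<omega> - (if fst i = k then a (?X \<omega>) else 0) else 0)" for i
    have lin: "data_signal t (?j (q, \<omega>)) - a (?X \<omega>) * ?j (q, \<omega>) (Inl (k, t)) = z + (\<Sum>i\<in>symbol_index. c i * q i)" for q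
    proof -
      have "(\<Sum>i\<in>symbol_index. c i * q i) = (\<Sum>j=1..K. \<Sum>t'=1..n. c (j, t') * q (j, t'))"
        unfolding symbol_index_def by (simp add: sum.cartesian_product)
      also have "\<dots> = (\<Sum>j=1..K. c (j, t) * q (j, t))"
      proof (rule sum.cong[OF refl])
        fix j
        show "(\<Sum>t'=1..n. c (j, t') * q (j, t')) = c (j, t) * q (j, t)"
          using t by (subst sum.remove[of _ t]) (auto simp: c_def intro!: sum.neutral)
      qed
      also have "\<dots> = (\<Sum>j=1..K. ?g j \<omega> * q (j, t) - (if j = k then a (?X \<omega>) * q (j, t) else 0))"
        by (intro sum.cong) (auto simp: c_def algebra_simps)
      also have "\<dots> = (\<Sum>j=1..K. ?g j \<omega> * q (j, t)) - a (?X \<omega>) * q (k, t)"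
        using k by (simp add: sum_subtractf)
      finally have "(\<Sum>i\<in>symbol_index. c i * q i) = (\<Sum>j=1..K. ?g j \<omega> * q (j, t)) - a (?X \<omega>) * q (k, t)" .
      moreover have "?j (q, \<omega>) (Inl (j, t)) = q (j, t)" if "j \<in> {1..K}" for j
        using that t by (auto simp: join_vector_def symbol_index_def)
      moreover have "?j (q, \<omega>) (Inr (Data_Noise k t)) = z"
        using k t by (auto simp: join_vector_def z_def)
      ultimately show ?thesis
        using k by (simp add: data_signal_def sources_join_vector[OF \<omega>])
    qed
    have sq: "(\<Sum>i\<in>symbol_index. (cmod (c i))\<^sup>2) = (cmod (?g k \<omega> - a (?X \<omega>)))\<^sup>2 + (\<Sum>i\<in>{1..K} - {k}. (cmod (?g i \<omega>))\<^sup>2)"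
    proof -
      have "(\<Sum>i\<in>symbol_index. (cmod (c i))\<^sup>2) = (\<Sum>j=1..K. \<Sum>t'=1..n. (cmod (c (j, t')))\<^sup>2)"
        unfolding symbol_index_def by (simp add: sum.cartesian_product)
      also have "\<dots> = (\<Sum>j=1..K. (cmod (c (j, t)))\<^sup>2)"
      proof (rule sum.cong[OF refl])
        fix j
        show "(\<Sum>t'=1..n. (cmod (c (j, t')))\<^sup>2) = (cmod (c (j, t)))\<^sup>2"
          using t by (subst sum.remove[of _ t]) (auto simp: c_def intro!: sum.neutral)
      qed
      also have "\<dots> = (cmod (c (k, t)))\<^sup>2 + (\<Sum>i\<in>{1..K} - {k}. (cmod (c (i, t)))\<^sup>2)"
        using k by (intro sum.remove) auto
      also have "(\<Sum>i\<in>{1..K} - {k}. (cmod (c (i, t)))\<^sup>2) = (\<Sum>i\<in>{1..K} - {k}. (cmod (?g i \<omega>))\<^sup>2)"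
        by (intro sum.cong) (auto simp: c_def)
      finally show ?thesis by (simp add: c_def)
    qed
    have "(\<integral>\<^sup>+q. ennreal ((cmod (data_signal t (?j (q, \<omega>)) - a (?X (sources (?j (q, \<omega>)))) * ?j (q, \<omega>) (Inl (k, t))))\<^sup>2 /
        f (?X (sources (?j (q, \<omega>))))) \<partial>gaussian_vector symbol_index) =
      (\<integral>\<^sup>+q. ennreal ((cmod (z + (\<Sum>i\<in>symbol_index. c i * q i)))\<^sup>2) * ennreal (1 / f (?X \<omega>)) \<partial>gaussian_vector symbol_index)"
      unfolding sources_join_vector[OF \<omega>] lin using f_pos
      by (intro nn_integral_cong) (simp add: ennreal_mult[symmetric] less_imp_le)
    also have "\<dots> = ennreal ((cmod z)\<^sup>2 + (\<Sum>i\<in>symbol_index. (cmod (c i))\<^sup>2)) * ennreal (1 / f (?X \<omega>))"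
      by (subst nn_integral_multc) (auto simp: nn_integral_linear_gaussian)
    also have "\<dots> = ennreal (((cmod (?g k \<omega> - a (?X \<omega>)))\<^sup>2 +
        (\<Sum>i\<in>{1..K} - {k}. (cmod (?g i \<omega>))\<^sup>2) + (cmod (\<omega> (Data_Noise k t)))\<^sup>2) / f (?X \<omega>))"
      using f_pos by (subst ennreal_mult[symmetric]) (auto simp: sq z_def less_imp_le sum_nonneg add_ac)
    finally show "(\<integral>\<^sup>+q. ennreal ((cmod (data_signal t (?j (q, \<omega>)) - a (?X (sources (?j (q, \<omega>)))) * ?j (q, \<omega>) (Inl (k, t))))\<^sup>2 /
        f (?X (sources (?j (q, \<omega>))))) \<partial>gaussian_vector symbol_index) = \<dots>" .
  qed
  finally show ?thesis .
qed

text \<open>Each symbol contributes a logarithm and two quadratic ratios of opposite sign, both of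
  mean 1 by the power identities; these cancel and leave the mean logarithm. Expectation is
  additive, so dependence among the symbols of an interval is harmless.\<close>

lemma interval_score_integral:
  "integrable U interval_score" "(LINT u|U. interval_score u) = real n * (user_rate k * ln 2)"
proof -
  let ?X = "pilot_received P k" and ?g = "effective_channel P k"
  have sg0: "sg s > 0" "sg s + (cmod (gh s))\<^sup>2 > 0" for s
    using sg_ge_1[of s] by (auto intro: add_pos_nonneg)
  have one: "integrable U f \<and> (LINT u|U. f u) = 1"
    if "(\<integral>\<^sup>+u. ennreal (f u) \<partial>U) = 1" "f \<in> borel_measurable U" "\<And>u. f u \<ge> 0" for f
    using that by (auto intro!: integrableI_nonneg simp: integral_eq_nn_integral)
  have X: "(\<lambda>u. ?X (sources u)) \<in> U \<rightarrow>\<^sub>M pilot_space P"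
    by (rule measurable_compose[OF sources_measurable pilot_k_measurable])
  note mI = borel_measurable_divide borel_measurable_power borel_measurable_add
         measurable_compose[OF _ borel_measurable_norm] borel_measurable_diff borel_measurable_times
         measurable_compose[OF X sg] measurable_compose[OF X gh] symbol_measurable data_signal_measurable
  let ?L = "\<lambda>\<omega>. ln (1 + (cmod (gh (?X \<omega>)))\<^sup>2 / sg (?X \<omega>))"
  have L: "integrable U (\<lambda>u. ?L (sources u))" "(LINT u|U. ?L (sources u)) = user_rate k * ln 2"
  proof -
    have "integrable (distr U I sources) ?L" "integral\<^sup>L (distr U I sources) ?L = user_rate k * ln 2"
      unfolding distr_sources by (rule integrable_rate, rule integral_rate)
    then show "integrable U (\<lambda>u. ?L (sources u))" "(LINT u|U. ?L (sources u)) = user_rate k * ln 2"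
      using integrable_rate by (simp_all only: integrable_distr_eq[OF sources_measurable borel_measurable_integrable]
        integral_distr[OF sources_measurable borel_measurable_integrable])
  qed
  have S: "integrable U (\<lambda>u. (cmod (data_signal t u))\<^sup>2 / (sg (?X (sources u)) + (cmod (gh (?X (sources u))))\<^sup>2)) \<and>
    (LINT u|U. (cmod (data_signal t u))\<^sup>2 / (sg (?X (sources u)) + (cmod (gh (?X (sources u))))\<^sup>2)) = 1"
    if t: "t \<in> {1..n}" for t
  proof (rule one)
    have sum_k: "(\<Sum>i\<in>{1..K}. (cmod (?g i \<omega>))\<^sup>2) = (cmod (?g k \<omega>))\<^sup>2 + (\<Sum>i\<in>{1..K} - {k}. (cmod (?g i \<omega>))\<^sup>2)" for \<omega>
      using k by (intro sum.remove) auto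
    have "(\<lambda>s. sg s + (cmod (gh s))\<^sup>2) \<in> borel_measurable (pilot_space P)"
      by (intro borel_measurable_add borel_measurable_power measurable_compose[OF _ borel_measurable_norm] sg gh)
    \<comment> \<open>Gain 0 makes the residual the received signal itself.\<close>
    from nn_integral_combined_symbols[OF t borel_measurable_const[of 0] this sg0(2)] signal_power[OF t, unfolded sum_k]
    show "(\<integral>\<^sup>+u. ennreal ((cmod (data_signal t u))\<^sup>2 / (sg (?X (sources u)) + (cmod (gh (?X (sources u))))\<^sup>2)) \<partial>U) = 1"
      by simp
    show "(\<lambda>u. (cmod (data_signal t u))\<^sup>2 / (sg (?X (sources u)) + (cmod (gh (?X (sources u))))\<^sup>2)) \<in> borel_measurable U"
      by (intro mI t)
  qed (intro divide_nonneg_nonneg zero_le_power2 less_imp_le[OF sg0(2)])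
  have E: "integrable U (\<lambda>u. (cmod (data_signal t u - gh (?X (sources u)) * u (Inl (k, t))))\<^sup>2 / sg (?X (sources u))) \<and>
    (LINT u|U. (cmod (data_signal t u - gh (?X (sources u)) * u (Inl (k, t))))\<^sup>2 / sg (?X (sources u))) = 1"
    if t: "t \<in> {1..n}" for t
  proof (rule one)
    from nn_integral_combined_symbols[OF t gh sg sg0(1)] noise_power[OF t]
    show "(\<integral>\<^sup>+u. ennreal ((cmod (data_signal t u - gh (?X (sources u)) * u (Inl (k, t))))\<^sup>2 / sg (?X (sources u))) \<partial>U) = 1"
      by simp
    show "(\<lambda>u. (cmod (data_signal t u - gh (?X (sources u)) * u (Inl (k, t))))\<^sup>2 / sg (?X (sources u))) \<in> borel_measurable U"
      by (intro mI t)
  qed (intro divide_nonneg_nonneg zero_le_power2 less_imp_le[OF sg0(1)])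
  have t: "integrable U (\<lambda>u. score gh sg (?X (sources u)) (data_signal t u) (u (Inl (k, t)))) \<and>
    (LINT u|U. score gh sg (?X (sources u)) (data_signal t u) (u (Inl (k, t)))) = user_rate k * ln 2"
    if t: "t \<in> {1..n}" for t
    unfolding score_def using L S[OF t] E[OF t] by simp
  show "integrable U interval_score"
    unfolding interval_score_def[abs_def] by (rule Bochner_Integration.integrable_sum) (use t in blast)
  have "(LINT u|U. interval_score u) = (\<Sum>t=1..n. LINT u|U. score gh sg (?X (sources u)) (data_signal t u) (u (Inl (k, t))))"
    unfolding interval_score_def by (rule Bochner_Integration.integral_sum) (use t in blast)
  also have "\<dots> = (\<Sum>t=1..n. user_rate k * ln 2)"
    by (rule sum.cong[OF refl]) (use t in blast)
  finally show "(LINT u|U. interval_score u) = real n * (user_rate k * ln 2)" by simp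
qed

end

section \<open>Independent intervals as coordinates of a product\<close>

lemma weak_law_lower_tail_PiM:
  fixes N :: "'a measure" and f :: "'a \<Rightarrow> real"
  assumes N: "prob_space N" and f: "integrable N f" and \<delta>: "\<delta> > 0"
  shows "(\<lambda>B. measure (\<Pi>\<^sub>M b\<in>{1..B}. N) {x \<in> space (\<Pi>\<^sub>M b\<in>{1..B}. N).
      (\<Sum>b=1..B. f (x b)) \<le> real B * ((LINT y|N. f y) - \<delta>)}) \<longlonglongrightarrow> 0"
proof (rule weak_law_lower_tail[OF f \<delta>])
  fix B :: nat
  show P: "prob_space (\<Pi>\<^sub>M b\<in>{1..B}. N)"
    by (intro prob_space_PiM N)
  interpret prob_space "\<Pi>\<^sub>M b\<in>{1..B}. N" by (rule P)
  show d: "distr (\<Pi>\<^sub>M b\<in>{1..B}. N) N (\<lambda>x. x b) = N" if "b \<in> {1..B}" for b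
    using that by (intro distr_PiM_component N)
  show "indep_vars (\<lambda>_. N) (\<lambda>b x. x b) {1..B}"
  proof (cases "B = 0")
    \<comment> \<open>The criterion through the joint law, used in the other case, needs a nonempty
      index set.\<close>
    case True
    then show ?thesis unfolding indep_vars_def indep_sets_def by simp
  next
    case False
    then have ne: "{1..B} \<noteq> {}" by simp
    show ?thesis
    proof (subst indep_vars_iff_distr_eq_PiM'[OF ne])
      have "distr (\<Pi>\<^sub>M b\<in>{1..B}. N) (\<Pi>\<^sub>M b\<in>{1..B}. N) (\<lambda>x. \<lambda>b\<in>{1..B}. x b) =
        distr (\<Pi>\<^sub>M b\<in>{1..B}. N) (\<Pi>\<^sub>M b\<in>{1..B}. N) (\<lambda>x. x)"
        by (intro distr_cong) (auto simp: space_PiM PiE_iff extensional_restrict)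
      also have "\<dots> = (\<Pi>\<^sub>M b\<in>{1..B}. N)" by (rule distr_id)
      also have "\<dots> = (\<Pi>\<^sub>M b\<in>{1..B}. distr (\<Pi>\<^sub>M b\<in>{1..B}. N) N (\<lambda>x. x b))"
        by (intro PiM_cong refl d[symmetric])
      finally show "distr (\<Pi>\<^sub>M b\<in>{1..B}. N) (\<Pi>\<^sub>M b\<in>{1..B}. N) (\<lambda>x. \<lambda>b\<in>{1..B}. x b) =
        (\<Pi>\<^sub>M b\<in>{1..B}. distr (\<Pi>\<^sub>M b\<in>{1..B}. N) N (\<lambda>x. x b))" .
    qed (auto intro: measurable_component_singleton)
  qed
qed

definition curry_vector :: "'i set \<Rightarrow> 'j set \<Rightarrow> ('i \<times> 'j \<Rightarrow> complex) \<Rightarrow> 'i \<Rightarrow> 'j \<Rightarrow> complex" where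
  "curry_vector I J x = (\<lambda>i\<in>I. \<lambda>j\<in>J. x (i, j))"

lemma curry_vector_measurable:
  "curry_vector I J \<in> gaussian_vector (I \<times> J) \<rightarrow>\<^sub>M (\<Pi>\<^sub>M i\<in>I. gaussian_vector J)"
  unfolding curry_vector_def[abs_def]
  by (intro measurable_restrict measurable_into_gaussian_vector) (auto intro: measurable_gaussian_component)

text \<open>Currying undoes uncurrying on the product space, so the law is obtained by transporting
  \<open>distr_uncurry_vector\<close>, without a second computation on boxes.\<close>

lemma distr_curry_vector:
  assumes I: "finite I" and J: "finite J"
  shows "distr (gaussian_vector (I \<times> J)) (\<Pi>\<^sub>M i\<in>I. gaussian_vector J) (curry_vector I J) = (\<Pi>\<^sub>M i\<in>I. gaussian_vector J)"
proof -
  have "distr (gaussian_vector (I \<times> J)) (\<Pi>\<^sub>M i\<in>I. gaussian_vector J) (curry_vector I J) =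
    distr (distr (\<Pi>\<^sub>M i\<in>I. gaussian_vector J) (gaussian_vector (I \<times> J)) (uncurry_vector I (\<lambda>_. J)))
      (\<Pi>\<^sub>M i\<in>I. gaussian_vector J) (curry_vector I J)"
    by (simp only: distr_uncurry_vector[OF I J])
  also have "\<dots> = distr (\<Pi>\<^sub>M i\<in>I. gaussian_vector J) (\<Pi>\<^sub>M i\<in>I. gaussian_vector J)
      (curry_vector I J \<circ> uncurry_vector I (\<lambda>_. J))"
    by (rule distr_distr[OF curry_vector_measurable uncurry_vector_measurable])
  also have "\<dots> = distr (\<Pi>\<^sub>M i\<in>I. gaussian_vector J) (\<Pi>\<^sub>M i\<in>I. gaussian_vector J) (\<lambda>x. x)"
    by (rule distr_cong)
       (auto simp: curry_vector_def uncurry_vector_def space_PiM PiE_iff extensional_def fun_eq_iff)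
  finally show ?thesis by (simp add: distr_id)
qed

section \<open>Random Gaussian codes with threshold decoding\<close>

text \<open>Restriction turns row \<open>b\<close> of the pilot matrix back into an element of
  \<open>pilot_space P\<close>, on which \<open>gh\<close> and \<open>sg\<close> are
  measurable.\<close>

definition total_score ::
    "downlink \<Rightarrow> nat \<Rightarrow> ((nat \<Rightarrow> complex) \<Rightarrow> complex) \<Rightarrow> ((nat \<Rightarrow> complex) \<Rightarrow> real) \<Rightarrow>
     codebook \<times> (nat \<times> nat \<Rightarrow> complex) \<times> (nat \<times> nat \<Rightarrow> complex) \<Rightarrow> nat \<Rightarrow> real" where
  "total_score P B gh sg = (\<lambda>(c, p, d) w. \<Sum>b=1..B. \<Sum>t=1..data_len P.
     score gh sg (\<lambda>s\<in>{1..fwd_len P}. p (b, s)) (d (b, t)) (c (w, b, t)))"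

text \<open>\<open>LEAST\<close> makes the decoder a deterministic function. If several messages
  pass the threshold it may err, and if none does its value is arbitrary; the analysis charges both
  cases to the error bound.\<close>

definition gaussian_code ::
    "downlink \<Rightarrow> nat \<Rightarrow> (nat \<Rightarrow> nat) \<Rightarrow> (nat \<Rightarrow> (nat \<Rightarrow> complex) \<Rightarrow> complex) \<Rightarrow>
     (nat \<Rightarrow> (nat \<Rightarrow> complex) \<Rightarrow> real) \<Rightarrow> (nat \<Rightarrow> real) \<Rightarrow> code" where
  "gaussian_code P B Ms gh sg \<gamma> =
     \<lparr> n_messages = Ms,
       codebook_dist = (\<lambda>j. gaussian_vector ({..<Ms j} \<times> {1..B} \<times> {1..data_len P})),
       decoder = (\<lambda>j z. LEAST w. w < Ms j \<and> \<gamma> j < total_score P B (gh j) (sg j) z w) \<rparr>"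

locale block_code = trained_downlink P for P +
  fixes B :: nat and Ms :: "nat \<Rightarrow> nat"
  assumes Ms: "\<And>j. j \<in> {1..K} \<Longrightarrow> Ms j \<ge> 1"
begin

abbreviation "cb_index j \<equiv> {..<Ms j} \<times> {1..B} \<times> {1..data_len P}"
abbreviation "messages \<equiv> \<Pi>\<^sub>E j\<in>{1..K}. {..<Ms j}"
abbreviation "message_space \<equiv> \<Pi>\<^sub>M j\<in>{1..K}. uniform_count_measure {..<Ms j}"
abbreviation "cb_space \<equiv> \<Pi>\<^sub>M j\<in>{1..K}. gaussian_vector (cb_index j)"
abbreviation "channel_space \<equiv> \<Pi>\<^sub>M b\<in>{1..B}. I"
abbreviation "flat_index \<equiv> (SIGMA j:{1..K}. cb_index j) <+> ({1..B} \<times> gaussian_sources P)"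
abbreviation "V \<equiv> gaussian_vector flat_index"

text \<open>All codebooks and all intervals become one vector of independent unit Gaussians, so that
  later arguments only select coordinates. Messages stay outside: they are discrete and decide which
  coordinates are transmitted.\<close>

definition flatten where
  "flatten = (\<lambda>(C, \<omega>). join_vector (SIGMA j:{1..K}. cb_index j) ({1..B} \<times> gaussian_sources P)
     (uncurry_vector {1..K} cb_index C, uncurry_vector {1..B} (\<lambda>_. gaussian_sources P) \<omega>))"

lemma prob_space_message_space: "prob_space message_space"
  using Ms by (intro prob_space_PiM prob_space_uniform_count_measure) (auto simp: lessThan_empty_iff Suc_le_eq)

lemma prob_space_cb_space: "prob_space cb_space"
  by (intro prob_space_PiM prob_space_gaussian_vector)

lemma prob_space_channel_space: "prob_space channel_space"
  by (intro prob_space_PiM prob_space_interval_space)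

lemma prob_space_rest: "prob_space (cb_space \<Otimes>\<^sub>M channel_space)"
proof -
  interpret C: prob_space cb_space by (rule prob_space_cb_space)
  interpret W: prob_space channel_space by (rule prob_space_channel_space)
  interpret pair_prob_space cb_space channel_space ..
  show ?thesis by (rule prob_space_axioms)
qed

lemma flatten_eq:
  "flatten = join_vector (SIGMA j:{1..K}. cb_index j) ({1..B} \<times> gaussian_sources P) \<circ>
     (\<lambda>(C, \<omega>). (uncurry_vector {1..K} cb_index C, uncurry_vector {1..B} (\<lambda>_. gaussian_sources P) \<omega>))"
  by (auto simp: flatten_def fun_eq_iff)

lemma uncurry_pair_measurable:
  "(\<lambda>(C, \<omega>). (uncurry_vector {1..K} cb_index C, uncurry_vector {1..B} (\<lambda>_. gaussian_sources P) \<omega>)) \<in>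
    cb_space \<Otimes>\<^sub>M channel_space \<rightarrow>\<^sub>M
    gaussian_vector (SIGMA j:{1..K}. cb_index j) \<Otimes>\<^sub>M gaussian_vector ({1..B} \<times> gaussian_sources P)"
  unfolding split_beta' interval_space_def
  by (intro measurable_Pair measurable_compose[OF measurable_fst uncurry_vector_measurable]
      measurable_compose[OF measurable_snd uncurry_vector_measurable])

lemma flatten_measurable: "flatten \<in> cb_space \<Otimes>\<^sub>M channel_space \<rightarrow>\<^sub>M V"
  unfolding flatten_eq by (rule measurable_comp[OF uncurry_pair_measurable join_vector_measurable])

text \<open>Uncurrying acts on the two factors separately and \<open>join_vector\<close> merges
  them; each step preserves the Gaussian product.\<close>

lemma distr_flatten: "distr (cb_space \<Otimes>\<^sub>M channel_space) V flatten = V"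
proof -
  let ?S = "SIGMA j:{1..K}. cb_index j" and ?T = "{1..B} \<times> gaussian_sources P"
  have T: "distr channel_space (gaussian_vector ?T) (uncurry_vector {1..B} (\<lambda>_. gaussian_sources P)) = gaussian_vector ?T"
    unfolding interval_space_def by (rule distr_uncurry_vector) auto
  have S: "distr cb_space (gaussian_vector ?S) (uncurry_vector {1..K} cb_index) = gaussian_vector ?S"
    by (rule distr_uncurry_vector) auto
  interpret T: prob_space "gaussian_vector ?T" by (rule prob_space_gaussian_vector)
  have um: "uncurry_vector {1..B} (\<lambda>_. gaussian_sources P) \<in> channel_space \<rightarrow>\<^sub>M gaussian_vector ?T"
    unfolding interval_space_def by (rule uncurry_vector_measurable)
  have "distr (cb_space \<Otimes>\<^sub>M channel_space) V flatten =
    distr (distr (cb_space \<Otimes>\<^sub>M channel_space) (gaussian_vector ?S \<Otimes>\<^sub>M gaussian_vector ?T)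
      (\<lambda>(C, \<omega>). (uncurry_vector {1..K} cb_index C, uncurry_vector {1..B} (\<lambda>_. gaussian_sources P) \<omega>)))
      V (join_vector ?S ?T)"
    unfolding flatten_eq by (rule distr_distr[OF join_vector_measurable uncurry_pair_measurable, symmetric])
  also have "distr (cb_space \<Otimes>\<^sub>M channel_space) (gaussian_vector ?S \<Otimes>\<^sub>M gaussian_vector ?T)
      (\<lambda>(C, \<omega>). (uncurry_vector {1..K} cb_index C, uncurry_vector {1..B} (\<lambda>_. gaussian_sources P) \<omega>)) =
    gaussian_vector ?S \<Otimes>\<^sub>M gaussian_vector ?T"
    using pair_measure_distr[OF uncurry_vector_measurable um, of "{1..K}" cb_index] T.sigma_finite_measure_axioms
    by (simp only: S T)
  also have "distr (gaussian_vector ?S \<Otimes>\<^sub>M gaussian_vector ?T) V (join_vector ?S ?T) = V"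
    by (rule distr_join_vector) auto
  finally show ?thesis .
qed

lemma measure_flatten:
  assumes "E \<in> sets V"
  shows "flatten -` E \<inter> space (cb_space \<Otimes>\<^sub>M channel_space) \<in> sets (cb_space \<Otimes>\<^sub>M channel_space)"
    "emeasure (cb_space \<Otimes>\<^sub>M channel_space) (flatten -` E \<inter> space (cb_space \<Otimes>\<^sub>M channel_space)) = emeasure V E"
proof -
  show "flatten -` E \<inter> space (cb_space \<Otimes>\<^sub>M channel_space) \<in> sets (cb_space \<Otimes>\<^sub>M channel_space)"
    using assms by (rule measurable_sets[OF flatten_measurable])
  have "emeasure V E = emeasure (distr (cb_space \<Otimes>\<^sub>M channel_space) V flatten) E"
    by (simp only: distr_flatten)
  also have "\<dots> = emeasure (cb_space \<Otimes>\<^sub>M channel_space) (flatten -` E \<inter> space (cb_space \<Otimes>\<^sub>M channel_space))"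
    by (rule emeasure_distr[OF flatten_measurable assms])
  finally show "emeasure (cb_space \<Otimes>\<^sub>M channel_space) (flatten -` E \<inter> space (cb_space \<Otimes>\<^sub>M channel_space)) = emeasure V E" ..
qed

lemma flatten_codebook:
  "j \<in> {1..K} \<Longrightarrow> w < Ms j \<Longrightarrow> b \<in> {1..B} \<Longrightarrow> t \<in> {1..data_len P} \<Longrightarrow>
    flatten (C, \<omega>) (Inl (j, w, b, t)) = C j (w, b, t)"
  by (auto simp: flatten_def join_vector_def uncurry_vector_def)

lemma flatten_channel:
  "b \<in> {1..B} \<Longrightarrow> i \<in> gaussian_sources P \<Longrightarrow> flatten (C, \<omega>) (Inr (b, i)) = \<omega> b i"
  by (auto simp: flatten_def join_vector_def uncurry_vector_def)

text \<open>There are finitely many message vectors, so the event is a finite union of sets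
  \<open>{v} \<times> E v\<close>. This permits fixing the messages before selecting coordinates, a
  selection that depends on them.\<close>

lemma emeasure_message_slices:
  fixes E :: "(nat \<Rightarrow> nat) \<Rightarrow> _ set"
  assumes E: "\<And>v. v \<in> messages \<Longrightarrow> E v \<in> sets (cb_space \<Otimes>\<^sub>M channel_space)"
  defines "G \<equiv> {(W, r). W \<in> messages \<and> r \<in> E W}"
  shows "G \<in> sets (message_space \<Otimes>\<^sub>M (cb_space \<Otimes>\<^sub>M channel_space))"
    "emeasure (message_space \<Otimes>\<^sub>M (cb_space \<Otimes>\<^sub>M channel_space)) G =
      (\<integral>\<^sup>+W. emeasure (cb_space \<Otimes>\<^sub>M channel_space) (E W) \<partial>message_space)"
proof -
  interpret R: prob_space "cb_space \<Otimes>\<^sub>M channel_space" by (rule prob_space_rest)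
  have sp: "space message_space = messages"
    by (simp add: space_PiM space_uniform_count_measure)
  have fin: "finite messages" by (intro finite_PiE) auto
  have "{v} \<in> sets message_space" if "v \<in> messages" for v
  proof -
    have "(\<Pi>\<^sub>E j\<in>{1..K}. {v j}) \<in> sets message_space"
      using that by (intro sets_PiM_I_finite) (auto simp: sets_uniform_count_measure PiE_iff)
    then show ?thesis using that by (simp add: PiE_singleton PiE_iff)
  qed
  then have "(\<Union>v\<in>messages. {v} \<times> E v) \<in> sets (message_space \<Otimes>\<^sub>M (cb_space \<Otimes>\<^sub>M channel_space))"
    using E fin by (intro sets.finite_UN pair_measureI)
  moreover have "G = (\<Union>v\<in>messages. {v} \<times> E v)" by (auto simp: G_def)
  ultimately show G: "G \<in> sets (message_space \<Otimes>\<^sub>M (cb_space \<Otimes>\<^sub>M channel_space))" by simp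
  show "emeasure (message_space \<Otimes>\<^sub>M (cb_space \<Otimes>\<^sub>M channel_space)) G =
      (\<integral>\<^sup>+W. emeasure (cb_space \<Otimes>\<^sub>M channel_space) (E W) \<partial>message_space)"
    unfolding R.emeasure_pair_measure_alt[OF G]
  proof (intro nn_integral_cong)
    fix W assume "W \<in> space message_space"
    then have "Pair W -` G = E W" unfolding sp by (auto simp: G_def)
    then show "emeasure (cb_space \<Otimes>\<^sub>M channel_space) (Pair W -` G) = emeasure (cb_space \<Otimes>\<^sub>M channel_space) (E W)"
      by simp
  qed
qed

lemma code_space_gaussian_code:
  "code_space P B (gaussian_code P B Ms gh sg \<gamma>) = message_space \<Otimes>\<^sub>M (cb_space \<Otimes>\<^sub>M channel_space)"
  by (simp add: code_space_def gaussian_code_def)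

text \<open>For fixed messages the symbol is one coordinate of the flat vector, of law
  \<open>CN01\<close> whatever the message, so averaging over messages leaves the law
  unchanged.\<close>

lemma distr_code_symbol:
  assumes k: "k \<in> {1..K}" and b: "b \<in> {1..B}" and t: "t \<in> {1..data_len P}"
  shows "code_symbol k b t \<in> message_space \<Otimes>\<^sub>M (cb_space \<Otimes>\<^sub>M channel_space) \<rightarrow>\<^sub>M CN01"
    "distr (message_space \<Otimes>\<^sub>M (cb_space \<Otimes>\<^sub>M channel_space)) CN01 (code_symbol k b t) = CN01"
proof -
  let ?M = "message_space \<Otimes>\<^sub>M (cb_space \<Otimes>\<^sub>M channel_space)"
  interpret W: prob_space message_space by (rule prob_space_message_space)
  have sp: "space message_space = messages"
    by (simp add: space_PiM space_uniform_count_measure)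
  define i where "i v = (Inl (k, v k, b, t) :: _ + nat \<times> gaussian_source)" for v :: "nat \<Rightarrow> nat"
  have i: "i v \<in> flat_index" if "v \<in> messages" for v
    using that k b t by (auto simp: i_def PiE_iff)
  define E where "E A v = flatten -` {x \<in> space V. x (i v) \<in> A} \<inter> space (cb_space \<Otimes>\<^sub>M channel_space)" for A v
  have meas: "(\<lambda>x. x (i v)) \<in> V \<rightarrow>\<^sub>M CN01" if "v \<in> messages" for v
    using i[OF that] by (rule measurable_component_singleton)
  have pre: "(\<lambda>x. x (i v)) -` A \<inter> space V = {x \<in> space V. x (i v) \<in> A}" for v A by blast
  have FA: "{x \<in> space V. x (i v) \<in> A} \<in> sets V" if "v \<in> messages" "A \<in> sets borel" for A v
  proof -
    have "(\<lambda>x. x (i v)) -` A \<inter> space V \<in> sets V"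
      using that by (intro measurable_sets[OF meas]) auto
    then show ?thesis unfolding pre .
  qed
  have eq: "code_symbol k b t -` A \<inter> space ?M = {(W, r). W \<in> messages \<and> r \<in> E A W}" for A
  proof (rule set_eqI, clarify)
    fix W C \<omega>
    have 1: "flatten (C, \<omega>) \<in> space V" if "(C, \<omega>) \<in> space (cb_space \<Otimes>\<^sub>M channel_space)"
      using that by (rule measurable_space[OF flatten_measurable])
    have 2: "flatten (C, \<omega>) (i W) = C k (W k, b, t)" if "W \<in> messages"
      unfolding i_def by (rule flatten_codebook) (use that k b t in \<open>auto simp: PiE_iff\<close>)
    have "(W, C, \<omega>) \<in> code_symbol k b t -` A \<inter> space ?M \<longleftrightarrow>
        W \<in> messages \<and> (C, \<omega>) \<in> space (cb_space \<Otimes>\<^sub>M channel_space) \<and> C k (W k, b, t) \<in> A"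
      unfolding space_pair_measure[of message_space] sp code_symbol_def
      by (simp only: vimage_eq Int_iff mem_Times_iff fst_conv snd_conv case_prod_conv) blast
    also have "\<dots> \<longleftrightarrow> W \<in> messages \<and> (C, \<omega>) \<in> E A W"
      unfolding E_def using 1 2 by auto
    finally show "((W, C, \<omega>) \<in> code_symbol k b t -` A \<inter> space ?M) =
        ((W, C, \<omega>) \<in> {(W, r). W \<in> messages \<and> r \<in> E A W})" by blast
  qed
  have Es: "E A v \<in> sets (cb_space \<Otimes>\<^sub>M channel_space)" if "v \<in> messages" "A \<in> sets borel" for A v
    unfolding E_def by (intro measure_flatten FA that)
  show m: "code_symbol k b t \<in> ?M \<rightarrow>\<^sub>M CN01"
  proof (rule measurableI)
    fix A assume "A \<in> sets CN01"
    then show "code_symbol k b t -` A \<inter> space ?M \<in> sets ?M"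
      unfolding eq by (intro emeasure_message_slices Es) auto
  qed simp
  show "distr ?M CN01 (code_symbol k b t) = CN01"
  proof (rule measure_eqI)
    fix A assume "A \<in> sets (distr ?M CN01 (code_symbol k b t))"
    then have A: "A \<in> sets borel" by simp
    have "emeasure (distr ?M CN01 (code_symbol k b t)) A = emeasure ?M {(W, r). W \<in> messages \<and> r \<in> E A W}"
      using A by (subst emeasure_distr[OF m]) (simp, simp only: eq)
    also have "\<dots> = (\<integral>\<^sup>+W. emeasure (cb_space \<Otimes>\<^sub>M channel_space) (E A W) \<partial>message_space)"
      using A by (intro emeasure_message_slices Es)
    also have "\<dots> = (\<integral>\<^sup>+W. emeasure CN01 A \<partial>message_space)"
    proof (intro nn_integral_cong)
      fix v assume "v \<in> space message_space"
      then have v: "v \<in> messages" by (simp only: sp)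
      have "emeasure (cb_space \<Otimes>\<^sub>M channel_space) (E A v) = emeasure V {x \<in> space V. x (i v) \<in> A}"
        unfolding E_def using FA[OF v A] by (rule measure_flatten)
      also have "\<dots> = emeasure (distr V CN01 (\<lambda>x. x (i v))) A"
        using A by (subst emeasure_distr[OF meas[OF v]]) (simp, simp only: pre)
      also have "distr V CN01 (\<lambda>x. x (i v)) = CN01"
        using CN01.prob_space_axioms i[OF v] by (rule distr_PiM_component)
      finally show "emeasure (cb_space \<Otimes>\<^sub>M channel_space) (E A v) = emeasure CN01 A" .
    qed
    finally show "emeasure (distr ?M CN01 (code_symbol k b t)) A = emeasure CN01 A"
      using W.emeasure_space_1 by simp
  qed simp
qed

lemma code_symbol_moments:
  assumes k: "k \<in> {1..K}" and b: "b \<in> {1..B}" and t: "t \<in> {1..data_len P}"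
  shows "(LINT x|code_space P B (gaussian_code P B Ms gh sg \<gamma>). code_symbol k b t x) = 0"
    "(LINT x|code_space P B (gaussian_code P B Ms gh sg \<gamma>). (cmod (code_symbol k b t x))\<^sup>2) = 1"
proof -
  note d = distr_code_symbol[OF assms]
  have "(LINT x|(message_space \<Otimes>\<^sub>M (cb_space \<Otimes>\<^sub>M channel_space)). code_symbol k b t x) = (LINT z|CN01. z)"
    using integral_distr[OF d(1), of "\<lambda>z. z"] unfolding d(2) by (simp cong: measurable_cong_sets)
  then show "(LINT x|code_space P B (gaussian_code P B Ms gh sg \<gamma>). code_symbol k b t x) = 0"
    by (simp add: code_space_gaussian_code integral_CN01_id)
  have "(LINT x|(message_space \<Otimes>\<^sub>M (cb_space \<Otimes>\<^sub>M channel_space)). (cmod (code_symbol k b t x))\<^sup>2) = (LINT z|CN01. (cmod z)\<^sup>2)"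
    using integral_distr[OF d(1), of "\<lambda>z. (cmod z)\<^sup>2"] unfolding d(2) by (simp cong: measurable_cong_sets)
  then show "(LINT x|code_space P B (gaussian_code P B Ms gh sg \<gamma>). (cmod (code_symbol k b t x))\<^sup>2) = 1"
    by (simp add: code_space_gaussian_code integral_CN01_norm_square)
qed

lemma total_score_measurable:
  assumes gh: "gh \<in> borel_measurable (pilot_space P)" and sg: "sg \<in> borel_measurable (pilot_space P)"
    and w: "w < M"
  shows "(\<lambda>z. total_score P B gh sg z w) \<in> borel_measurable
    (gaussian_vector ({..<M} \<times> {1..B} \<times> {1..data_len P}) \<Otimes>\<^sub>M
      (matrix_space B (fwd_len P) \<Otimes>\<^sub>M matrix_space B (data_len P)))"
  unfolding total_score_def split_beta'
proof (intro borel_measurable_sum score_measurable[OF gh sg])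
  fix b t assume b: "b \<in> {1..B}" and t: "t \<in> {1..data_len P}"
  let ?N = "gaussian_vector ({..<M} \<times> {1..B} \<times> {1..data_len P}) \<Otimes>\<^sub>M
      (matrix_space B (fwd_len P) \<Otimes>\<^sub>M matrix_space B (data_len P))"
  have fs: "(\<lambda>z. fst (snd z)) \<in> ?N \<rightarrow>\<^sub>M matrix_space B (fwd_len P)"
    and ss: "(\<lambda>z. snd (snd z)) \<in> ?N \<rightarrow>\<^sub>M matrix_space B (data_len P)"
    by (intro measurable_compose[OF measurable_snd measurable_fst] measurable_compose[OF measurable_snd measurable_snd])+
  show "(\<lambda>z. \<lambda>s\<in>{1..fwd_len P}. fst (snd z) (b, s)) \<in> ?N \<rightarrow>\<^sub>M pilot_space P"
    unfolding pilot_space_def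
  proof (rule measurable_restrict)
    fix s assume s: "s \<in> {1..fwd_len P}"
    have "(\<lambda>x. x (b, s)) \<in> borel_measurable (matrix_space B (fwd_len P))"
      unfolding matrix_space_def using b s by (intro measurable_component_singleton) auto
    then show "(\<lambda>z. fst (snd z) (b, s)) \<in> borel_measurable ?N"
      by (rule measurable_compose[OF fs])
  qed
  have "(\<lambda>x. x (b, t)) \<in> borel_measurable (matrix_space B (data_len P))"
    unfolding matrix_space_def using b t by (intro measurable_component_singleton) auto
  then show "(\<lambda>z. snd (snd z) (b, t)) \<in> borel_measurable ?N"
    by (rule measurable_compose[OF ss])
  show "(\<lambda>z. fst z (w, b, t)) \<in> borel_measurable ?N"
    using b t w by (intro measurable_gaussian_componentI[OF measurable_fst]) auto
qed

lemma coding_scheme_gaussian_code: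
  assumes gh: "\<And>j. j \<in> {1..K} \<Longrightarrow> gh j \<in> borel_measurable (pilot_space P)"
    and sg: "\<And>j. j \<in> {1..K} \<Longrightarrow> sg j \<in> borel_measurable (pilot_space P)"
  shows "coding_scheme P B (gaussian_code P B Ms gh sg \<gamma>)"
  unfolding coding_scheme_def
proof (intro ballI conjI)
  fix j assume j: "j \<in> {1..K}"
  show "1 \<le> n_messages (gaussian_code P B Ms gh sg \<gamma>) j"
    using Ms[OF j] by (simp add: gaussian_code_def)
  show "prob_space (codebook_dist (gaussian_code P B Ms gh sg \<gamma>) j)"
    by (simp add: gaussian_code_def prob_space_gaussian_vector)
  show "sets (codebook_dist (gaussian_code P B Ms gh sg \<gamma>) j) =
       sets (\<Pi>\<^sub>M i\<in>{..<n_messages (gaussian_code P B Ms gh sg \<gamma>) j} \<times> {1..B} \<times> {1..data_len P}. borel)"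
    by (auto simp: gaussian_code_def intro!: sets_PiM_cong)
  show "decoder (gaussian_code P B Ms gh sg \<gamma>) j \<in> measurable
       (codebook_dist (gaussian_code P B Ms gh sg \<gamma>) j \<Otimes>\<^sub>M (matrix_space B (fwd_len P) \<Otimes>\<^sub>M matrix_space B (data_len P)))
       (count_space UNIV)"
    unfolding gaussian_code_def code.simps
  proof (rule measurable_Least)
    fix w
    show "(\<lambda>z. w < Ms j \<and> \<gamma> j < total_score P B (gh j) (sg j) z w) \<in> measurable
      (gaussian_vector (cb_index j) \<Otimes>\<^sub>M (matrix_space B (fwd_len P) \<Otimes>\<^sub>M matrix_space B (data_len P))) (count_space UNIV)"
    proof (cases "w < Ms j")
      case True
      have "(\<lambda>z. total_score P B (gh j) (sg j) z w) \<in> borel_measurable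
        (gaussian_vector (cb_index j) \<Otimes>\<^sub>M (matrix_space B (fwd_len P) \<Otimes>\<^sub>M matrix_space B (data_len P)))"
        by (rule total_score_measurable[OF gh[OF j] sg[OF j] True])
      from borel_measurable_pred_less[OF borel_measurable_const this] show ?thesis
        using True by simp
    qed simp
  qed
  fix b t assume "b \<in> {1..B}" "t \<in> {1..data_len P}"
  then show "(LINT x|code_space P B (gaussian_code P B Ms gh sg \<gamma>). code_symbol j b t x) = 0"
    "(LINT x|code_space P B (gaussian_code P B Ms gh sg \<gamma>). (cmod (code_symbol j b t x))\<^sup>2) = 1"
    using j by (simp_all only: code_symbol_moments)
qed

end

section \<open>Error probability\<close>

lemma level_sets_measurable:
  fixes f :: "'z \<Rightarrow> real"
  assumes "f \<in> borel_measurable N"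
  shows "{x \<in> space N. f x \<le> c} \<in> sets N" "{x \<in> space N. c < f x} \<in> sets N"
  using assms by measurable

locale block_decoder = user_decoder P k gh sg + block_code P B Ms for P k gh sg B Ms
begin

text \<open>Locates the coordinates of interval \<open>b\<close> in the flat vector when the
  messages \<open>v\<close> are sent: the symbols of user \<open>j\<close> are read from codeword
  \<open>v j\<close>.\<close>

definition embed :: "(nat \<Rightarrow> nat) \<Rightarrow> nat \<Rightarrow> nat \<times> nat + gaussian_source \<Rightarrow> (nat \<times> nat \<times> nat \<times> nat) + (nat \<times> gaussian_source)" where
  "embed v b i = (case i of Inl (j, t) \<Rightarrow> Inl (j, v j, b, t) | Inr s \<Rightarrow> Inr (b, s))"

definition block :: "(nat \<Rightarrow> nat) \<Rightarrow> nat \<Rightarrow>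
    ((nat \<times> nat \<times> nat \<times> nat) + (nat \<times> gaussian_source) \<Rightarrow> complex) \<Rightarrow> nat \<times> nat + gaussian_source \<Rightarrow> complex" where
  "block v b x = (\<lambda>i\<in>symbol_index <+> gaussian_sources P. x (embed v b i))"

text \<open>The messages \<open>v\<close> fix what is transmitted and received, while
  \<open>w\<close> is the codeword being tested; the correct case is \<open>w = v k\<close>.\<close>

definition flat_score where
  "flat_score v w x = (\<Sum>b=1..B. \<Sum>t=1..n. score gh sg (pilot_received P k (sources (block v b x)))
     (data_signal t (block v b x)) (x (Inl (k, w, b, t))))"

lemma embed_mem:
  assumes "v \<in> messages" "b \<in> {1..B}" "i \<in> symbol_index <+> gaussian_sources P"
  shows "embed v b i \<in> flat_index"
  using assms(3)
proof (rule PlusE)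
  fix jt assume i: "i = Inl jt" and jt: "jt \<in> symbol_index"
  then show ?thesis
    using assms(1,2) by (auto simp: embed_def symbol_index_def PiE_iff)
next
  fix s assume i: "i = Inr s" and s: "s \<in> gaussian_sources P"
  then show ?thesis
    using assms(2) by (auto simp: embed_def)
qed

lemma block_measurable:
  assumes "v \<in> messages" "b \<in> {1..B}"
  shows "block v b \<in> V \<rightarrow>\<^sub>M U"
  unfolding block_def[abs_def]
  by (intro measurable_restrict measurable_component_singleton embed_mem assms)

lemma flat_score_measurable:
  assumes v: "v \<in> messages" and w: "w < Ms k"
  shows "flat_score v w \<in> borel_measurable V"
  unfolding flat_score_def[abs_def]
proof (intro borel_measurable_sum score_measurable[OF gh sg])
  fix b t assume b: "b \<in> {1..B}" and t: "t \<in> {1..n}"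
  note m = block_measurable[OF v b]
  show "(\<lambda>x. pilot_received P k (sources (block v b x))) \<in> V \<rightarrow>\<^sub>M pilot_space P"
    by (rule measurable_compose[OF m measurable_compose[OF sources_measurable pilot_k_measurable]])
  show "(\<lambda>x. data_signal t (block v b x)) \<in> borel_measurable V"
    by (rule measurable_compose[OF m data_signal_measurable[OF t]])
  show "(\<lambda>x. x (Inl (k, w, b, t))) \<in> borel_measurable V"
    using k w b t by (intro measurable_gaussian_component) auto
qed

lemma flat_score_own:
  assumes v: "v \<in> messages"
  shows "flat_score v (v k) x = (\<Sum>b=1..B. interval_score (block v b x))"
proof -
  have "block v b x (Inl (k, t)) = x (Inl (k, v k, b, t))" if "t \<in> {1..n}" for b t
    using k that by (auto simp: block_def embed_def symbol_index_def)
  then show ?thesis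
    unfolding flat_score_def interval_score_def by (intro sum.cong refl) simp
qed

text \<open>Connects the operational decoder with the flat space on which probabilities are
  computed: sources, symbols and noise of interval \<open>b\<close> are recovered coordinate by
  coordinate.\<close>

lemma total_score_flatten:
  assumes v: "v \<in> messages" and C\<omega>: "(C, \<omega>) \<in> space (cb_space \<Otimes>\<^sub>M channel_space)" and w: "w < Ms k"
  shows "total_score P B gh sg (C k, all_pilots_received P B k (v, C, \<omega>), all_data_received P B k (v, C, \<omega>)) w =
    flat_score v w (flatten (C, \<omega>))"
  unfolding total_score_def flat_score_def case_prod_conv
proof (intro sum.cong refl)
  fix b t assume b: "b \<in> {1..B}" and t: "t \<in> {1..n}"
  let ?u = "block v b (flatten (C, \<omega>))"
  have \<omega>b: "\<omega> b \<in> space I"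
    using C\<omega> b by (auto simp: space_pair_measure space_PiM)
  have "sources ?u i = \<omega> b i" for i
  proof (cases "i \<in> gaussian_sources P")
    case True
    then have "sources ?u i = flatten (C, \<omega>) (Inr (b, i))"
      by (auto simp: sources_def block_def embed_def)
    also have "\<dots> = \<omega> b i" by (rule flatten_channel[OF b True])
    finally show ?thesis .
  next
    case False
    then show ?thesis using \<omega>b by (simp add: sources_def space_interval_space)
  qed
  then have src: "sources ?u = \<omega> b" by (rule ext)
  have 1: "(\<lambda>s\<in>{1..fwd_len P}. all_pilots_received P B k (v, C, \<omega>) (b, s)) = pilot_received P k (sources ?u)"
    unfolding src using b by (auto simp: all_pilots_received_def pilot_received_def fun_eq_iff)
  have sym: "?u (Inl (j, t)) = C j (v j, b, t)" if j: "j \<in> {1..K}" for j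
  proof -
    have "?u (Inl (j, t)) = flatten (C, \<omega>) (Inl (j, v j, b, t))"
      using j t by (auto simp: block_def embed_def symbol_index_def)
    also have "\<dots> = C j (v j, b, t)"
      using j v b t by (intro flatten_codebook) (auto simp: PiE_iff)
    finally show ?thesis .
  qed
  have noise: "?u (Inr (Data_Noise k t)) = \<omega> b (Data_Noise k t)"
  proof -
    have d: "Data_Noise k t \<in> gaussian_sources P" using k t by simp
    then have "?u (Inr (Data_Noise k t)) = flatten (C, \<omega>) (Inr (b, Data_Noise k t))"
      by (auto simp: block_def embed_def)
    also have "\<dots> = \<omega> b (Data_Noise k t)" by (rule flatten_channel[OF b d])
    finally show ?thesis .
  qed
  have 2: "all_data_received P B k (v, C, \<omega>) (b, t) = data_signal t ?u"
    unfolding data_signal_def src noise using b t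
    by (simp add: all_data_received_def code_symbol_def sym)
  have 3: "flatten (C, \<omega>) (Inl (k, w, b, t)) = C k (w, b, t)"
    by (rule flatten_codebook[OF k w b t])
  show "score gh sg (\<lambda>s\<in>{1..fwd_len P}. all_pilots_received P B k (v, C, \<omega>) (b, s))
      (all_data_received P B k (v, C, \<omega>) (b, t)) (C k (w, b, t)) =
    score gh sg (pilot_received P k (sources ?u)) (data_signal t ?u) (flatten (C, \<omega>) (Inl (k, w, b, t)))"
    unfolding 1 2 3 ..
qed

text \<open>For fixed messages, different intervals read different coordinates, since
  \<open>embed\<close> keeps the interval number. Reindexing a product of identical laws along an
  injection and then currying gives independent copies of \<open>U\<close>.\<close>

lemma distr_blocks:
  assumes v: "v \<in> messages"
  shows "(\<lambda>x. \<lambda>b\<in>{1..B}. block v b x) \<in> V \<rightarrow>\<^sub>M (\<Pi>\<^sub>M b\<in>{1..B}. U)"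
    "distr V (\<Pi>\<^sub>M b\<in>{1..B}. U) (\<lambda>x. \<lambda>b\<in>{1..B}. block v b x) = (\<Pi>\<^sub>M b\<in>{1..B}. U)"
proof -
  let ?J = "symbol_index <+> gaussian_sources P"
  define e where "e = (\<lambda>(b, i). embed v b i)"
  define r where "r x = (\<lambda>p\<in>{1..B} \<times> ?J. x (e p))" for x :: "_ \<Rightarrow> complex"
  have e: "e \<in> {1..B} \<times> ?J \<rightarrow> flat_index"
  proof
    fix p assume "p \<in> {1..B} \<times> ?J"
    then obtain b i where "p = (b, i)" "b \<in> {1..B}" "i \<in> ?J" by blast
    then show "e p \<in> flat_index" using embed_mem[OF v] by (simp only: e_def case_prod_conv)
  qed
  have inj: "inj_on e ({1..B} \<times> ?J)"
    by (rule inj_onI) (auto simp: e_def embed_def split: sum.splits)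
  have rm: "r \<in> V \<rightarrow>\<^sub>M gaussian_vector ({1..B} \<times> ?J)"
    unfolding r_def[abs_def] by (intro measurable_restrict measurable_component_singleton) (use e in blast)
  have r: "distr V (gaussian_vector ({1..B} \<times> ?J)) r = gaussian_vector ({1..B} \<times> ?J)"
    unfolding r_def[abs_def] by (rule distr_PiM_reindex[OF CN01.prob_space_axioms inj e])
  have eq: "curry_vector {1..B} ?J \<circ> r = (\<lambda>x. \<lambda>b\<in>{1..B}. block v b x)"
    by (auto simp: curry_vector_def r_def block_def e_def fun_eq_iff)
  show "(\<lambda>x. \<lambda>b\<in>{1..B}. block v b x) \<in> V \<rightarrow>\<^sub>M (\<Pi>\<^sub>M b\<in>{1..B}. U)"
    by (intro measurable_restrict block_measurable v)
  have "distr V (\<Pi>\<^sub>M b\<in>{1..B}. U) (\<lambda>x. \<lambda>b\<in>{1..B}. block v b x) =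
    distr (distr V (gaussian_vector ({1..B} \<times> ?J)) r) (\<Pi>\<^sub>M b\<in>{1..B}. U) (curry_vector {1..B} ?J)"
    unfolding eq[symmetric] by (rule distr_distr[OF curry_vector_measurable rm, symmetric])
  also have "\<dots> = (\<Pi>\<^sub>M b\<in>{1..B}. U)"
    unfolding r by (rule distr_curry_vector) auto
  finally show "distr V (\<Pi>\<^sub>M b\<in>{1..B}. U) (\<lambda>x. \<lambda>b\<in>{1..B}. block v b x) = (\<Pi>\<^sub>M b\<in>{1..B}. U)" .
qed

text \<open>The score of the sent codeword is the sum of interval scores over the blocks, whose
  joint law is known. The resulting probability no longer depends on \<open>v\<close>.\<close>

lemma own_codeword_missed:
  assumes v: "v \<in> messages"
  shows "emeasure V {x \<in> space V. flat_score v (v k) x \<le> c} =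
    emeasure (\<Pi>\<^sub>M b\<in>{1..B}. U) {y \<in> space (\<Pi>\<^sub>M b\<in>{1..B}. U). (\<Sum>b=1..B. interval_score (y b)) \<le> c}"
proof -
  let ?N = "\<Pi>\<^sub>M b\<in>{1..B}. U" and ?T = "\<lambda>x. \<lambda>b\<in>{1..B}. block v b x"
  note d = distr_blocks[OF v]
  have "(\<lambda>y. \<Sum>b=1..B. interval_score (y b)) \<in> borel_measurable ?N"
    by (intro borel_measurable_sum measurable_compose[OF _ interval_score_measurable] measurable_component_singleton)
  then have S: "{y \<in> space ?N. (\<Sum>b=1..B. interval_score (y b)) \<le> c} \<in> sets ?N"
    by (rule level_sets_measurable)
  have "emeasure ?N {y \<in> space ?N. (\<Sum>b=1..B. interval_score (y b)) \<le> c} =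
    emeasure (distr V ?N ?T) {y \<in> space ?N. (\<Sum>b=1..B. interval_score (y b)) \<le> c}"
    by (simp only: d(2))
  also have "\<dots> = emeasure V (?T -` {y \<in> space ?N. (\<Sum>b=1..B. interval_score (y b)) \<le> c} \<inter> space V)"
    by (rule emeasure_distr[OF d(1) S])
  also have "?T -` {y \<in> space ?N. (\<Sum>b=1..B. interval_score (y b)) \<le> c} \<inter> space V =
      {x \<in> space V. flat_score v (v k) x \<le> c}"
    using measurable_space[OF d(1)] by (auto simp: flat_score_own[OF v])
  finally show ?thesis ..
qed

text \<open>Given everything that the received signals depend on, the symbols of a wrong codeword are
  independent of them, and each factor of the exponentiated score has mean 1.\<close>

lemma nn_integral_exp_wrong_score:
  assumes v: "v \<in> messages" and w: "w < Ms k" "w \<noteq> v k"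
  shows "(\<integral>\<^sup>+x. ennreal (exp (flat_score v w x)) \<partial>V) = 1"
proof -
  interpret product_sigma_finite "\<lambda>_::(nat \<times> nat \<times> nat \<times> nat) + (nat \<times> gaussian_source). CN01" by standard
  define T where "T = {1..B} \<times> {1..n}"
  define \<kappa> where "\<kappa> = (\<lambda>(b, t). Inl (k, w, b, t) :: (nat \<times> nat \<times> nat \<times> nat) + (nat \<times> gaussian_source))"
  \<comment> \<open>\<open>I1\<close> holds the symbols of the wrong codeword of user
    \<open>k\<close>, \<open>I2\<close> all other coordinates; the integral over \<open>I1\<close>
    is taken with \<open>I2\<close> frozen.\<close>
  define I1 where "I1 = \<kappa> ` T"
  define I2 where "I2 = flat_index - I1"
  have fin: "finite T" "finite I1" "finite I2" by (auto simp: T_def I1_def I2_def)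
  have sub: "I1 \<subseteq> flat_index" using k w by (auto simp: I1_def \<kappa>_def T_def)
  have dj: "I2 \<inter> I1 = {}" and un: "I2 \<union> I1 = flat_index" using sub by (auto simp: I2_def)
  have inj: "inj_on \<kappa> T" by (auto simp: inj_on_def \<kappa>_def)
  interpret P2: prob_space "gaussian_vector I2" by (rule prob_space_gaussian_vector)
  have m: "(\<lambda>x. ennreal (exp (flat_score v w x))) \<in> borel_measurable (gaussian_vector (I2 \<union> I1))"
    unfolding un by (intro measurable_compose[OF _ measurable_ennreal] measurable_compose[OF _ borel_measurable_exp]
        flat_score_measurable v w)
  have inner: "(\<integral>\<^sup>+z. ennreal (exp (flat_score v w (merge I2 I1 (y, z)))) \<partial>gaussian_vector I1) = 1" for y
  proof -
    define x0 where "x0 = merge I2 I1 (y, \<lambda>_. 0)"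
    define S where "S b = pilot_received P k (sources (block v b x0))" for b
    define Y where "Y b t = data_signal t (block v b x0)" for b t
    define f where "f p q = ennreal (exp (score gh sg (S (fst p)) (Y (fst p) (snd p)) q))" for p q
    \<comment> \<open>User \<open>k\<close> transmits codeword \<open>v k\<close>, and
      \<open>w \<noteq> v k\<close> keeps every coordinate read by \<open>block v b\<close> outside
      \<open>I1\<close>. Hence the zeros put into \<open>x0\<close> there do not affect the received
      signals.\<close>
    have blk: "block v b (merge I2 I1 (y, z)) = block v b x0" if b: "b \<in> {1..B}" for b z
    proof -
      have "merge I2 I1 (y, z) (embed v b i) = x0 (embed v b i)" if i: "i \<in> symbol_index <+> gaussian_sources P" for i
      proof -
        have "embed v b i \<notin> I1"
          using w by (auto simp: I1_def \<kappa>_def embed_def split: sum.splits)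
        then have "embed v b i \<in> I2" using embed_mem[OF v b i] by (simp add: I2_def)
        then show ?thesis using dj by (simp add: x0_def)
      qed
      then show ?thesis unfolding block_def by (intro restrict_ext)
    qed
    \<comment> \<open>The exponential of the sum is a product with one factor per coordinate of
      \<open>I1\<close>; \<open>inv_into\<close> recovers interval and time from the
      coordinate.\<close>
    have "ennreal (exp (flat_score v w (merge I2 I1 (y, z)))) = (\<Prod>i\<in>I1. f (inv_into T \<kappa> i) (z i))" for z
    proof -
      have "flat_score v w (merge I2 I1 (y, z)) =
        (\<Sum>b=1..B. \<Sum>t=1..n. score gh sg (S b) (Y b t) (z (\<kappa> (b, t))))"
        unfolding flat_score_def
      proof (intro sum.cong refl)
        fix b t assume b: "b \<in> {1..B}" and t: "t \<in> {1..n}"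
        have "\<kappa> (b, t) \<in> I1" using b t by (auto simp: I1_def T_def)
        then have "merge I2 I1 (y, z) (Inl (k, w, b, t)) = z (\<kappa> (b, t))"
          using dj by (simp add: \<kappa>_def)
        then show "score gh sg (pilot_received P k (sources (block v b (merge I2 I1 (y, z)))))
            (data_signal t (block v b (merge I2 I1 (y, z)))) (merge I2 I1 (y, z) (Inl (k, w, b, t))) =
          score gh sg (S b) (Y b t) (z (\<kappa> (b, t)))"
          by (simp only: blk[OF b] S_def Y_def)
      qed
      also have "\<dots> = (\<Sum>p\<in>T. score gh sg (S (fst p)) (Y (fst p) (snd p)) (z (\<kappa> p)))"
        unfolding T_def by (simp add: sum.cartesian_product split_beta')
      finally have "ennreal (exp (flat_score v w (merge I2 I1 (y, z)))) = (\<Prod>p\<in>T. f p (z (\<kappa> p)))"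
        using fin by (simp add: exp_sum f_def prod_ennreal)
      also have "\<dots> = (\<Prod>i\<in>I1. f (inv_into T \<kappa> i) (z i))"
        unfolding I1_def prod.reindex[OF inj] by (intro prod.cong) (simp_all add: inv_into_f_f[OF inj])
      finally show ?thesis .
    qed
    then have "(\<integral>\<^sup>+z. ennreal (exp (flat_score v w (merge I2 I1 (y, z)))) \<partial>gaussian_vector I1) =
      (\<integral>\<^sup>+z. (\<Prod>i\<in>I1. f (inv_into T \<kappa> i) (z i)) \<partial>gaussian_vector I1)"
      by simp
    also have "\<dots> = (\<Prod>i\<in>I1. integral\<^sup>N CN01 (f (inv_into T \<kappa> i)))"
    proof (rule product_nn_integral_prod[OF fin(2)])
      fix i
      have id: "(\<lambda>q. q) \<in> borel_measurable CN01"
        by (simp cong: measurable_cong_sets)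
      have "(\<lambda>q. score gh sg s y' q) \<in> borel_measurable CN01" for s y'
        \<comment> \<open>The pilots are constant in \<open>q\<close>, so the discrete sigma-algebra
          on their space settles the measurability of \<open>gh\<close> and
          \<open>sg\<close>.\<close>
        by (rule score_measurable[where N = "count_space UNIV" and s = "\<lambda>_. s"]) (simp_all add: id)
      then show "f (inv_into T \<kappa> i) \<in> borel_measurable CN01"
        unfolding f_def by (intro measurable_compose[OF _ measurable_ennreal] measurable_compose[OF _ borel_measurable_exp])
    qed
    also have "\<dots> = 1"
      unfolding f_def using sg_ge_1 by (intro prod.neutral ballI nn_integral_exp_score) (rule less_le_trans[OF zero_less_one])
    finally show ?thesis .
  qed
  have "(\<integral>\<^sup>+x. ennreal (exp (flat_score v w x)) \<partial>V) = (\<integral>\<^sup>+y. 1 \<partial>gaussian_vector I2)"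
    unfolding product_nn_integral_fold[OF dj fin(3,2) m, unfolded un] inner ..
  then show ?thesis by (simp add: P2.emeasure_space_1)
qed

lemma wrong_codeword_accepted:
  assumes v: "v \<in> messages" and w: "w < Ms k" "w \<noteq> v k"
  shows "emeasure V {x \<in> space V. c < flat_score v w x} \<le> ennreal (exp (- c))"
proof -
  have fm: "flat_score v w \<in> borel_measurable V" by (rule flat_score_measurable[OF v w(1)])
  have "emeasure V {x \<in> space V. c < flat_score v w x} = (\<integral>\<^sup>+x. indicator {x \<in> space V. c < flat_score v w x} x \<partial>V)"
    using level_sets_measurable(2)[OF fm] by simp
  also have "\<dots> \<le> (\<integral>\<^sup>+x. ennreal (exp (- c)) * ennreal (exp (flat_score v w x)) \<partial>V)"
  proof (rule nn_integral_mono)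
    fix x
    show "indicator {x \<in> space V. c < flat_score v w x} x \<le> ennreal (exp (- c)) * ennreal (exp (flat_score v w x))"
      by (cases "c < flat_score v w x")
         (auto simp: ennreal_mult[symmetric] mult_exp_exp indicator_def simp flip: ennreal_1 intro!: ennreal_leI)
  qed
  also have "\<dots> = ennreal (exp (- c))"
    using nn_integral_exp_wrong_score[OF v w]
    by (subst nn_integral_cmult[OF measurable_compose[OF measurable_compose[OF fm borel_measurable_exp] measurable_ennreal]])
      simp
  finally show ?thesis .
qed

text \<open>The estimate is made for each message vector and does not depend on it, so averaging
  over messages preserves it. The sent message has \<open>Ms k - 1\<close> competitors; the
  reduction by one later absorbs the rounding of the codebook size.\<close>

lemma error_probability_le:
  assumes ghs: "ghs k = gh" and sgs: "sgs k = sg"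
  shows "error_probability P B (gaussian_code P B Ms ghs sgs \<gamma>) k \<le>
    measure (\<Pi>\<^sub>M b\<in>{1..B}. U) {y \<in> space (\<Pi>\<^sub>M b\<in>{1..B}. U). (\<Sum>b=1..B. interval_score (y b)) \<le> \<gamma> k} +
    (real (Ms k) - 1) * exp (- \<gamma> k)"
    (is "_ \<le> measure ?N ?S + _")
proof -
  let ?M = "message_space \<Otimes>\<^sub>M (cb_space \<Otimes>\<^sub>M channel_space)"
  interpret W: prob_space message_space by (rule prob_space_message_space)
  interpret R: prob_space "cb_space \<Otimes>\<^sub>M channel_space" by (rule prob_space_rest)
  interpret MR: pair_prob_space message_space "cb_space \<Otimes>\<^sub>M channel_space" ..
  interpret N: prob_space ?N by (intro prob_space_PiM prob_space_gaussian_vector)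
  have sp: "space message_space = messages"
    by (simp add: space_PiM space_uniform_count_measure)
  define miss where "miss v = {x \<in> space V. flat_score v (v k) x \<le> \<gamma> k}" for v
  define acc where "acc v w = {x \<in> space V. \<gamma> k < flat_score v w x}" for v w
  define bad where "bad v = miss v \<union> (\<Union>w\<in>{..<Ms k} - {v k}. acc v w)" for v
  have vk: "v k < Ms k" if "v \<in> messages" for v using that k by (auto simp: PiE_iff)
  have ms: "miss v \<in> sets V" if "v \<in> messages" for v
    unfolding miss_def by (intro level_sets_measurable flat_score_measurable that vk)
  have as: "acc v w \<in> sets V" if "v \<in> messages" "w < Ms k" for v w
    unfolding acc_def by (intro level_sets_measurable flat_score_measurable that)
  have bs: "bad v \<in> sets V" if "v \<in> messages" for v
    unfolding bad_def using that by (intro sets.Un ms sets.finite_UN as) auto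
  define E where "E v = flatten -` bad v \<inter> space (cb_space \<Otimes>\<^sub>M channel_space)" for v
  have Es: "E v \<in> sets (cb_space \<Otimes>\<^sub>M channel_space)" if "v \<in> messages" for v
    unfolding E_def by (rule measure_flatten(1)[OF bs[OF that]])
  define G where "G = {(W, r). W \<in> messages \<and> r \<in> E W}"
  define bound where "bound = measure ?N ?S + (real (Ms k) - 1) * exp (- \<gamma> k)"
  have Mk: "real (Ms k) - 1 \<ge> 0" using Ms[OF k] by simp
  have b0: "bound \<ge> 0" unfolding bound_def using Mk by simp
  have Eb: "emeasure (cb_space \<Otimes>\<^sub>M channel_space) (E v) \<le> ennreal bound" if v: "v \<in> messages" for v
  proof -
    have "emeasure (cb_space \<Otimes>\<^sub>M channel_space) (E v) = emeasure V (bad v)"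
      unfolding E_def by (rule measure_flatten(2)[OF bs[OF v]])
    also have "\<dots> \<le> emeasure V (miss v) + emeasure V (\<Union>w\<in>{..<Ms k} - {v k}. acc v w)"
      unfolding bad_def using v by (intro emeasure_subadditive ms sets.finite_UN as) auto
    also have "emeasure V (miss v) = ennreal (measure ?N ?S)"
      unfolding miss_def own_codeword_missed[OF v] by (rule N.emeasure_eq_measure)
    also have "emeasure V (\<Union>w\<in>{..<Ms k} - {v k}. acc v w) \<le> (\<Sum>w\<in>{..<Ms k} - {v k}. emeasure V (acc v w))"
      using v as by (intro emeasure_subadditive_finite) auto
    also have "\<dots> \<le> (\<Sum>w\<in>{..<Ms k} - {v k}. ennreal (exp (- \<gamma> k)))"
      unfolding acc_def using v by (intro sum_mono wrong_codeword_accepted) auto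
    also have "\<dots> = ennreal ((real (Ms k) - 1) * exp (- \<gamma> k))"
      using vk[OF v] Ms[OF k] by (simp add: card_Diff_singleton ennreal_of_nat_eq_real_of_nat ennreal_mult[symmetric] of_nat_diff)
    also have "ennreal (measure ?N ?S) + ennreal ((real (Ms k) - 1) * exp (- \<gamma> k)) = ennreal bound"
      unfolding bound_def using Mk by (intro ennreal_plus[symmetric]) auto
    finally show ?thesis by (simp add: add_left_mono)
  qed
  have G: "G \<in> sets ?M" and eG: "emeasure ?M G = (\<integral>\<^sup>+W. emeasure (cb_space \<Otimes>\<^sub>M channel_space) (E W) \<partial>message_space)"
    unfolding G_def by (rule emeasure_message_slices(1)[OF Es], simp, rule emeasure_message_slices(2)[OF Es])
  have "emeasure ?M G \<le> (\<integral>\<^sup>+W. ennreal bound \<partial>message_space)"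
    unfolding eG by (intro nn_integral_mono Eb) (simp only: sp)
  also have "\<dots> = ennreal bound" by (simp only: nn_integral_const W.emeasure_space_1 mult_1_right)
  finally have mG: "measure ?M G \<le> bound"
    unfolding MR.emeasure_eq_measure ennreal_le_iff[OF b0] .
  let ?dec = "decoder (gaussian_code P B Ms ghs sgs \<gamma>) k"
  \<comment> \<open>Outside \<open>G\<close> the sent message passes the threshold and no other
    does, so \<open>LEAST\<close> returns it.\<close>
  have "{(W, C, \<omega>) \<in> space ?M.
      ?dec (C k, all_pilots_received P B k (W, C, \<omega>), all_data_received P B k (W, C, \<omega>)) \<noteq> W k} \<subseteq> G"
  proof (clarify, rule ccontr)
    fix W C \<omega>
    assume in_sp: "(W, C, \<omega>) \<in> space ?M"
      and err: "?dec (C k, all_pilots_received P B k (W, C, \<omega>), all_data_received P B k (W, C, \<omega>)) \<noteq> W k"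
      and nG: "(W, C, \<omega>) \<notin> G"
    have W: "W \<in> messages" and C\<omega>: "(C, \<omega>) \<in> space (cb_space \<Otimes>\<^sub>M channel_space)"
      using in_sp unfolding space_pair_measure[of message_space] sp by auto
    let ?x = "flatten (C, \<omega>)"
    have x: "?x \<in> space V" using C\<omega> by (rule measurable_space[OF flatten_measurable])
    have nb: "?x \<notin> bad W" using nG W C\<omega> by (auto simp: G_def E_def)
    have own: "\<gamma> k < flat_score W (W k) ?x" using nb x by (auto simp: bad_def miss_def not_le)
    have other: "\<not> \<gamma> k < flat_score W w ?x" if "w < Ms k" "w \<noteq> W k" for w
      using nb x that by (auto simp: bad_def acc_def)
    have "?dec (C k, all_pilots_received P B k (W, C, \<omega>), all_data_received P B k (W, C, \<omega>)) =
      (LEAST w. w < Ms k \<and> \<gamma> k < flat_score W w ?x)"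
    proof -
      have "(w < Ms k \<and> \<gamma> k < total_score P B gh sg
           (C k, all_pilots_received P B k (W, C, \<omega>), all_data_received P B k (W, C, \<omega>)) w) \<longleftrightarrow>
         (w < Ms k \<and> \<gamma> k < flat_score W w ?x)" for w
        using total_score_flatten[OF W C\<omega>, of w] by auto
      then show ?thesis by (simp only: gaussian_code_def code.simps ghs sgs)
    qed
    also have "\<dots> = W k"
    proof (rule Least_equality)
      show "W k < Ms k \<and> \<gamma> k < flat_score W (W k) ?x" using own vk[OF W] by simp
      fix w assume "w < Ms k \<and> \<gamma> k < flat_score W w ?x"
      then show "W k \<le> w" using other[of w] by auto
    qed
    finally show False using err by contradiction
  qed
  then have "error_probability P B (gaussian_code P B Ms ghs sgs \<gamma>) k \<le> measure ?M G"
    unfolding error_probability_def code_space_gaussian_code by (intro MR.finite_measure_mono G)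
  with mG show ?thesis unfolding bound_def by (rule order_trans[rotated])
qed

end

section \<open>Codebook sizes, thresholds and the limit\<close>

context trained_downlink
begin

lemma user_decoder_exists:
  assumes "k \<in> {1..K}"
  shows "\<exists>gh sg. user_decoder P k gh sg"
  by (rule user_rate_as_pilot_function[OF assms], intro exI, rule user_decoder.intro[OF trained_downlink_axioms],
      rule user_decoder_axioms.intro[OF assms]) assumption+

text \<open>One family of codes serves all users: every error probability is averaged over all
  codebooks and messages, so the users' bounds are proved separately and hold
  simultaneously.\<close>

lemma user_rates_achievable: "achievable_rates P user_rate"
  unfolding achievable_rates_def
proof (intro allI impI)
  fix \<epsilon> :: real assume \<epsilon>: "\<epsilon> > 0"
  obtain gh sg where dec: "\<And>k. k \<in> {1..K} \<Longrightarrow> user_decoder P k (gh k) (sg k)"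
    using user_decoder_exists by metis
  define n where "n = data_len P"
  have n: "n \<ge> 1" using sys by (auto simp: n_def data_len_def downlink_system_def)
  \<comment> \<open>Rounding up gives at least one message even when the target exponent is
    negative.\<close>
  define Ms where "Ms B j = nat \<lceil>2 powr (real B * real n * (user_rate j - \<epsilon>))\<rceil>" for B :: nat and j
  \<comment> \<open>Half of the rate slack \<open>n * \<epsilon> * ln 2\<close>, in nats per
    interval. The threshold lies \<open>B * \<delta>\<close> below the mean score and
    \<open>B * \<delta>\<close> above the logarithm of the target codebook size, so both error terms
    vanish.\<close>
  define \<delta> where "\<delta> = real n * \<epsilon> * ln 2 / 2"
  define \<gamma> where "\<gamma> B j = real B * (real n * (user_rate j * ln 2) - \<delta>)" for B :: nat and j
  have \<delta>: "\<delta> > 0" using \<epsilon> n by (simp add: \<delta>_def)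
  have Ms_pos: "Ms B j \<ge> 1" for B j
  proof -
    have "\<lceil>2 powr (real B * real n * (user_rate j - \<epsilon>))\<rceil> > 0" by simp
    then show ?thesis unfolding Ms_def by linarith
  qed
  have Ms_ge: "2 powr (real B * real n * (user_rate j - \<epsilon>)) \<le> real (Ms B j)" for B j
    unfolding Ms_def by linarith
  \<comment> \<open>Rounding up adds less than one message, which the exclusion of the correct
    message compensates.\<close>
  have Ms_le: "real (Ms B j) - 1 \<le> 2 powr (real B * real n * (user_rate j - \<epsilon>))" for B j
  proof -
    have "0 < 2 powr (real B * real n * (user_rate j - \<epsilon>))" by simp
    then show ?thesis unfolding Ms_def by linarith
  qed
  define S where "S B = gaussian_code P B (Ms B) gh sg (\<gamma> B)" for B
  have bc: "block_code P (Ms B)" for B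
    by (intro block_code.intro block_code_axioms.intro trained_downlink_axioms Ms_pos)
  show "\<exists>S. (\<forall>B\<ge>1. coding_scheme P B (S B) \<and>
        (\<forall>k\<in>{1..K}. 2 powr (real B * real (data_len P) * (user_rate k - \<epsilon>)) \<le> real (n_messages (S B) k))) \<and>
     (\<forall>k\<in>{1..K}. (\<lambda>B. error_probability P B (S B) k) \<longlonglongrightarrow> 0)"
  proof (intro exI[of _ S] conjI allI impI ballI)
    fix B :: nat
    show "coding_scheme P B (S B)"
      unfolding S_def
      by (rule block_code.coding_scheme_gaussian_code[OF bc])
         (use dec user_decoder.gh user_decoder.sg in blast)+
    fix k
    show "2 powr (real B * real (data_len P) * (user_rate k - \<epsilon>)) \<le> real (n_messages (S B) k)"
      using Ms_ge[of B k] by (simp add: S_def gaussian_code_def n_def)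
  next
    fix k assume k: "k \<in> {1..K}"
    interpret u: user_decoder P k "gh k" "sg k" by (rule dec[OF k])
    have bd: "block_decoder P k (gh k) (sg k) (Ms B)" for B
      by (intro block_decoder.intro bc u.user_decoder_axioms)
    define p where "p B = measure (\<Pi>\<^sub>M b\<in>{1..B}. u.U) {y \<in> space (\<Pi>\<^sub>M b\<in>{1..B}. u.U).
      (\<Sum>b=1..B. u.interval_score (y b)) \<le> \<gamma> B k}" for B :: nat
    have "p \<longlonglongrightarrow> 0"
      using weak_law_lower_tail_PiM[OF prob_space_gaussian_vector u.interval_score_integral(1) \<delta>]
      unfolding u.interval_score_integral(2) p_def[abs_def] \<gamma>_def n_def .
    moreover have "(\<lambda>B. exp (- \<delta>) ^ B) \<longlonglongrightarrow> 0"
      using \<delta> by (intro LIMSEQ_power_zero) simp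
    ultimately have lim: "(\<lambda>B. p B + exp (- \<delta>) ^ B) \<longlonglongrightarrow> 0"
      using tendsto_add by fastforce
    have le: "error_probability P B (S B) k \<le> p B + exp (- \<delta>) ^ B" for B
    proof -
      have "error_probability P B (S B) k \<le> p B + (real (Ms B k) - 1) * exp (- \<gamma> B k)"
        unfolding S_def p_def by (rule block_decoder.error_probability_le[OF bd, where ghs = gh and sgs = sg, OF refl refl])
      also have "(real (Ms B k) - 1) * exp (- \<gamma> B k) \<le> 2 powr (real B * real n * (user_rate k - \<epsilon>)) * exp (- \<gamma> B k)"
        by (intro mult_right_mono Ms_le) simp
      also have "\<dots> = exp (real B * real n * (user_rate k - \<epsilon>) * ln 2 + - \<gamma> B k)"
        unfolding exp_add by (simp add: powr_def)
      also have "real B * real n * (user_rate k - \<epsilon>) * ln 2 + - \<gamma> B k = real B * - \<delta>"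
        by (simp add: \<gamma>_def \<delta>_def field_simps)
      also have "exp (real B * - \<delta>) = exp (- \<delta>) ^ B"
        by (rule exp_of_nat_mult)
      finally show ?thesis by simp
    qed
    show "(\<lambda>B. error_probability P B (S B) k) \<longlonglongrightarrow> 0"
    proof (rule tendsto_sandwich[OF _ _ tendsto_const lim])
      show "\<forall>\<^sub>F B in sequentially. 0 \<le> error_probability P B (S B) k"
        by (simp add: error_probability_def)
      show "\<forall>\<^sub>F B in sequentially. error_probability P B (S B) k \<le> p B + exp (- \<delta>) ^ B"
        by (intro always_eventually allI le)
    qed
  qed
qed

end

theorem theorem4:
  fixes P :: downlink
  assumes "downlink_system P"
  shows "achievable_weighted_sum_rate P
    (\<Sum>k=1..n_users P. weight P k *
      (LINT \<omega>|interval_space P. capacity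
        ((cmod (cond_expectation_complex (interval_space P) (pilot_received P k) (pilot_space P)
            (effective_channel P k k) \<omega>))\<^sup>2 /
         (1 + (\<Sum>i\<in>{1..n_users P} - {k}.
                cond_expectation (interval_space P) (pilot_received P k) (pilot_space P)
                  (\<lambda>\<omega>. (cmod (effective_channel P k i \<omega>))\<^sup>2) \<omega>)
            + cond_variance (interval_space P) (pilot_received P k) (pilot_space P)
                (effective_channel P k k) \<omega>))))"
proof -
  interpret trained_downlink P by standard fact
  show ?thesis
    unfolding achievable_weighted_sum_rate_def
    using user_rates_achievable unfolding user_rate_def[symmetric] by blast
qed

end
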